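(* Let $1<p<\infty$. Then for any $u\in H^p_k(\mathbb{B})$ we have $$\|u\|_{H^p}^p=|u(0)|^p+C_k\int_{\mathbb{B}}\bigl(|y|^{2-2\gamma-d}-1\bigr)\Bigl[p(p-1)|u(y)|^{p-2}|\nabla u(y)|^2+2\sum_{\alpha\in R_+}k(\alpha)\frac{F(u(y),u(\sigma_\alpha(y)))}{\langle\alpha,y\rangle^2}\Bigr]\omega_k(y)\,dy.$$ In fact, a $\Delta_k$-harmonic function $u$ on $\mathbb{B}$ belongs to $H^p_k(\mathbb{B})$ if and only if the integral above is finite.
   Context: Let $R$ be a root system in $\mathbb{R}^d$, not necessarily crystallographic and not necessarily spanning $\mathbb{R}^d$; $W$ is the associated finite reflection group, generated by the orthogonal reflections $\sigma_\alpha$ in the hyperplanes $\alpha^\perp$, $\alpha\in R$; $R_+$ is a positive subsystem; $k:R\to[0,\infty)$ is $W$-invariant. $\langle\cdot,\cdot\rangle$ and $|\cdot|$ are the Euclidean scalar product and norm. Put $\gamma=\sum_{\alpha\in R_+}k(\alpha)$ and $\omega_k(x)=\prod_{\alpha\in R_+}|\langle\alpha,x\rangle|^{2k(\alpha)}$. It is assumed throughout that $d+2\gamma>2$. Dunkl operators: $T_\xi f(x)=\partial_\xi f(x)+\sum_{\alpha\in R_+}k(\alpha)\langle\alpha,\xi\rangle\frac{f(x)-f(\sigma_\alpha x)}{\langle\alpha,x\rangle}$, $\xi\in\mathbb{R}^d$. Dunkl Laplacian: $\Delta_k=\sum_{i=1}^dT_{\xi_i}^2$ for any orthonormal basis $(\xi_i)$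 of $\mathbb{R}^d$. All functions are real-valued; a $C^2$ function $u$ on a $W$-invariant open set is $\Delta_k$-harmonic if $\Delta_ku=0$ there. $\mathbb{B}=\{x\in\mathbb{R}^d:|x|<1\}$, $\mathbb{S}=\partial\mathbb{B}$, $\sigma$ (without index) is the surface measure on $\mathbb{S}$, $d_k=\int_{\mathbb{S}}\omega_k\,d\sigma$, $C_k=\frac{1}{d_k(d+2\gamma-2)}$. The measure $\omega_k\sigma$ on $\mathbb{S}$ is given by $d\omega_k\sigma(x)=\omega_k(x)\,d\sigma(x)$, and $u_r(x):=u(rx)$ denotes the dilation of $u$ by $r$. Hardy space: for $1\le p\le\infty$, $H^p_k(\mathbb{B})$ is the family of those $\Delta_k$-harmonic functions $u$ on $\mathbb{B}$ which satisfy $$\|u\|_{H^p}:=\sup_{0\le r<1}\|u_r\|_{L^p(\omega_k\sigma)}<\infty,$$ so that for $p<\infty$, $\|u_r\|_{L^p(\omega_k\sigma)}^p=\int_{\mathbb{S}}|u(ry)|^p\omega_k(y)\,d\sigma(y)$. For $1<p<\infty$ and $a,b\in\mathbb{R}$, $F(a,b)=|b|^p-|a|^p-pa|a|^{p-2}(b-a)$, where $F(a,b)=|b|^p$ if $a=0$.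
   Formalization: The identity is proved with the left side divided by d_k (it fails for u=1 otherwise) and for roots with |α|²=2 (the coefficient 2 is wrong for other lengths, e.g. d=1, u(x)=x, p=2); the "if and only if" is proved for roots of any length. *)

theory Defs
  imports "HOL-Analysis.Analysis"
begin

section \<open>Root systems\<close>

definition reflection :: "'a::euclidean_space \<Rightarrow> 'a \<Rightarrow> 'a" where
  "reflection \<alpha> x = x - (2 * (\<alpha> \<bullet> x) / (\<alpha> \<bullet> \<alpha>)) *\<^sub>R \<alpha>"

text \<open>Reduced, but neither crystallographic nor spanning; the lengths of the roots are not
  normalised here.\<close>

definition root_system :: "'a::euclidean_space set \<Rightarrow> bool" where
  "root_system R \<longleftrightarrow> finite R \<and> 0 \<notin> R \<and>
     (\<forall>\<alpha>\<in>R. reflection \<alpha> ` R = R) \<and>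
     (\<forall>\<alpha>\<in>R. R \<inter> range (\<lambda>c. c *\<^sub>R \<alpha>) = {\<alpha>, - \<alpha>})"

definition positive_subsystem :: "'a::euclidean_space set \<Rightarrow> 'a set \<Rightarrow> bool" where
  "positive_subsystem R Rp \<longleftrightarrow>
     (\<exists>\<beta>. (\<forall>\<alpha>\<in>R. \<alpha> \<bullet> \<beta> \<noteq> 0) \<and> Rp = {\<alpha>\<in>R. \<alpha> \<bullet> \<beta> > 0})"

text \<open>Closure under inverses is automatic, since reflections are involutions.\<close>

inductive_set reflection_group :: "'a::euclidean_space set \<Rightarrow> ('a \<Rightarrow> 'a) set" for R where
  id: "id \<in> reflection_group R"
| comp: "\<alpha> \<in> R \<Longrightarrow> w \<in> reflection_group R \<Longrightarrow> reflection \<alpha> \<circ> w \<in> reflection_group R"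

definition multiplicity_function :: "'a::euclidean_space set \<Rightarrow> ('a \<Rightarrow> real) \<Rightarrow> bool" where
  "multiplicity_function R k \<longleftrightarrow>
     (\<forall>\<alpha>\<in>R. 0 \<le> k \<alpha>) \<and> (\<forall>w\<in>reflection_group R. \<forall>\<alpha>\<in>R. k (w \<alpha>) = k \<alpha>)"

definition dunkl_gamma :: "'a::euclidean_space set \<Rightarrow> ('a \<Rightarrow> real) \<Rightarrow> real" where
  "dunkl_gamma Rp k = (\<Sum>\<alpha>\<in>Rp. k \<alpha>)"

text \<open>The library has \<open>0 powr 0 = 0\<close>; here the zeroth power of \<open>0\<close> is \<open>1\<close>.\<close>

definition rpow :: "real \<Rightarrow> real \<Rightarrow> real" where
  "rpow x a = (if a = 0 then 1 else x powr a)"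

definition dunkl_weight :: "'a::euclidean_space set \<Rightarrow> ('a \<Rightarrow> real) \<Rightarrow> 'a \<Rightarrow> real" where
  "dunkl_weight Rp k x = (\<Prod>\<alpha>\<in>Rp. rpow \<bar>\<alpha> \<bullet> x\<bar> (2 * k \<alpha>))"

section \<open>Dunkl operators\<close>

text \<open>On the hyperplane orthogonal to \<open>\<alpha>\<close> the difference quotient is understood as its continuous
  extension: for \<open>f\<close> of class \<open>C\<^sup>1\<close> and \<open>\<alpha> \<bullet> x = 0\<close>, its limit at \<open>x\<close> is \<open>2 / (\<alpha> \<bullet> \<alpha>)\<close> times the
  derivative of \<open>f\<close> at \<open>x\<close> in direction \<open>\<alpha>\<close>.\<close>

definition dunkl_quotient :: "'a::euclidean_space \<Rightarrow> ('a \<Rightarrow> real) \<Rightarrow> 'a \<Rightarrow> real" where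
  "dunkl_quotient \<alpha> f x =
     (if \<alpha> \<bullet> x = 0 then 2 / (\<alpha> \<bullet> \<alpha>) * frechet_derivative f (at x) \<alpha>
      else (f x - f (reflection \<alpha> x)) / (\<alpha> \<bullet> x))"

definition dunkl_operator ::
  "'a::euclidean_space set \<Rightarrow> ('a \<Rightarrow> real) \<Rightarrow> 'a \<Rightarrow> ('a \<Rightarrow> real) \<Rightarrow> 'a \<Rightarrow> real" where
  "dunkl_operator Rp k \<xi> f x =
     frechet_derivative f (at x) \<xi> + (\<Sum>\<alpha>\<in>Rp. k \<alpha> * (\<alpha> \<bullet> \<xi>) * dunkl_quotient \<alpha> f x)"

definition dunkl_laplacian ::
  "'a::euclidean_space set \<Rightarrow> ('a \<Rightarrow> real) \<Rightarrow> ('a \<Rightarrow> real) \<Rightarrow> 'a \<Rightarrow> real" where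
  "dunkl_laplacian Rp k f x =
     (\<Sum>b\<in>Basis. dunkl_operator Rp k b (dunkl_operator Rp k b f) x)"

definition C2_on :: "'a::euclidean_space set \<Rightarrow> ('a \<Rightarrow> real) \<Rightarrow> bool" where
  "C2_on S f \<longleftrightarrow> f differentiable_on S \<and>
     (\<forall>b\<in>Basis. (\<lambda>x. frechet_derivative f (at x) b) differentiable_on S) \<and>
     (\<forall>b\<in>Basis. \<forall>c\<in>Basis. continuous_on S
        (\<lambda>x. frechet_derivative (\<lambda>y. frechet_derivative f (at y) b) (at x) c))"

text \<open>For open sets \<open>S\<close> invariant under the reflection group; then only the values of \<open>u\<close> on \<open>S\<close>
  matter.\<close>

definition dunkl_harmonic_on ::
  "'a::euclidean_space set \<Rightarrow> ('a \<Rightarrow> real) \<Rightarrow> 'a set \<Rightarrow> ('a \<Rightarrow> real) \<Rightarrow> bool" where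
  "dunkl_harmonic_on Rp k S u \<longleftrightarrow> C2_on S u \<and> (\<forall>x\<in>S. dunkl_laplacian Rp k u x = 0)"

definition gradient :: "('a::euclidean_space \<Rightarrow> real) \<Rightarrow> 'a \<Rightarrow> 'a" where
  "gradient f x = (\<Sum>b\<in>Basis. frechet_derivative f (at x) b *\<^sub>R b)"

section \<open>Surface measure and Hardy spaces\<close>

text \<open>The unnormalised surface measure on the unit sphere of \<open>\<real>\<^sup>d\<close>: the measure of \<open>A\<close> is \<open>d\<close> times the
  Lebesgue measure of the cone \<open>{x. 0 < norm x < 1 \<and> x / norm x \<in> A}\<close>. This is the measure of
  integration in polar coordinates; for \<open>d = 1\<close> it is counting measure on \<open>{-1, 1}\<close>.\<close>

definition surface_measure :: "'a::euclidean_space measure" where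
  "surface_measure = scale_measure (of_nat DIM('a))
     (distr (restrict_space lborel (ball 0 1 - {0})) (restrict_space borel (sphere 0 1)) sgn)"

definition weighted_surface_measure ::
  "'a::euclidean_space set \<Rightarrow> ('a \<Rightarrow> real) \<Rightarrow> 'a measure" where
  "weighted_surface_measure Rp k = density surface_measure (\<lambda>x. ennreal (dunkl_weight Rp k x))"

definition dunkl_d :: "'a::euclidean_space set \<Rightarrow> ('a \<Rightarrow> real) \<Rightarrow> real" where
  "dunkl_d Rp k = (LINT x|surface_measure. dunkl_weight Rp k x)"

definition dunkl_C :: "'a::euclidean_space set \<Rightarrow> ('a \<Rightarrow> real) \<Rightarrow> real" where
  "dunkl_C Rp k = 1 / (dunkl_d Rp k * (real DIM('a) + 2 * dunkl_gamma Rp k - 2))"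

text \<open>The \<open>L\<^sup>p\<close> norm of the dilation of \<open>u\<close> by \<open>r\<close> (\<open>p\<close> finite). For \<open>u\<close> continuous on the open unit
  ball and \<open>0 \<le> r < 1\<close> the integrand is bounded on the sphere, so the integral always exists.\<close>

definition dilation_norm ::
  "'a::euclidean_space set \<Rightarrow> ('a \<Rightarrow> real) \<Rightarrow> real \<Rightarrow> ('a \<Rightarrow> real) \<Rightarrow> real \<Rightarrow> real" where
  "dilation_norm Rp k p u r =
     (LINT y|weighted_surface_measure Rp k. \<bar>u (r *\<^sub>R y)\<bar> powr p) powr (1 / p)"

definition hardy_space ::
  "'a::euclidean_space set \<Rightarrow> ('a \<Rightarrow> real) \<Rightarrow> real \<Rightarrow> ('a \<Rightarrow> real) set" where
  "hardy_space Rp k p =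
     {u. dunkl_harmonic_on Rp k (ball 0 1) u \<and> bdd_above (dilation_norm Rp k p u ` {0..<1})}"

definition hardy_norm ::
  "'a::euclidean_space set \<Rightarrow> ('a \<Rightarrow> real) \<Rightarrow> real \<Rightarrow> ('a \<Rightarrow> real) \<Rightarrow> real" where
  "hardy_norm Rp k p u = (SUP r\<in>{0..<1}. dilation_norm Rp k p u r)"

text \<open>The norms above are taken with respect to the unnormalised measure, whose total mass is
  \<^term>\<open>dunkl_d Rp k\<close>: the constant \<open>u = 1\<close> has norm to the power \<open>p\<close> equal to this mass. Hence the
  Hardy--Stein identity relates \<open>\<bar>u 0\<bar> powr p\<close> to that power of the norm divided by the mass, and its jump
  coefficient \<open>2\<close> is \<open>\<alpha> \<bullet> \<alpha>\<close> for roots normalised to \<open>\<alpha> \<bullet> \<alpha> = 2\<close>. The Dunkl operators do not depend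
  on the lengths of the roots, but this coefficient does.\<close>

section \<open>The Hardy--Stein integrand\<close>

definition bregman_F :: "real \<Rightarrow> real \<Rightarrow> real \<Rightarrow> real" where
  "bregman_F p a b = (if a = 0 then \<bar>b\<bar> powr p
     else \<bar>b\<bar> powr p - \<bar>a\<bar> powr p - p * a * \<bar>a\<bar> powr (p - 2) * (b - a))"

text \<open>The singular points \<open>y = 0\<close>, \<open>\<alpha> \<bullet> y = 0\<close>, and (for \<open>p < 2\<close>) \<open>u y = 0\<close> with nonzero gradient form
  a null set; elsewhere the product of a power of \<open>u y = 0\<close> and a zero gradient is \<open>0\<close>.\<close>

definition hardy_stein_integrand ::
  "'a::euclidean_space set \<Rightarrow> ('a \<Rightarrow> real) \<Rightarrow> real \<Rightarrow> ('a \<Rightarrow> real) \<Rightarrow> 'a \<Rightarrow> real" where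
  "hardy_stein_integrand Rp k p u y =
     (norm y powr (2 - 2 * dunkl_gamma Rp k - real DIM('a)) - 1) *
     (p * (p - 1) * rpow \<bar>u y\<bar> (p - 2) * (norm (gradient u y))\<^sup>2 +
      2 * (\<Sum>\<alpha>\<in>Rp. k \<alpha> * (bregman_F p (u y) (u (reflection \<alpha> y)) / (\<alpha> \<bullet> y)\<^sup>2))) *
     dunkl_weight Rp k y"

end

theory Submission
  imports Defs
begin

text \<open>
  Off the reflecting hyperplanes the Dunkl Laplacian of a \<open>C\<^sup>2\<close> function \<open>f\<close> is
  \<open>\<Delta> f + \<Sum> k\<^sub>\<alpha> (2 \<partial>\<^sub>\<alpha> f / \<langle>\<alpha>, x\<rangle> - \<bar>\<alpha>\<bar>\<^sup>2 (f - f \<circ> \<sigma>\<^sub>\<alpha>) / \<langle>\<alpha>, x\<rangle>\<^sup>2)\<close>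
  (\<open>dunkl_laplacian_eq_dunkl_expr\<close>). That the mixed terms of the squared Dunkl operators cancel is Dunkl's
  identity for pairs of roots (\<open>dunkl_pair_identity\<close>), a telescoping sum of tangents. If \<open>\<Delta>\<^sub>k u = 0\<close> and \<open>\<Phi>\<close> is a
  \<open>C\<^sup>2\<close> function, then
  \<open>\<Delta>\<^sub>k (\<Phi> \<circ> u) = \<Phi>'' (u) \<bar>\<nabla> u\<bar>\<^sup>2 + \<Sum> k\<^sub>\<alpha> \<bar>\<alpha>\<bar>\<^sup>2 F\<^sub>\<Phi> (u, u \<circ> \<sigma>\<^sub>\<alpha>) / \<langle>\<alpha>, x\<rangle>\<^sup>2\<close>
  with the first order remainder \<open>F\<^sub>\<Phi>\<close> of \<open>\<Phi>\<close> (\<open>dunkl_expr_compose\<close>). For \<open>\<Phi> = \<bar>\<cdot>\<bar>\<^sup>p\<close> and normalized roots this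
  is the bracket of the Hardy--Stein integrand, and it is nonnegative by convexity.

  The second ingredient is the Green identity: integrated against the weight and the Green function of the ball
  of radius \<open>S\<close> with pole \<open>0\<close>, a Dunkl Laplacian gives the spherical mean of the function at radius \<open>S\<close> minus its value at \<open>0\<close>
  times the mass of the sphere (\<open>green_identity\<close>, \<open>nn_integral_green_compose\<close>). It rests on the weak form
  \<open>\<integral> \<psi> \<Delta>\<^sub>k f w = - \<integral> \<nabla> \<psi> \<cdot> \<nabla> f w\<close> for \<open>\<psi>\<close> invariant under the reflections (\<open>integral_dunkl_expr\<close>). This is integration by parts with
  a smoothed weight. The derivatives of the weight produce terms that are singular on the hyperplanes, but
  their singular parts are antisymmetric under the reflections and integrate to zero. For the Green function,
  whose gradient is a multiple of \<open>\<bar>x\<bar>\<^sup>-\<^sup>N x\<close> with \<open>N = d + 2 \<gamma>\<close>, the right-hand side is in polar coordinates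
  (\<open>nn_integral_polar\<close>) the integral of a radial derivative (\<open>integral_radial_derivative\<close>).

  For \<open>p \<ge> 2\<close> the power \<open>\<bar>\<cdot>\<bar>\<^sup>p\<close> is of class \<open>C\<^sup>2\<close>. For \<open>p < 2\<close> it is approximated by \<open>C\<^sup>2\<close> functions whose second derivatives
  increase to that of the power, and hence so do their remainders (\<open>nn_integral_green_power\<close>). Since all integrands are
  nonnegative, monotone convergence for \<open>S \<rightarrow> 1\<close> gives both statements at once: the spherical means are bounded if and
  only if the integral is finite, and then their supremum is given by it (\<open>sphere_mean_bounded_iff\<close>).
  Passing to roots of arbitrary length changes the jump coefficients by bounded factors only (\<open>stein_energy_unit_iff\<close>).
\<close>

section \<open>Reflections and root systems\<close>

lemma linear_reflection: "linear (reflection \<alpha>)"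
  by (rule linearI) (auto simp: reflection_def inner_add_right algebra_simps add_divide_distrib)

lemma bounded_linear_reflection: "bounded_linear (reflection \<alpha>)"
  using linear_reflection linear_conv_bounded_linear by blast

lemma continuous_on_reflection [continuous_intros]:
  "continuous_on S f \<Longrightarrow> continuous_on S (\<lambda>x. reflection \<alpha> (f x))"
  using bounded_linear_reflection bounded_linear.continuous_on by blast

lemma borel_measurable_reflection [measurable]: "reflection \<alpha> \<in> borel_measurable borel"
  by (intro borel_measurable_continuous_onI continuous_on_reflection continuous_on_id)

lemma inner_reflection_reflection: "reflection \<alpha> x \<bullet> reflection \<alpha> y = x \<bullet> y"
proof (cases "\<alpha> = 0")
  case False
  then have "\<alpha> \<bullet> \<alpha> \<noteq> 0" by simp
  then show ?thesis
    by (simp add: reflection_def inner_diff_left inner_diff_right field_simps inner_commute)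
qed (simp add: reflection_def)

lemma norm_reflection [simp]: "norm (reflection \<alpha> x) = norm x"
  by (simp add: norm_eq_sqrt_inner inner_reflection_reflection)

lemma inner_reflection_self [simp]: "\<alpha> \<bullet> reflection \<alpha> x = - (\<alpha> \<bullet> x)"
  by (cases "\<alpha> = 0") (simp_all add: reflection_def inner_diff_right)

lemma reflection_reflection [simp]: "reflection \<alpha> (reflection \<alpha> x) = x"
proof (cases "\<alpha> = 0")
  case False
  have "reflection \<alpha> (reflection \<alpha> x) =
    reflection \<alpha> x - (2 * (\<alpha> \<bullet> reflection \<alpha> x) / (\<alpha> \<bullet> \<alpha>)) *\<^sub>R \<alpha>"
    by (rule reflection_def)
  then show ?thesis by (simp only: inner_reflection_self) (simp add: reflection_def)
qed (simp add: reflection_def)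

lemma inner_reflection_right: "x \<bullet> reflection \<alpha> y = reflection \<alpha> x \<bullet> y"
  using inner_reflection_reflection[of \<alpha> x "reflection \<alpha> y"] by simp

lemma reflection_root: "reflection \<alpha> \<alpha> = - \<alpha>"
  by (cases "\<alpha> = 0") (simp_all add: reflection_def scaleR_2)

lemma reflection_minus: "reflection (- \<alpha>) = reflection \<alpha>"
  by (rule ext) (simp add: reflection_def)

lemma reflection_conjugate:
  "reflection (reflection \<beta> \<alpha>) x = reflection \<beta> (reflection \<alpha> (reflection \<beta> x))"
proof -
  have "reflection \<beta> (reflection \<alpha> (reflection \<beta> x)) =
    x - (2 * (\<alpha> \<bullet> reflection \<beta> x) / (\<alpha> \<bullet> \<alpha>)) *\<^sub>R reflection \<beta> \<alpha>"
    using linear_diff[OF linear_reflection[of \<beta>]] linear_scale[OF linear_reflection[of \<beta>]]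
    by (simp add: reflection_def[of \<alpha>])
  then show ?thesis
    by (simp add: reflection_def[of "reflection \<beta> \<alpha>"] inner_reflection_reflection inner_reflection_right)
qed

locale root_data =
  fixes R Rp :: "'a::euclidean_space set" and k :: "'a \<Rightarrow> real"
  assumes root_system: "root_system R"
    and positive: "positive_subsystem R Rp"
    and multiplicity: "multiplicity_function R k"
begin

lemma finite_R [simp, intro]: "finite R"
  and root_nonzero: "\<alpha> \<in> R \<Longrightarrow> \<alpha> \<noteq> 0"
  and reflection_image: "\<alpha> \<in> R \<Longrightarrow> reflection \<alpha> ` R = R"
  using root_system by (auto simp: root_system_def)

lemma reflection_in_R: "\<alpha> \<in> R \<Longrightarrow> \<beta> \<in> R \<Longrightarrow> reflection \<alpha> \<beta> \<in> R"
  using reflection_image by blast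

lemma parallel_roots: "\<alpha> \<in> R \<Longrightarrow> c *\<^sub>R \<alpha> \<in> R \<Longrightarrow> c *\<^sub>R \<alpha> = \<alpha> \<or> c *\<^sub>R \<alpha> = - \<alpha>"
  using root_system unfolding root_system_def by blast

lemma uminus_in_R: "\<alpha> \<in> R \<Longrightarrow> - \<alpha> \<in> R"
  using reflection_in_R[of \<alpha> \<alpha>] by (simp add: reflection_root)

lemma k_nonneg: "\<alpha> \<in> R \<Longrightarrow> 0 \<le> k \<alpha>"
  using multiplicity by (auto simp: multiplicity_function_def)

lemma k_reflection: "\<alpha> \<in> R \<Longrightarrow> \<beta> \<in> R \<Longrightarrow> k (reflection \<alpha> \<beta>) = k \<beta>"
proof -
  assume a: "\<alpha> \<in> R" "\<beta> \<in> R"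
  have "reflection \<alpha> \<circ> id \<in> reflection_group R"
    using a by (intro reflection_group.intros)
  then show ?thesis using multiplicity a by (force simp: multiplicity_function_def)
qed

lemma k_uminus: "\<alpha> \<in> R \<Longrightarrow> k (- \<alpha>) = k \<alpha>"
  using k_reflection[of \<alpha> \<alpha>] by (simp add: reflection_root)

lemma Rp_subset: "Rp \<subseteq> R" and finite_Rp [simp, intro]: "finite Rp"
  using positive finite_subset[OF _ finite_R] by (auto simp: positive_subsystem_def)

lemma Rp_R: "\<alpha> \<in> Rp \<Longrightarrow> \<alpha> \<in> R"
  using Rp_subset by blast

lemma Rp_nonzero: "\<alpha> \<in> Rp \<Longrightarrow> \<alpha> \<noteq> 0" and Rp_k_nonneg: "\<alpha> \<in> Rp \<Longrightarrow> 0 \<le> k \<alpha>"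
  by (auto dest: Rp_R root_nonzero k_nonneg)

lemma R_partition: "R = Rp \<union> uminus ` Rp" "Rp \<inter> uminus ` Rp = {}"
proof -
  obtain v where v: "\<forall>\<alpha>\<in>R. \<alpha> \<bullet> v \<noteq> 0" "Rp = {\<alpha>\<in>R. \<alpha> \<bullet> v > 0}"
    using positive by (auto simp: positive_subsystem_def)
  show "R = Rp \<union> uminus ` Rp"
  proof (intro set_eqI iffI)
    fix \<alpha> assume a: "\<alpha> \<in> R"
    show "\<alpha> \<in> Rp \<union> uminus ` Rp"
    proof (cases "\<alpha> \<bullet> v > 0")
      case False
      then have "- \<alpha> \<in> Rp" using a v uminus_in_R by force
      then show ?thesis by (metis UnI2 imageI minus_minus)
    qed (use a v in auto)
  qed (use v uminus_in_R in auto)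
  show "Rp \<inter> uminus ` Rp = {}" using v by auto
qed

lemma sum_R_even:
  fixes f :: "'a \<Rightarrow> real"
  assumes "\<And>\<alpha>. \<alpha> \<in> R \<Longrightarrow> f (- \<alpha>) = f \<alpha>"
  shows "(\<Sum>\<alpha>\<in>R. f \<alpha>) = 2 * (\<Sum>\<alpha>\<in>Rp. f \<alpha>)"
proof -
  have "(\<Sum>\<alpha>\<in>R. f \<alpha>) = (\<Sum>\<alpha>\<in>Rp. f \<alpha>) + (\<Sum>\<alpha>\<in>uminus ` Rp. f \<alpha>)"
    using R_partition by (simp add: sum.union_disjoint)
  also have "(\<Sum>\<alpha>\<in>uminus ` Rp. f \<alpha>) = (\<Sum>\<alpha>\<in>Rp. f \<alpha>)"
    using assms Rp_R by (simp add: sum.reindex)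
  finally show ?thesis by simp
qed

text \<open>A product over the positive roots of even, Weyl invariant factors is invariant under every
  reflection: its square is the product over all roots, which reflections permute.\<close>

lemma prod_Rp_reflection:
  fixes F :: "real \<Rightarrow> real \<Rightarrow> real"
  assumes \<beta>: "\<beta> \<in> R" and even: "\<And>c t. F c (- t) = F c t" and nonneg: "\<And>c t. 0 \<le> F c t"
  shows "(\<Prod>\<alpha>\<in>Rp. F (k \<alpha>) (\<alpha> \<bullet> reflection \<beta> x)) = (\<Prod>\<alpha>\<in>Rp. F (k \<alpha>) (\<alpha> \<bullet> x))"
proof -
  have square: "(\<Prod>\<alpha>\<in>R. F (k \<alpha>) (\<alpha> \<bullet> y)) = (\<Prod>\<alpha>\<in>Rp. F (k \<alpha>) (\<alpha> \<bullet> y))\<^sup>2" for y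
  proof -
    have "(\<Prod>\<alpha>\<in>R. F (k \<alpha>) (\<alpha> \<bullet> y)) =
        (\<Prod>\<alpha>\<in>Rp. F (k \<alpha>) (\<alpha> \<bullet> y)) * (\<Prod>\<alpha>\<in>uminus ` Rp. F (k \<alpha>) (\<alpha> \<bullet> y))"
      using R_partition by (simp add: prod.union_disjoint)
    also have "(\<Prod>\<alpha>\<in>uminus ` Rp. F (k \<alpha>) (\<alpha> \<bullet> y)) = (\<Prod>\<alpha>\<in>Rp. F (k \<alpha>) (\<alpha> \<bullet> y))"
      using Rp_R by (subst prod.reindex) (auto intro!: prod.cong simp: k_uminus even)
    finally show ?thesis by (simp add: power2_eq_square)
  qed
  have inj: "inj_on (reflection \<beta>) R" by (metis inj_onI reflection_reflection)
  have "(\<Prod>\<alpha>\<in>R. F (k \<alpha>) (\<alpha> \<bullet> reflection \<beta> x)) =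
      (\<Prod>\<alpha>\<in>R. F (k (reflection \<beta> \<alpha>)) (reflection \<beta> \<alpha> \<bullet> x))"
    using \<beta> by (intro prod.cong) (simp_all add: k_reflection inner_reflection_right)
  also have "\<dots> = (\<Prod>\<alpha>\<in>reflection \<beta> ` R. F (k \<alpha>) (\<alpha> \<bullet> x))"
    using inj by (simp add: prod.reindex)
  also have "\<dots> = (\<Prod>\<alpha>\<in>R. F (k \<alpha>) (\<alpha> \<bullet> x))" using \<beta> by (simp add: reflection_image)
  finally have "(\<Prod>\<alpha>\<in>Rp. F (k \<alpha>) (\<alpha> \<bullet> reflection \<beta> x))\<^sup>2 = (\<Prod>\<alpha>\<in>Rp. F (k \<alpha>) (\<alpha> \<bullet> x))\<^sup>2"
    by (simp add: square)
  then show ?thesis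
    by (rule power2_eq_imp_eq) (simp_all add: nonneg prod_nonneg)
qed

subsection \<open>Dunkl's identity for pairs of roots\<close>

text \<open>For roots in a plane spanned by \<open>\<alpha>, \<beta>\<close>, with angles \<open>\<theta>\<^sub>\<alpha>\<close>, \<open>\<theta>\<^sub>\<beta>\<close> and \<open>\<phi>\<close> the angle of the
  projection of \<open>x\<close>, the quotient \<open>\<alpha> \<bullet> \<beta> / ((\<alpha> \<bullet> x) * (\<beta> \<bullet> x))\<close> is a constant times
  \<open>cot (\<theta>\<^sub>\<beta> - \<theta>\<^sub>\<alpha>) * (tan (\<theta>\<^sub>\<beta> - \<phi>) - tan (\<theta>\<^sub>\<alpha> - \<phi>))\<close>. It therefore telescopes along the map
  \<open>(\<alpha>, \<beta>) \<mapsto> (\<beta>, \<sigma>\<^sub>\<beta> \<alpha>)\<close>, which keeps the difference of the angles. The function below is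
  the term \<open>cot (\<theta>\<^sub>\<beta> - \<theta>\<^sub>\<alpha>) * tan (\<theta>\<^sub>\<alpha> - \<phi>)\<close>, up to that constant, as a rational function of scalar products.\<close>

definition telescope :: "'a \<Rightarrow> 'a \<Rightarrow> 'a \<Rightarrow> real" where
  "telescope x \<alpha> \<beta> = - (\<alpha> \<bullet> \<beta>) * ((\<beta> \<bullet> x) * (\<alpha> \<bullet> \<alpha>) - (\<alpha> \<bullet> \<beta>) * (\<alpha> \<bullet> x)) /
     ((\<alpha> \<bullet> x) * ((\<alpha> \<bullet> x)\<^sup>2 * (\<beta> \<bullet> \<beta>) + (\<beta> \<bullet> x)\<^sup>2 * (\<alpha> \<bullet> \<alpha>) - 2 * (\<alpha> \<bullet> x) * (\<beta> \<bullet> x) * (\<alpha> \<bullet> \<beta>)))"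

lemma telescope_step:
  assumes a: "\<alpha> \<bullet> x \<noteq> 0" and b: "\<beta> \<bullet> x \<noteq> 0" and indep: "(\<alpha> \<bullet> x) *\<^sub>R \<beta> \<noteq> (\<beta> \<bullet> x) *\<^sub>R \<alpha>"
  shows "(\<alpha> \<bullet> \<beta>) / ((\<alpha> \<bullet> x) * (\<beta> \<bullet> x)) = telescope x \<beta> (reflection \<beta> \<alpha>) - telescope x \<alpha> \<beta>"
proof -
  define A B C P Q where defs: "A = \<alpha> \<bullet> x" "B = \<beta> \<bullet> x" "C = \<alpha> \<bullet> \<beta>" "P = \<alpha> \<bullet> \<alpha>" "Q = \<beta> \<bullet> \<beta>"
  \<comment> \<open>This is the squared norm of \<open>A *\<^sub>R \<beta> - B *\<^sub>R \<alpha>\<close>, and it is unchanged when \<open>(\<alpha>, \<beta>)\<close> is replaced by \<open>(\<beta>, \<sigma>\<^sub>\<beta> \<alpha>)\<close>.\<close>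
  define D where "D = A\<^sup>2 * Q + B\<^sup>2 * P - 2 * A * B * C"
  have "\<beta> \<noteq> 0" using b by auto
  then have Q: "Q \<noteq> 0" by (simp add: defs)
  have "((\<alpha> \<bullet> x) *\<^sub>R \<beta> - (\<beta> \<bullet> x) *\<^sub>R \<alpha>) \<bullet> ((\<alpha> \<bullet> x) *\<^sub>R \<beta> - (\<beta> \<bullet> x) *\<^sub>R \<alpha>) = D"
    unfolding D_def defs
    by (simp add: inner_diff_left inner_diff_right algebra_simps power2_eq_square inner_commute)
  then have D: "D \<noteq> 0" using indep by (metis inner_eq_zero_iff right_minus_eq)
  have C': "\<beta> \<bullet> reflection \<beta> \<alpha> = - C" by (simp add: defs inner_commute)
  have A': "reflection \<beta> \<alpha> \<bullet> x = A - 2 * C / Q * B"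
    by (simp add: reflection_def inner_diff_left defs inner_commute[of \<beta> \<alpha>])
  have P': "reflection \<beta> \<alpha> \<bullet> reflection \<beta> \<alpha> = P"
    by (simp add: inner_reflection_reflection defs)
  have D': "B\<^sup>2 * P + (A - 2 * C / Q * B)\<^sup>2 * Q - 2 * B * (A - 2 * C / Q * B) * (- C) = D"
    using Q by (simp add: D_def power2_eq_square field_simps)
  have "telescope x \<beta> (reflection \<beta> \<alpha>) = C * ((A - 2 * C / Q * B) * Q + C * B) / (B * D)"
    unfolding telescope_def C' A' P' D'[symmetric] by (simp add: defs)
  also have "\<dots> = C * (A * Q - C * B) / (B * D)"
    using Q by (simp add: algebra_simps)
  finally have 1: "telescope x \<beta> (reflection \<beta> \<alpha>) = C * (A * Q - C * B) / (B * D)" .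
  have 2: "telescope x \<alpha> \<beta> = - C * (B * P - C * A) / (A * D)"
    by (simp add: telescope_def D_def defs)
  have "C / (A * B) = C * (A * Q - C * B) / (B * D) + C * (B * P - C * A) / (A * D)"
    using a b D by (simp add: defs(1,2)[symmetric] divide_simps)
      (simp add: D_def power2_eq_square algebra_simps)
  then show ?thesis unfolding 1 2 by (simp add: defs)
qed

text \<open>The contributions of two distinct reflections to the square of the Dunkl operators cancel:
  summed over the pairs of roots with a given product of reflections, the quotients vanish by
  telescoping.\<close>

lemma dunkl_pair_identity:
  assumes x: "\<And>\<alpha>. \<alpha> \<in> R \<Longrightarrow> \<alpha> \<bullet> x \<noteq> 0"
  shows "(\<Sum>(\<alpha>, \<beta>)\<in>R \<times> R. k \<alpha> * k \<beta> * (f x - f (reflection \<beta> (reflection \<alpha> x))) *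
           ((\<alpha> \<bullet> \<beta>) / ((\<alpha> \<bullet> x) * (\<beta> \<bullet> x)))) = (0::real)"
proof -
  define K where "K = (\<lambda>(\<alpha>, \<beta>). k \<alpha> * k \<beta> * (f x - f (reflection \<beta> (reflection \<alpha> x))))"
  define T where "T = (\<lambda>(\<alpha>, \<beta>). telescope x \<alpha> \<beta>)"
  define \<tau> where "\<tau> = (\<lambda>(\<alpha>, \<beta>). (\<beta>, reflection \<beta> \<alpha>) :: 'a \<times> 'a)"
  have bij: "bij_betw \<tau> (R \<times> R) (R \<times> R)"
    by (rule bij_betw_byWitness[where f' = "\<lambda>(\<beta>, \<gamma>). (reflection \<beta> \<gamma>, \<beta>)"])
      (auto simp: \<tau>_def reflection_in_R)
  have K\<tau>: "K (\<tau> z) = K z" if "z \<in> R \<times> R" for z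
    using that by (auto simp: K_def \<tau>_def k_reflection reflection_conjugate)
  have step: "(case z of (\<alpha>, \<beta>) \<Rightarrow> k \<alpha> * k \<beta> * (f x - f (reflection \<beta> (reflection \<alpha> x))) *
           ((\<alpha> \<bullet> \<beta>) / ((\<alpha> \<bullet> x) * (\<beta> \<bullet> x)))) = K (\<tau> z) * T (\<tau> z) - K z * T z" if z: "z \<in> R \<times> R" for z
  proof -
    obtain \<alpha> \<beta> where z': "z = (\<alpha>, \<beta>)" "\<alpha> \<in> R" "\<beta> \<in> R" using z by auto
    show ?thesis
    proof (cases "(\<alpha> \<bullet> x) *\<^sub>R \<beta> = (\<beta> \<bullet> x) *\<^sub>R \<alpha>")
      case True
      then have "\<beta> = ((\<beta> \<bullet> x) / (\<alpha> \<bullet> x)) *\<^sub>R \<alpha>"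
        using x[OF z'(2)] by (metis divide_inverse_commute eq_vector_fraction_iff scaleR_scaleR)
      then have "\<beta> = \<alpha> \<or> \<beta> = - \<alpha>" using parallel_roots[OF z'(2)] z'(3) by metis
      \<comment> \<open>For parallel roots the formula for the quotient fails, but the coefficient \<open>K\<close> vanishes.\<close>
      then have "reflection \<beta> = reflection \<alpha>" by (auto simp: reflection_minus)
      then have "K z = 0" by (simp add: K_def z')
      then show ?thesis using K\<tau>[OF z] by (simp only: z' K_def prod.case mult_zero_left diff_0_right)
    next
      case False
      have "(case z of (\<alpha>, \<beta>) \<Rightarrow> k \<alpha> * k \<beta> * (f x - f (reflection \<beta> (reflection \<alpha> x))) *
           ((\<alpha> \<bullet> \<beta>) / ((\<alpha> \<bullet> x) * (\<beta> \<bullet> x)))) = K z * (T (\<tau> z) - T z)"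
        using telescope_step[OF x[OF z'(2)] x[OF z'(3)] False]
        by (simp only: z' K_def T_def \<tau>_def prod.case)
      then show ?thesis using K\<tau>[OF z] by (simp add: right_diff_distrib)
    qed
  qed
  have "(\<Sum>z\<in>R \<times> R. K (\<tau> z) * T (\<tau> z)) = (\<Sum>z\<in>R \<times> R. K z * T z)"
    using sum.reindex_bij_betw[OF bij, of "\<lambda>z. K z * T z"] .
  then show ?thesis using step by (simp add: sum_subtractf)
qed

end

section \<open>Functions of class \<open>C\<^sup>2\<close>\<close>

definition laplace :: "('a::euclidean_space \<Rightarrow> real) \<Rightarrow> 'a \<Rightarrow> real" where
  "laplace f x = (\<Sum>b\<in>Basis. frechet_derivative (\<lambda>y. frechet_derivative f (at y) b) (at x) b)"

lemma linear_eq_inner_Basis: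
  fixes l :: "'a::euclidean_space \<Rightarrow> real"
  assumes "linear l"
  shows "l h = (\<Sum>b\<in>Basis. l b *\<^sub>R b) \<bullet> h"
proof -
  have "l h = l (\<Sum>b\<in>Basis. (h \<bullet> b) *\<^sub>R b)" by (simp add: euclidean_representation)
  also have "\<dots> = (\<Sum>b\<in>Basis. (h \<bullet> b) * l b)"
    using assms by (simp add: linear_sum linear_scale)
  finally show ?thesis by (simp add: inner_sum_left inner_commute[of h] mult.commute)
qed

lemma has_derivative_gradient:
  assumes "f differentiable (at x)"
  shows "(f has_derivative (\<lambda>h. gradient f x \<bullet> h)) (at x)"
proof -
  have d: "(f has_derivative frechet_derivative f (at x)) (at x)"
    using assms frechet_derivative_works by blast
  have "frechet_derivative f (at x) = (\<lambda>h. gradient f x \<bullet> h)"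
    unfolding gradient_def by (rule ext, rule linear_eq_inner_Basis[OF has_derivative_linear[OF d]])
  with d show ?thesis by simp
qed

lemma gradient_inner_Basis: "b \<in> Basis \<Longrightarrow> gradient f x \<bullet> b = frechet_derivative f (at x) b"
  by (simp add: gradient_def inner_sum_left inner_Basis if_distrib cong: if_cong)

lemma gradient_eqI:
  assumes "(f has_derivative (\<lambda>h. g \<bullet> h)) (at x)"
  shows "gradient f x = g"
proof -
  have "frechet_derivative f (at x) = (\<lambda>h. g \<bullet> h)"
    using assms frechet_derivative_at by metis
  then show ?thesis by (simp add: gradient_def euclidean_representation)
qed

locale C2_function =
  fixes S :: "'a::euclidean_space set" and f :: "'a \<Rightarrow> real"
  assumes open_S: "open S" and C2: "C2_on S f"
begin

abbreviation "partial b \<equiv> (\<lambda>x. frechet_derivative f (at x) b)"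

lemma differentiable: "x \<in> S \<Longrightarrow> f differentiable (at x)"
  using C2 open_S by (auto simp: C2_on_def differentiable_on_eq_differentiable_at)

lemma derivative: "x \<in> S \<Longrightarrow> (f has_derivative (\<lambda>h. gradient f x \<bullet> h)) (at x)"
  by (simp add: differentiable has_derivative_gradient)

lemma partial_differentiable: "x \<in> S \<Longrightarrow> b \<in> Basis \<Longrightarrow> partial b differentiable (at x)"
  using C2 open_S by (auto simp: C2_on_def differentiable_on_eq_differentiable_at)

lemma partial_derivative:
  "x \<in> S \<Longrightarrow> b \<in> Basis \<Longrightarrow> (partial b has_derivative frechet_derivative (partial b) (at x)) (at x)"
  using partial_differentiable frechet_derivative_works by blast

lemma continuous_on_f: "continuous_on S f"
  by (meson C2 C2_on_def differentiable_imp_continuous_on)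

lemma continuous_on_partial: "b \<in> Basis \<Longrightarrow> continuous_on S (partial b)"
  using C2 by (auto simp: C2_on_def intro: differentiable_imp_continuous_on)

lemma continuous_on_gradient: "continuous_on S (gradient f)"
  unfolding gradient_def by (intro continuous_intros continuous_on_partial)

lemma continuous_on_second:
  "b \<in> Basis \<Longrightarrow> c \<in> Basis \<Longrightarrow> continuous_on S (\<lambda>x. frechet_derivative (partial b) (at x) c)"
  using C2 by (auto simp: C2_on_def)

lemma continuous_on_laplace: "continuous_on S (laplace f)"
  unfolding laplace_def by (intro continuous_intros continuous_on_second)

lemma compact_bounds:
  assumes K: "compact K" "K \<subseteq> S"
  obtains M where "0 \<le> M" "\<And>x. x \<in> K \<Longrightarrow> norm (gradient f x) \<le> M"
    "\<And>x. x \<in> K \<Longrightarrow> \<bar>laplace f x\<bar> \<le> M"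
    "\<And>x b h. x \<in> K \<Longrightarrow> b \<in> Basis \<Longrightarrow> \<bar>frechet_derivative (partial b) (at x) h\<bar> \<le> M * norm h"
proof -
  have bdd: "\<exists>M. \<forall>x\<in>K. norm (g x) \<le> M" if "continuous_on S g" for g :: "'a \<Rightarrow> 'b::real_normed_vector"
    using compact_imp_bounded[OF compact_continuous_image[OF continuous_on_subset[OF that K(2)] K(1)]]
    by (auto simp: bounded_iff)
  obtain M2 where M2: "\<forall>x\<in>K. norm (gradient f x) \<le> M2" using bdd[OF continuous_on_gradient] by blast
  obtain M3 where M3: "\<forall>x\<in>K. norm (laplace f x) \<le> M3" using bdd[OF continuous_on_laplace] by blast
  have "continuous_on S (\<lambda>x. \<Sum>b\<in>Basis. \<Sum>c\<in>Basis. \<bar>frechet_derivative (partial b) (at x) c\<bar>)"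
    by (intro continuous_intros continuous_on_second)
  from bdd[OF this] obtain M4 where
    M4: "\<forall>x\<in>K. norm (\<Sum>b\<in>Basis. \<Sum>c\<in>Basis. \<bar>frechet_derivative (partial b) (at x) c\<bar>) \<le> M4" by blast
  have second: "\<bar>frechet_derivative (partial b) (at x) h\<bar> \<le> M4 * norm h"
    if x: "x \<in> K" and b: "b \<in> Basis" for x b h
  proof -
    have lin: "linear (frechet_derivative (partial b) (at x))"
      using partial_derivative[of x b] x b K has_derivative_linear by blast
    have "\<bar>frechet_derivative (partial b) (at x) h\<bar> =
        \<bar>\<Sum>c\<in>Basis. frechet_derivative (partial b) (at x) c * (c \<bullet> h)\<bar>"
      using linear_eq_inner_Basis[OF lin, of h] by (simp add: inner_sum_left)
    also have "\<dots> \<le> (\<Sum>c\<in>Basis. \<bar>frechet_derivative (partial b) (at x) c\<bar> * norm h)"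
      using Basis_le_norm[of _ h]
      by (intro order_trans[OF sum_abs] sum_mono)
        (auto simp: abs_mult inner_commute[of _ h] intro!: mult_left_mono)
    also have "\<dots> = (\<Sum>c\<in>Basis. \<bar>frechet_derivative (partial b) (at x) c\<bar>) * norm h"
      by (simp add: sum_distrib_right)
    also have "\<dots> \<le> (\<Sum>b\<in>Basis. \<Sum>c\<in>Basis. \<bar>frechet_derivative (partial b) (at x) c\<bar>) * norm h"
      using b by (intro mult_right_mono member_le_sum) (auto intro: sum_nonneg)
    also have "\<dots> \<le> M4 * norm h"
      using M4 x by (intro mult_right_mono) auto
    finally show ?thesis .
  qed
  define M where "M = \<bar>M2\<bar> + \<bar>M3\<bar> + \<bar>M4\<bar>"
  show ?thesis
  proof (rule that[of M])
    show "\<bar>frechet_derivative (partial b) (at x) h\<bar> \<le> M * norm h" if "x \<in> K" "b \<in> Basis" for x b h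
      using second[OF that, of h] by (rule order_trans) (auto simp: M_def intro!: mult_right_mono)
  qed (use M2 M3 in \<open>force simp: M_def\<close>)+
qed

lemma taylor_bounds:
  assumes K: "compact K" "convex K" "K \<subseteq> S"
  obtains M where "0 \<le> M"
    "\<And>x y. x \<in> K \<Longrightarrow> y \<in> K \<Longrightarrow> norm (gradient f x - gradient f y) \<le> M * norm (x - y)"
    "\<And>x y. x \<in> K \<Longrightarrow> y \<in> K \<Longrightarrow> \<bar>f y - f x - gradient f x \<bullet> (y - x)\<bar> \<le> M * (norm (y - x))\<^sup>2"
proof -
  obtain M where M: "0 \<le> M"
    "\<And>x b h. x \<in> K \<Longrightarrow> b \<in> Basis \<Longrightarrow> \<bar>frechet_derivative (partial b) (at x) h\<bar> \<le> M * norm h"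
    using compact_bounds[OF K(1,3)] by metis
  have comp: "\<bar>partial b x - partial b y\<bar> \<le> M * norm (x - y)" if "x \<in> K" "y \<in> K" "b \<in> Basis" for x y b
  proof -
    have "norm (partial b x - partial b y) \<le> M * norm (x - y)"
    proof (rule differentiable_bound[OF K(2) _ _ that(1,2)])
      fix z assume z: "z \<in> K"
      show "(partial b has_derivative frechet_derivative (partial b) (at z)) (at z within K)"
        using partial_derivative[of z b] z K that has_derivative_at_withinI by blast
      show "onorm (frechet_derivative (partial b) (at z)) \<le> M"
        using M(2)[OF z that(3)] by (intro onorm_le) auto
    qed
    then show ?thesis by simp
  qed
  define M' where "M' = real DIM('a) * M"
  have grad: "norm (gradient f x - gradient f y) \<le> M' * norm (x - y)" if "x \<in> K" "y \<in> K" for x y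
  proof -
    have "norm (gradient f x - gradient f y) \<le> (\<Sum>b\<in>Basis. \<bar>(gradient f x - gradient f y) \<bullet> b\<bar>)"
      by (rule norm_le_l1)
    also have "\<dots> \<le> (\<Sum>b\<in>(Basis::'a set). M * norm (x - y))"
      using comp that by (intro sum_mono) (simp add: inner_diff_left gradient_inner_Basis)
    finally show ?thesis by (simp add: M'_def mult.assoc)
  qed
  show ?thesis
  proof (rule that[of M'])
    show "0 \<le> M'" using M by (simp add: M'_def)
    fix x y assume xy: "x \<in> K" "y \<in> K"
    show "norm (gradient f x - gradient f y) \<le> M' * norm (x - y)" using grad xy .
    have seg: "closed_segment x y \<subseteq> K" using K(2) xy by (simp add: closed_segment_subset)
    have "norm ((f y - gradient f x \<bullet> y) - (f x - gradient f x \<bullet> x)) \<le> (M' * norm (y - x)) * norm (y - x)"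
    proof (rule differentiable_bound[where S = "closed_segment x y"])
      fix z assume z: "z \<in> closed_segment x y"
      have "z \<in> S" using z seg K by blast
      then show "((\<lambda>z. f z - gradient f x \<bullet> z) has_derivative
          (\<lambda>h. gradient f z \<bullet> h - gradient f x \<bullet> h)) (at z within closed_segment x y)"
        by (auto intro!: derivative_eq_intros has_derivative_at_withinI[OF derivative])
      have "norm (gradient f z \<bullet> h - gradient f x \<bullet> h) \<le> M' * norm (y - x) * norm h" for h
      proof -
        have "norm (gradient f z \<bullet> h - gradient f x \<bullet> h) \<le> norm (gradient f z - gradient f x) * norm h"
          by (metis Cauchy_Schwarz_ineq2 inner_diff_left real_norm_def)
        also have "\<dots> \<le> (M' * norm (z - x)) * norm h"
          using grad[of z x] z seg xy by (intro mult_right_mono) auto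
        also have "\<dots> \<le> M' * norm (y - x) * norm h"
          using segment_bound1[OF z] M
          by (intro mult_right_mono mult_left_mono) (auto simp: M'_def norm_minus_commute)
        finally show ?thesis .
      qed
      then show "onorm (\<lambda>h. gradient f z \<bullet> h - gradient f x \<bullet> h) \<le> M' * norm (y - x)"
        by (intro onorm_le) auto
    qed auto
    then show "\<bar>f y - f x - gradient f x \<bullet> (y - x)\<bar> \<le> M' * (norm (y - x))\<^sup>2"
      by (simp add: inner_diff_right algebra_simps power2_eq_square)
  qed
qed

end

section \<open>The Dunkl Laplacian off the hyperplanes\<close>

context root_data
begin

text \<open>The Dunkl Laplacian as a differential-difference operator. Division by zero makes the terms
  singular at a hyperplane \<open>0\<close> on it.\<close>

definition dunkl_expr :: "('a \<Rightarrow> real) \<Rightarrow> 'a \<Rightarrow> real" where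
  "dunkl_expr f x = laplace f x + (\<Sum>\<alpha>\<in>Rp. k \<alpha> *
     (2 * (\<alpha> \<bullet> gradient f x) / (\<alpha> \<bullet> x) - (\<alpha> \<bullet> \<alpha>) * (f x - f (reflection \<alpha> x)) / (\<alpha> \<bullet> x)\<^sup>2))"

definition regular :: "'a set" where
  "regular = {x. \<forall>\<alpha>\<in>R. \<alpha> \<bullet> x \<noteq> 0}"

lemma open_regular: "open regular"
proof -
  have "regular = (\<Inter>\<alpha>\<in>R. {x. \<alpha> \<bullet> x \<noteq> 0})" by (auto simp: regular_def)
  moreover have "open {x. \<alpha> \<bullet> x \<noteq> 0}" for \<alpha> :: 'a
    by (intro open_Collect_neq continuous_intros)
  ultimately show ?thesis by auto
qed

lemma regular_reflection: "\<alpha> \<in> R \<Longrightarrow> x \<in> regular \<Longrightarrow> reflection \<alpha> x \<in> regular"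
  by (auto simp: regular_def inner_reflection_right reflection_in_R)

text \<open>In the square of the Dunkl operators the pairs of positive roots contribute four values of \<open>f\<close>, at \<open>x\<close>,
  \<open>\<sigma>\<^sub>\<alpha> x\<close>, \<open>\<sigma>\<^sub>\<beta> x\<close> and \<open>\<sigma>\<^sub>\<alpha> \<sigma>\<^sub>\<beta> x\<close>. Summed over all roots and after replacing \<open>\<alpha>\<close> by \<open>\<sigma>\<^sub>\<beta> \<alpha>\<close> in the last two, the
  two middle values cancel by symmetry, and the other two are those of the identity for pairs.\<close>

lemma difference_terms_vanish:
  assumes x: "x \<in> regular"
  shows "(\<Sum>\<beta>\<in>Rp. \<Sum>\<alpha>\<in>Rp. k \<alpha> * k \<beta> * (\<alpha> \<bullet> \<beta>) *
      ((f x - f (reflection \<alpha> x)) / (\<alpha> \<bullet> x) -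
       (f (reflection \<beta> x) - f (reflection \<alpha> (reflection \<beta> x))) / (\<alpha> \<bullet> reflection \<beta> x)) / (\<beta> \<bullet> x)) = (0::real)"
    (is "(\<Sum>\<beta>\<in>Rp. \<Sum>\<alpha>\<in>Rp. ?t \<alpha> \<beta>) = 0")
proof -
  have x0: "\<alpha> \<in> R \<Longrightarrow> \<alpha> \<bullet> x \<noteq> 0" for \<alpha> using x by (auto simp: regular_def)
  define h where "h \<alpha> \<beta> = k \<alpha> * k \<beta> * (\<alpha> \<bullet> \<beta>) / ((\<alpha> \<bullet> x) * (\<beta> \<bullet> x))" for \<alpha> \<beta>
  have inner_sum: "(\<Sum>\<alpha>\<in>R. ?t \<alpha> \<beta>) =
      (\<Sum>\<alpha>\<in>R. h \<alpha> \<beta> * (f x - f (reflection \<beta> (reflection \<alpha> x))) +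
        h \<alpha> \<beta> * f (reflection \<beta> x) - h \<alpha> \<beta> * f (reflection \<alpha> x))" if \<beta>: "\<beta> \<in> R" for \<beta>
  proof -
    define g where "g \<alpha> = k \<alpha> * k \<beta> * (\<alpha> \<bullet> \<beta>) *
       (f (reflection \<beta> x) - f (reflection \<alpha> (reflection \<beta> x))) / ((\<alpha> \<bullet> reflection \<beta> x) * (\<beta> \<bullet> x))" for \<alpha>
    have inj: "inj_on (reflection \<beta>) R" by (metis inj_onI reflection_reflection)
    have "(\<Sum>\<alpha>\<in>R. g \<alpha>) = (\<Sum>\<alpha>\<in>reflection \<beta> ` R. g \<alpha>)" using \<beta> by (simp add: reflection_image)
    also have "\<dots> = (\<Sum>\<alpha>\<in>R. g (reflection \<beta> \<alpha>))" using inj by (simp add: sum.reindex)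
    also have "\<dots> = (\<Sum>\<alpha>\<in>R. - (h \<alpha> \<beta> * (f (reflection \<beta> x) - f (reflection \<beta> (reflection \<alpha> x)))))"
    proof (rule sum.cong[OF refl])
      fix \<alpha> assume "\<alpha> \<in> R"
      have "reflection \<beta> \<alpha> \<bullet> \<beta> = - (\<alpha> \<bullet> \<beta>)" by (metis inner_commute inner_reflection_self)
      then show "g (reflection \<beta> \<alpha>) =
          - (h \<alpha> \<beta> * (f (reflection \<beta> x) - f (reflection \<beta> (reflection \<alpha> x))))"
        using \<beta> \<open>\<alpha> \<in> R\<close> by (simp add: g_def h_def k_reflection inner_reflection_reflection reflection_conjugate)
    qed
    finally have g: "(\<Sum>\<alpha>\<in>R. g \<alpha>) =
      (\<Sum>\<alpha>\<in>R. - (h \<alpha> \<beta> * (f (reflection \<beta> x) - f (reflection \<beta> (reflection \<alpha> x)))))" .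
    have "(\<Sum>\<alpha>\<in>R. ?t \<alpha> \<beta>) = (\<Sum>\<alpha>\<in>R. h \<alpha> \<beta> * (f x - f (reflection \<alpha> x)) - g \<alpha>)"
      by (intro sum.cong) (simp_all add: h_def g_def diff_divide_distrib right_diff_distrib)
    also have "\<dots> = (\<Sum>\<alpha>\<in>R. h \<alpha> \<beta> * (f x - f (reflection \<alpha> x))) - (\<Sum>\<alpha>\<in>R. g \<alpha>)"
      by (rule sum_subtractf)
    finally show ?thesis unfolding g
      by (simp add: sum_subtractf[symmetric] algebra_simps sum_negf[symmetric] sum.distrib[symmetric])
  qed
  have even_\<alpha>: "?t (- \<alpha>) \<beta> = ?t \<alpha> \<beta>" if "\<alpha> \<in> R" for \<alpha> \<beta>
    using that by (simp add: k_uminus reflection_minus diff_divide_distrib algebra_simps)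
  have even_\<beta>: "?t \<alpha> (- \<beta>) = ?t \<alpha> \<beta>" if "\<beta> \<in> R" for \<alpha> \<beta>
    using that by (simp add: k_uminus reflection_minus)
  have "(\<Sum>\<beta>\<in>R. \<Sum>\<alpha>\<in>R. ?t \<alpha> \<beta>) = 2 * (\<Sum>\<beta>\<in>Rp. \<Sum>\<alpha>\<in>R. ?t \<alpha> \<beta>)"
    using even_\<beta> by (intro sum_R_even) (auto intro!: sum.cong)
  also have "(\<Sum>\<beta>\<in>Rp. \<Sum>\<alpha>\<in>R. ?t \<alpha> \<beta>) = (\<Sum>\<beta>\<in>Rp. 2 * (\<Sum>\<alpha>\<in>Rp. ?t \<alpha> \<beta>))"
    using even_\<alpha> by (intro sum.cong sum_R_even) auto
  finally have four: "(\<Sum>\<beta>\<in>R. \<Sum>\<alpha>\<in>R. ?t \<alpha> \<beta>) = 4 * (\<Sum>\<beta>\<in>Rp. \<Sum>\<alpha>\<in>Rp. ?t \<alpha> \<beta>)"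
    by (simp add: sum_distrib_left)
  have "(\<Sum>\<beta>\<in>R. \<Sum>\<alpha>\<in>R. ?t \<alpha> \<beta>) =
      (\<Sum>\<beta>\<in>R. \<Sum>\<alpha>\<in>R. h \<alpha> \<beta> * (f x - f (reflection \<beta> (reflection \<alpha> x)))) +
      (\<Sum>\<beta>\<in>R. \<Sum>\<alpha>\<in>R. h \<alpha> \<beta> * f (reflection \<beta> x)) - (\<Sum>\<beta>\<in>R. \<Sum>\<alpha>\<in>R. h \<alpha> \<beta> * f (reflection \<alpha> x))"
    using inner_sum by (simp add: sum.distrib sum_subtractf cong: sum.cong)
  also have "(\<Sum>\<beta>\<in>R. \<Sum>\<alpha>\<in>R. h \<alpha> \<beta> * f (reflection \<alpha> x)) =
      (\<Sum>\<beta>\<in>R. \<Sum>\<alpha>\<in>R. h \<alpha> \<beta> * f (reflection \<beta> x))"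
    by (subst sum.swap) (simp add: h_def ac_simps inner_commute)
  also have "(\<Sum>\<beta>\<in>R. \<Sum>\<alpha>\<in>R. h \<alpha> \<beta> * (f x - f (reflection \<beta> (reflection \<alpha> x)))) = 0"
  proof -
    have "(\<Sum>\<beta>\<in>R. \<Sum>\<alpha>\<in>R. h \<alpha> \<beta> * (f x - f (reflection \<beta> (reflection \<alpha> x)))) =
      (\<Sum>(\<alpha>, \<beta>)\<in>R \<times> R. k \<alpha> * k \<beta> * (f x - f (reflection \<beta> (reflection \<alpha> x))) *
           ((\<alpha> \<bullet> \<beta>) / ((\<alpha> \<bullet> x) * (\<beta> \<bullet> x))))"
      by (subst sum.swap, subst sum.cartesian_product) (auto simp: h_def intro!: sum.cong)
    then show ?thesis using dunkl_pair_identity[of x f] x0 by simp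
  qed
  finally show ?thesis using four by simp
qed

text \<open>Off the hyperplanes the difference quotients can be differentiated term by term. The derivative
  of \<open>f \<circ> \<sigma>\<^sub>\<alpha>\<close> along \<open>\<alpha>\<close> is minus the derivative of \<open>f\<close> at \<open>\<sigma>\<^sub>\<alpha> x\<close>, so the gradients at the reflected points
  cancel between the two applications of the Dunkl operators, leaving the factor \<open>2\<close>.\<close>

lemma dunkl_laplacian_eq_dunkl_expr:
  assumes S: "open S" "\<And>\<alpha> x. \<alpha> \<in> R \<Longrightarrow> x \<in> S \<Longrightarrow> reflection \<alpha> x \<in> S"
    and f: "C2_on S f" and x: "x \<in> S" "x \<in> regular"
  shows "dunkl_laplacian Rp k f x = dunkl_expr f x"
proof -
  interpret C2_function S f using S f by unfold_locales
  let ?\<sigma> = reflection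
  have x0: "\<alpha> \<in> Rp \<Longrightarrow> \<alpha> \<bullet> x \<noteq> 0" for \<alpha> using x Rp_R by (auto simp: regular_def)
  define T where "T b y = partial b y + (\<Sum>\<alpha>\<in>Rp. k \<alpha> * (\<alpha> \<bullet> b) * ((f y - f (?\<sigma> \<alpha> y)) / (\<alpha> \<bullet> y)))" for b y
  have T: "dunkl_operator Rp k b f y = T b y" if "y \<in> regular" for b y
    using that Rp_R by (auto simp: dunkl_operator_def T_def dunkl_quotient_def regular_def intro!: sum.cong)
  define DT where "DT b h = frechet_derivative (partial b) (at x) h + (\<Sum>\<alpha>\<in>Rp. k \<alpha> * (\<alpha> \<bullet> b) *
      ((gradient f x \<bullet> h - gradient f (?\<sigma> \<alpha> x) \<bullet> ?\<sigma> \<alpha> h) / (\<alpha> \<bullet> x)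
        - (f x - f (?\<sigma> \<alpha> x)) * (\<alpha> \<bullet> h) / (\<alpha> \<bullet> x)\<^sup>2))" for b h
  have derT: "(T b has_derivative DT b) (at x)" if b: "b \<in> Basis" for b
  proof -
    have comp: "((\<lambda>y. f (?\<sigma> \<alpha> y)) has_derivative (\<lambda>h. gradient f (?\<sigma> \<alpha> x) \<bullet> ?\<sigma> \<alpha> h)) (at x)"
      if "\<alpha> \<in> Rp" for \<alpha>
    proof (rule has_derivative_compose[where f = "?\<sigma> \<alpha>"])
      show "(?\<sigma> \<alpha> has_derivative ?\<sigma> \<alpha>) (at x)"
        by (rule bounded_linear_imp_has_derivative[OF bounded_linear_reflection])
    qed (use that x S Rp_R derivative in auto)
    have "((\<lambda>y. (f y - f (?\<sigma> \<alpha> y)) / (\<alpha> \<bullet> y)) has_derivative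
       (\<lambda>h. (gradient f x \<bullet> h - gradient f (?\<sigma> \<alpha> x) \<bullet> ?\<sigma> \<alpha> h) / (\<alpha> \<bullet> x)
        - (f x - f (?\<sigma> \<alpha> x)) * (\<alpha> \<bullet> h) / (\<alpha> \<bullet> x)\<^sup>2)) (at x)" if "\<alpha> \<in> Rp" for \<alpha>
      using x0[OF that]
      by (auto intro!: derivative_eq_intros comp[OF that] derivative[OF x(1)]
          simp: fun_eq_iff field_simps power2_eq_square)
    then show ?thesis unfolding T_def DT_def
      by (intro has_derivative_add has_derivative_sum has_derivative_mult_right
          partial_derivative x(1) b)
  qed
  have derD: "frechet_derivative (dunkl_operator Rp k b f) (at x) = DT b" if b: "b \<in> Basis" for b
  proof -
    have "(dunkl_operator Rp k b f has_derivative DT b) (at x)"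
      using T by (intro has_derivative_transform_within_open[OF derT[OF b] open_regular x(2)]) auto
    then show ?thesis using frechet_derivative_at by metis
  qed
  have "dunkl_laplacian Rp k f x =
      (\<Sum>b\<in>Basis. DT b b + (\<Sum>\<beta>\<in>Rp. k \<beta> * (\<beta> \<bullet> b) * ((T b x - T b (?\<sigma> \<beta> x)) / (\<beta> \<bullet> x))))"
    unfolding dunkl_laplacian_def
  proof (rule sum.cong[OF refl])
    fix b :: 'a assume b: "b \<in> Basis"
    show "dunkl_operator Rp k b (dunkl_operator Rp k b f) x =
        DT b b + (\<Sum>\<beta>\<in>Rp. k \<beta> * (\<beta> \<bullet> b) * ((T b x - T b (?\<sigma> \<beta> x)) / (\<beta> \<bullet> x)))"
      using x0 x regular_reflection Rp_R
      by (subst dunkl_operator_def) (simp add: derD[OF b] dunkl_quotient_def T)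
  qed
  also have "\<dots> = (\<Sum>b\<in>Basis. DT b b) +
      (\<Sum>\<beta>\<in>Rp. k \<beta> * ((\<Sum>b\<in>Basis. (\<beta> \<bullet> b) * T b x) - (\<Sum>b\<in>Basis. (\<beta> \<bullet> b) * T b (?\<sigma> \<beta> x))) / (\<beta> \<bullet> x))"
    unfolding sum.distrib
    by (subst sum.swap[of _ Rp Basis]) (simp add: sum_distrib_left sum_divide_distrib sum_subtractf[symmetric] algebra_simps)
  also have "(\<Sum>b\<in>Basis. DT b b) = laplace f x + (\<Sum>\<alpha>\<in>Rp. k \<alpha> *
      ((\<alpha> \<bullet> gradient f x + \<alpha> \<bullet> gradient f (?\<sigma> \<alpha> x)) / (\<alpha> \<bullet> x)
        - (f x - f (?\<sigma> \<alpha> x)) * (\<alpha> \<bullet> \<alpha>) / (\<alpha> \<bullet> x)\<^sup>2))"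
  proof -
    have "(\<Sum>b\<in>Basis. k \<alpha> * (\<alpha> \<bullet> b) *
      ((gradient f x \<bullet> b - gradient f (?\<sigma> \<alpha> x) \<bullet> ?\<sigma> \<alpha> b) / (\<alpha> \<bullet> x)
        - (f x - f (?\<sigma> \<alpha> x)) * (\<alpha> \<bullet> b) / (\<alpha> \<bullet> x)\<^sup>2)) =
      k \<alpha> * ((\<alpha> \<bullet> gradient f x + \<alpha> \<bullet> gradient f (?\<sigma> \<alpha> x)) / (\<alpha> \<bullet> x)
        - (f x - f (?\<sigma> \<alpha> x)) * (\<alpha> \<bullet> \<alpha>) / (\<alpha> \<bullet> x)\<^sup>2)" for \<alpha>
    proof -
      define p q s where "p = k \<alpha> / (\<alpha> \<bullet> x)" "q = k \<alpha> * ((f x - f (?\<sigma> \<alpha> x)) / (\<alpha> \<bullet> x)\<^sup>2)"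
        "s = ?\<sigma> \<alpha> (gradient f (?\<sigma> \<alpha> x))"
      have "(\<Sum>b\<in>Basis. k \<alpha> * (\<alpha> \<bullet> b) *
        ((gradient f x \<bullet> b - gradient f (?\<sigma> \<alpha> x) \<bullet> ?\<sigma> \<alpha> b) / (\<alpha> \<bullet> x)
          - (f x - f (?\<sigma> \<alpha> x)) * (\<alpha> \<bullet> b) / (\<alpha> \<bullet> x)\<^sup>2)) =
        (\<Sum>b\<in>Basis. p * ((\<alpha> \<bullet> b) * (gradient f x \<bullet> b)) - p * ((\<alpha> \<bullet> b) * (s \<bullet> b)) - q * ((\<alpha> \<bullet> b) * (\<alpha> \<bullet> b)))"
        by (intro sum.cong) (simp_all add: p_q_s_def inner_reflection_right diff_divide_distrib algebra_simps)
      also have "\<dots> = p * (\<alpha> \<bullet> gradient f x) - p * (\<alpha> \<bullet> s) - q * (\<alpha> \<bullet> \<alpha>)"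
        by (simp add: sum_subtractf sum_distrib_left[symmetric] euclidean_inner[symmetric])
      also have "\<alpha> \<bullet> s = - (\<alpha> \<bullet> gradient f (?\<sigma> \<alpha> x))" by (simp add: p_q_s_def)
      finally show ?thesis by (simp add: p_q_s_def algebra_simps add_divide_distrib)
    qed
    then show ?thesis unfolding DT_def sum.distrib laplace_def
      by (subst sum.swap[of _ Rp Basis]) simp
  qed
  also have "(\<Sum>\<beta>\<in>Rp. k \<beta> * ((\<Sum>b\<in>Basis. (\<beta> \<bullet> b) * T b x) - (\<Sum>b\<in>Basis. (\<beta> \<bullet> b) * T b (?\<sigma> \<beta> x))) / (\<beta> \<bullet> x)) =
     (\<Sum>\<beta>\<in>Rp. k \<beta> * ((\<beta> \<bullet> gradient f x - \<beta> \<bullet> gradient f (?\<sigma> \<beta> x)) / (\<beta> \<bullet> x)) +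
       (\<Sum>\<alpha>\<in>Rp. k \<alpha> * k \<beta> * (\<alpha> \<bullet> \<beta>) * ((f x - f (?\<sigma> \<alpha> x)) / (\<alpha> \<bullet> x) -
       (f (?\<sigma> \<beta> x) - f (?\<sigma> \<alpha> (?\<sigma> \<beta> x))) / (\<alpha> \<bullet> ?\<sigma> \<beta> x)) / (\<beta> \<bullet> x)))"
  proof (rule sum.cong[OF refl])
    fix \<beta> assume "\<beta> \<in> Rp"
    have TT: "(\<Sum>b\<in>Basis. (\<beta> \<bullet> b) * T b y) = \<beta> \<bullet> gradient f y +
        (\<Sum>\<alpha>\<in>Rp. k \<alpha> * (\<alpha> \<bullet> \<beta>) * ((f y - f (?\<sigma> \<alpha> y)) / (\<alpha> \<bullet> y)))" for y
    proof -
      have "(\<Sum>b\<in>Basis. (\<beta> \<bullet> b) * T b y) = (\<Sum>b\<in>Basis. (\<beta> \<bullet> b) * (gradient f y \<bullet> b)) +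
         (\<Sum>b\<in>Basis. \<Sum>\<alpha>\<in>Rp. k \<alpha> * ((\<alpha> \<bullet> b) * (\<beta> \<bullet> b)) * ((f y - f (?\<sigma> \<alpha> y)) / (\<alpha> \<bullet> y)))"
        by (simp add: T_def distrib_left sum.distrib gradient_inner_Basis sum_distrib_left ac_simps)
      also have "(\<Sum>b\<in>Basis. \<Sum>\<alpha>\<in>Rp. k \<alpha> * ((\<alpha> \<bullet> b) * (\<beta> \<bullet> b)) * ((f y - f (?\<sigma> \<alpha> y)) / (\<alpha> \<bullet> y))) =
         (\<Sum>\<alpha>\<in>Rp. k \<alpha> * (\<alpha> \<bullet> \<beta>) * ((f y - f (?\<sigma> \<alpha> y)) / (\<alpha> \<bullet> y)))"
        by (subst sum.swap) (simp only: sum_distrib_left[symmetric] sum_distrib_right[symmetric] euclidean_inner[symmetric])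
      finally show ?thesis by (simp only: euclidean_inner[symmetric])
    qed
    show "k \<beta> * ((\<Sum>b\<in>Basis. (\<beta> \<bullet> b) * T b x) - (\<Sum>b\<in>Basis. (\<beta> \<bullet> b) * T b (?\<sigma> \<beta> x))) / (\<beta> \<bullet> x) =
      k \<beta> * ((\<beta> \<bullet> gradient f x - \<beta> \<bullet> gradient f (?\<sigma> \<beta> x)) / (\<beta> \<bullet> x)) +
       (\<Sum>\<alpha>\<in>Rp. k \<alpha> * k \<beta> * (\<alpha> \<bullet> \<beta>) * ((f x - f (?\<sigma> \<alpha> x)) / (\<alpha> \<bullet> x) -
       (f (?\<sigma> \<beta> x) - f (?\<sigma> \<alpha> (?\<sigma> \<beta> x))) / (\<alpha> \<bullet> ?\<sigma> \<beta> x)) / (\<beta> \<bullet> x))"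
    proof -
      define a where "a \<alpha> = k \<alpha> * (\<alpha> \<bullet> \<beta>) * ((f x - f (?\<sigma> \<alpha> x)) / (\<alpha> \<bullet> x))" for \<alpha>
      define b where "b \<alpha> = k \<alpha> * (\<alpha> \<bullet> \<beta>) *
        ((f (?\<sigma> \<beta> x) - f (?\<sigma> \<alpha> (?\<sigma> \<beta> x))) / (\<alpha> \<bullet> ?\<sigma> \<beta> x))" for \<alpha>
      have factor: "A * B * C * (q - q') / D = B / D * (A * C * q - A * C * q')" for A B C D q q' :: real
        by (simp add: algebra_simps diff_divide_distrib)
      have "(\<Sum>\<alpha>\<in>Rp. k \<alpha> * k \<beta> * (\<alpha> \<bullet> \<beta>) * ((f x - f (?\<sigma> \<alpha> x)) / (\<alpha> \<bullet> x) -
       (f (?\<sigma> \<beta> x) - f (?\<sigma> \<alpha> (?\<sigma> \<beta> x))) / (\<alpha> \<bullet> ?\<sigma> \<beta> x)) / (\<beta> \<bullet> x)) =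
        (\<Sum>\<alpha>\<in>Rp. k \<beta> / (\<beta> \<bullet> x) * (a \<alpha> - b \<alpha>))"
        unfolding a_def b_def by (intro sum.cong refl factor)
      also have "\<dots> = k \<beta> / (\<beta> \<bullet> x) * ((\<Sum>\<alpha>\<in>Rp. a \<alpha>) - (\<Sum>\<alpha>\<in>Rp. b \<alpha>))"
        by (simp only: sum_distrib_left[symmetric] sum_subtractf)
      finally show ?thesis unfolding TT a_def[symmetric] b_def[symmetric]
        by (simp add: algebra_simps add_divide_distrib diff_divide_distrib)
    qed
  qed
  also have "\<dots> = (\<Sum>\<beta>\<in>Rp. k \<beta> * ((\<beta> \<bullet> gradient f x - \<beta> \<bullet> gradient f (?\<sigma> \<beta> x)) / (\<beta> \<bullet> x)))"
    using difference_terms_vanish[OF x(2), of f] by (simp add: sum.distrib)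
  finally show ?thesis
    unfolding dunkl_expr_def
    by (simp add: sum.distrib[symmetric] add.assoc)
      (intro sum.cong refl, simp add: algebra_simps add_divide_distrib diff_divide_distrib)
qed

end

section \<open>Lebesgue integrals\<close>

subsection \<open>Isometries and dilations\<close>

lemma AE_lborel_negligible:
  assumes "negligible N" shows "AE x in lborel. x \<notin> N"
proof -
  have "N \<in> null_sets (completion lborel)" using assms by (simp add: negligible_iff_null_sets)
  then show ?thesis
    using AE_completion_iff AE_not_in by blast
qed

text \<open>For a Borel set \<open>A\<close> and the unit ball \<open>B\<close>, the pairs \<open>(y, z)\<close> with \<open>y \<in> B\<close> and \<open>f z + y \<in> A\<close>
  are counted in two ways: with \<open>y\<close> fixed, and, after translating by \<open>f z\<close>, with \<open>f z + y\<close> fixed.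
  This is the uniqueness of Haar measure; the isometry \<open>f\<close> enters through the measure of the ball.\<close>

lemma lborel_distr_isometry:
  fixes f :: "'a::euclidean_space \<Rightarrow> 'a"
  assumes f: "orthogonal_transformation f"
  shows "distr lborel borel f = lborel"
proof (rule measure_eqI)
  have lin: "linear f" using f by (simp add: orthogonal_transformation_linear)
  have cont: "continuous_on UNIV f" using lin by (simp add: linear_continuous_on linear_conv_bounded_linear)
  then have [measurable]: "f \<in> borel_measurable borel" by (rule borel_measurable_continuous_onI)
  obtain g where g: "\<And>x. f (g x) = x" "\<And>x. g (f x) = x"
    using orthogonal_transformation_bij[OF f] by (metis bij_pointE)
  show "sets (distr lborel borel f) = sets lborel" by simp
  fix A assume "A \<in> sets (distr lborel borel f)"
  then have [measurable]: "A \<in> sets borel" by simp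
  let ?B = "ball (0::'a) 1"
  let ?m = "emeasure lborel ?B"
  have translate: "(\<integral>\<^sup>+z. h (c + z) \<partial>lborel) = (\<integral>\<^sup>+z. h z \<partial>lborel)"
    if [measurable]: "h \<in> borel_measurable borel" for h :: "'a \<Rightarrow> ennreal" and c
    by (subst (2) lborel_distr_plus[of c, symmetric]) (simp add: nn_integral_distr)
  have "emeasure (distr lborel borel f) A * ?m =
      (\<integral>\<^sup>+y. indicator ?B y * (\<integral>\<^sup>+z. indicator A (f z + y) \<partial>lborel) \<partial>lborel)"
  proof -
    have "(\<integral>\<^sup>+z. indicator A (f z + y) \<partial>lborel) = emeasure (distr lborel borel f) A" for y
    proof -
      have "(\<integral>\<^sup>+z. indicator A (f z + y) \<partial>lborel) = (\<integral>\<^sup>+z. indicator A (f (g y + z)) \<partial>lborel)"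
        using linear_add[OF lin] g by (simp add: add.commute)
      also have "\<dots> = (\<integral>\<^sup>+z. indicator A (f z) \<partial>lborel)"
        by (rule translate) simp
      also have "\<dots> = (\<integral>\<^sup>+z. indicator A z \<partial>distr lborel borel f)"
        by (rule nn_integral_distr[symmetric]) simp_all
      also have "\<dots> = emeasure (distr lborel borel f) A"
        by (rule nn_integral_indicator) simp
      finally show ?thesis .
    qed
    moreover have "(\<integral>\<^sup>+y. indicator ?B y * emeasure (distr lborel borel f) A \<partial>lborel) =
        ?m * emeasure (distr lborel borel f) A"
      by (subst nn_integral_multc) (auto intro: borel_measurable_indicator)
    ultimately show ?thesis by (simp add: mult.commute)
  qed
  also have "\<dots> = (\<integral>\<^sup>+y. \<integral>\<^sup>+z. indicator ?B y * indicator A (f z + y) \<partial>lborel \<partial>lborel)"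
    by (simp add: nn_integral_cmult)
  also have "\<dots> = (\<integral>\<^sup>+z. \<integral>\<^sup>+y. indicator ?B y * indicator A (f z + y) \<partial>lborel \<partial>lborel)"
    by (rule lborel_pair.Fubini') (unfold indicator_def mem_ball dist_0_norm, measurable)
  also have "\<dots> = (\<integral>\<^sup>+z. \<integral>\<^sup>+y. indicator ?B (y - f z) * indicator A y \<partial>lborel \<partial>lborel)"
  proof (rule nn_integral_cong)
    fix z
    have "(\<lambda>y. indicator ?B (y - f z) * indicator A y :: ennreal) \<in> borel_measurable borel"
      unfolding indicator_def mem_ball dist_0_norm by measurable
    from translate[OF this, of "f z"]
    show "(\<integral>\<^sup>+y. indicator ?B y * indicator A (f z + y) \<partial>lborel) =
        (\<integral>\<^sup>+y. indicator ?B (y - f z) * indicator A y \<partial>lborel)" by simp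
  qed
  also have "\<dots> = (\<integral>\<^sup>+y. \<integral>\<^sup>+z. indicator ?B (y - f z) * indicator A y \<partial>lborel \<partial>lborel)"
    by (rule lborel_pair.Fubini') (unfold indicator_def mem_ball dist_0_norm, measurable)
  also have "\<dots> = (\<integral>\<^sup>+y. ?m * indicator A y \<partial>lborel)"
  proof (rule nn_integral_cong)
    fix y
    have "indicator ?B (y - f z) = (indicator (ball (g y) 1) z :: ennreal)" for z
    proof -
      have "norm (y - f z) = norm (g y - z)"
        using f g(1)[of y] by (metis linear_diff[OF lin] orthogonal_transformation_norm)
      then show ?thesis by (simp add: indicator_def dist_norm norm_minus_commute[of "f z" y])
    qed
    then have "(\<integral>\<^sup>+z. indicator ?B (y - f z) * indicator A y \<partial>lborel) =
        emeasure lborel (ball (g y) 1) * indicator A y"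
      by (simp, subst nn_integral_multc) (auto intro: borel_measurable_indicator)
    then show "(\<integral>\<^sup>+z. indicator ?B (y - f z) * indicator A y \<partial>lborel) = ?m * indicator A y"
      by (simp add: emeasure_ball)
  qed
  also have "\<dots> = emeasure lborel A * ?m"
    by (subst nn_integral_cmult) (simp_all add: mult.commute)
  finally have "emeasure (distr lborel borel f) A * ?m = emeasure lborel A * ?m" .
  moreover have "?m \<noteq> 0" "?m \<noteq> top"
    using less_imp_neq[OF unit_ball_vol_pos[of "real DIM('a)"]] by (auto simp: emeasure_ball)
  ultimately show "emeasure (distr lborel borel f) A = emeasure lborel A"
    by (simp add: ennreal_mult_cancel_left mult.commute[of _ ?m])
qed

lemma orthogonal_transformation_reflection: "orthogonal_transformation (reflection \<alpha>)"
  by (simp add: orthogonal_transformation_def linear_reflection inner_reflection_reflection)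

lemma lborel_distr_reflection: "distr lborel borel (reflection \<alpha>) = lborel"
  by (intro lborel_distr_isometry orthogonal_transformation_reflection)

lemma integral_reflection:
  fixes h :: "'a::euclidean_space \<Rightarrow> real"
  assumes [measurable]: "h \<in> borel_measurable borel"
  shows "(LINT x|lborel. h (reflection \<alpha> x)) = (LINT x|lborel. h x)"
  by (subst (2) lborel_distr_reflection[of \<alpha>, symmetric]) (simp add: integral_distr)

text \<open>By the change of variables the integral is its own negative; a non-integrable function has
  integral \<open>0\<close> by convention.\<close>

lemma integral_antisymmetric:
  fixes h :: "'a::euclidean_space \<Rightarrow> real"
  assumes "h \<in> borel_measurable borel" "\<And>x. h (reflection \<alpha> x) = - h x"
  shows "(LINT x|lborel. h x) = 0"
  using integral_reflection[OF assms(1), of \<alpha>] assms(2) by simp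

lemma nn_integral_dilation:
  fixes h :: "'a::euclidean_space \<Rightarrow> ennreal"
  assumes [measurable]: "h \<in> borel_measurable borel" and c: "0 < c"
  shows "(\<integral>\<^sup>+x. h x \<partial>lborel) = ennreal (c ^ DIM('a)) * (\<integral>\<^sup>+x. h (c *\<^sub>R x) \<partial>lborel)"
  using c by (subst lborel_affine[of c 0]) (simp_all add: nn_integral_density nn_integral_distr nn_integral_cmult)

subsection \<open>Integration by parts\<close>

text \<open>The integral of a difference quotient of \<open>V\<close> vanishes by translation invariance; the quotients
  are bounded by the Lipschitz constant and supported in a fixed ball.\<close>

lemma integral_directional_derivative_zero:
  fixes V D :: "'a::euclidean_space \<Rightarrow> real"
  assumes lip: "\<And>x y. \<bar>V x - V y\<bar> \<le> L * norm (x - y)"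
    and supp: "\<And>x. r \<le> norm x \<Longrightarrow> V x = 0"
    and [measurable]: "D \<in> borel_measurable borel"
    and der: "AE x in lborel. \<exists>V'. (V has_derivative V') (at x) \<and> V' b = D x"
  shows "integrable lborel D" "(LINT x|lborel. D x) = 0"
proof -
  have "0 \<le> L"
  proof -
    obtain e :: 'a where "e \<in> Basis" using nonempty_Basis by blast
    then have "0 \<le> L * norm (e - 0)" using lip[of e 0] by linarith
    then show ?thesis using \<open>e \<in> Basis\<close> by simp
  qed
  then have "L-lipschitz_on UNIV V" using lip by (auto intro!: lipschitz_onI simp: dist_norm)
  then have contV: "continuous_on UNIV V" by (rule lipschitz_on_continuous_on)
  then have [measurable]: "V \<in> borel_measurable borel" by (rule borel_measurable_continuous_onI)
  define t where "t n = 1 / real (Suc n)" for n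
  have t: "0 < t n" "t n \<le> 1" for n by (auto simp: t_def)
  have t0: "filterlim t (at 0) sequentially"
  proof -
    have "t \<longlonglongrightarrow> 0"
      using LIMSEQ_inverse_real_of_nat unfolding t_def[abs_def] inverse_eq_divide .
    then show ?thesis using t(1) by (auto simp: filterlim_at less_imp_neq[symmetric])
  qed
  define q where "q n x = (V (x + t n *\<^sub>R b) - V x) / t n" for n x
  \<comment> \<open>For steps of length at most \<open>1\<close> the quotients vanish outside the enlarged ball.\<close>
  define w where "w x = (L * norm b) * indicator (cball 0 (\<bar>r\<bar> + norm b)) x" for x :: 'a
  have intV: "integrable lborel V"
  proof -
    have "integrable lborel (\<lambda>x. indicator (cball 0 \<bar>r\<bar>) x *\<^sub>R V x)"
      using contV by (intro borel_integrable_compact[unfolded set_integrable_def]) (auto intro: continuous_on_subset)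
    moreover have "(\<lambda>x. indicator (cball 0 \<bar>r\<bar>) x *\<^sub>R V x) = V"
      using supp by (auto simp: indicator_def fun_eq_iff)
    ultimately show ?thesis by simp
  qed
  have q0: "(LINT x|lborel. q n x) = 0" for n
  proof -
    have shift: "lborel = distr lborel borel (\<lambda>x. x + t n *\<^sub>R b)"
    proof -
      have "(+) (t n *\<^sub>R b) = (\<lambda>x. x + t n *\<^sub>R b)" by (auto simp: add.commute)
      then show ?thesis using lborel_distr_plus[of "t n *\<^sub>R b"] by simp
    qed
    have "integrable lborel (\<lambda>x. V (x + t n *\<^sub>R b))"
      using intV by (subst (asm) shift) (simp add: integrable_distr_eq)
    moreover have "(LINT x|lborel. V (x + t n *\<^sub>R b)) = (LINT x|lborel. V x)"
      by (subst (2) shift) (simp add: integral_distr)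
    ultimately show ?thesis using intV by (simp add: q_def)
  qed
  have w: "integrable lborel w"
    unfolding w_def by (intro integrable_mult_right integrable_real_indicator)
      (auto simp: emeasure_cball)
  have lim: "AE x in lborel. (\<lambda>n. q n x) \<longlonglongrightarrow> D x"
      using der
    proof eventually_elim
      case (elim x)
      then obtain V' where V': "(V has_derivative V') (at x)" "V' b = D x" by blast
      have "((\<lambda>s. V (x + s *\<^sub>R b)) has_derivative (\<lambda>s. V' (s *\<^sub>R b))) (at 0)"
        by (rule has_derivative_compose[where f = "\<lambda>s. x + s *\<^sub>R b"])
          (use V' in \<open>auto intro!: derivative_eq_intros\<close>)
      then have "((\<lambda>s. V (x + s *\<^sub>R b)) has_real_derivative D x) (at 0)"
        using V' by (simp add: has_field_derivative_def linear_scale[OF has_derivative_linear] mult_commute_abs)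
      then have "((\<lambda>s. (V (x + s *\<^sub>R b) - V x) / s) \<longlongrightarrow> D x) (at 0)"
        by (simp add: has_field_derivative_iff)
      from filterlim_compose[OF this t0] show ?case by (simp add: q_def)
    qed
  have bound: "AE x in lborel. norm (q n x) \<le> w x" for n
    proof (rule AE_I2)
      fix x :: 'a
      show "norm (q n x) \<le> w x"
      proof (cases "norm x \<le> \<bar>r\<bar> + norm b")
        case True
        have "\<bar>V (x + t n *\<^sub>R b) - V x\<bar> \<le> L * (t n * norm b)"
          using lip[of "x + t n *\<^sub>R b" x] t[of n] by simp
        then have "norm (q n x) \<le> L * norm b"
          using t[of n] by (simp add: q_def field_simps)
        then show ?thesis using True by (simp add: w_def)
      next
        case False
        have "norm (t n *\<^sub>R b) \<le> norm b" using t[of n] by (simp add: mult_left_le_one_le)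
        then have "r \<le> norm (x + t n *\<^sub>R b)"
          using False norm_diff_ineq[of x "t n *\<^sub>R b"] by linarith
        moreover have "r \<le> norm x" using False norm_ge_zero[of b] by linarith
        ultimately show ?thesis using supp False by (simp add: q_def w_def)
      qed
    qed
  have [measurable]: "q n \<in> borel_measurable lborel" for n by (simp add: q_def[abs_def])
  show "integrable lborel D"
    by (rule integrable_dominated_convergence[OF _ _ w lim bound]) simp_all
  have "(\<lambda>n. LINT x|lborel. q n x) \<longlonglongrightarrow> (LINT x|lborel. D x)"
    by (rule integral_dominated_convergence[OF _ _ w lim bound]) simp_all
  then show "(LINT x|lborel. D x) = 0" using q0 by (simp add: LIMSEQ_const_iff)
qed

lemma borel_measurable_sgn_vector [measurable (raw)]:
  fixes f :: "'b \<Rightarrow> 'a::euclidean_space"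
  assumes [measurable]: "f \<in> borel_measurable M"
  shows "(\<lambda>x. sgn (f x)) \<in> borel_measurable M"
  unfolding sgn_div_norm by measurable

subsection \<open>Polar coordinates\<close>

text \<open>The sphere is parametrized by the unit ball through \<open>sgn\<close>. After exchanging the integrals
  and dilating by \<open>1 / \<rho>\<close>, the right-hand side becomes the integral of \<open>(d / \<rho>) * G (\<rho> *\<^sub>R sgn x)\<close> over \<open>norm x < \<rho>\<close>; the
  substitution \<open>\<rho> = s * norm x\<close> turns it into integrals of dilations of \<open>G\<close>, weighted by
  \<open>d / s\<close> for \<open>s > 1\<close>.\<close>

lemma nn_integral_polar:
  fixes G :: "'a::euclidean_space \<Rightarrow> ennreal"
  assumes G[measurable]: "G \<in> borel_measurable borel"
  shows "(\<integral>\<^sup>+x. G x \<partial>lborel) = (\<integral>\<^sup>+x. indicator (ball 0 1) x *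
    (\<integral>\<^sup>+\<rho>. ennreal (if 0 < \<rho> then DIM('a) * \<rho> ^ (DIM('a) - 1) else 0) * G (\<rho> *\<^sub>R sgn x) \<partial>lborel) \<partial>lborel)"
proof -
  let ?d = "DIM('a)"
  define h where "h \<rho> = (if 0 < \<rho> then ?d * \<rho> ^ (?d - 1) else 0)" for \<rho> :: real
  have [measurable]: "h \<in> borel_measurable borel" unfolding h_def[abs_def] by simp
  have power_d: "\<rho> ^ (?d - Suc 0) = \<rho> ^ ?d / \<rho>" if "0 < \<rho>" for \<rho> :: real
    using that power_Suc[of \<rho> "?d - 1"] DIM_positive[where 'a='a] by simp
  have "(\<integral>\<^sup>+x. indicator (ball 0 1) x * (\<integral>\<^sup>+\<rho>. ennreal (h \<rho>) * G (\<rho> *\<^sub>R sgn x) \<partial>lborel) \<partial>lborel) =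
      (\<integral>\<^sup>+x. \<integral>\<^sup>+\<rho>. indicator (ball 0 1) x * (ennreal (h \<rho>) * G (\<rho> *\<^sub>R sgn x)) \<partial>lborel \<partial>lborel)"
    by (simp add: nn_integral_cmult)
  also have "\<dots> = (\<integral>\<^sup>+\<rho>. \<integral>\<^sup>+x. indicator (ball 0 1) x * (ennreal (h \<rho>) * G (\<rho> *\<^sub>R sgn x)) \<partial>lborel \<partial>lborel)"
    by (rule lborel_pair.Fubini') (unfold indicator_def mem_ball dist_0_norm, measurable)
  also have "\<dots> = (\<integral>\<^sup>+\<rho>. \<integral>\<^sup>+x. ennreal (if norm x < \<rho> then ?d / \<rho> else 0) * G (\<rho> *\<^sub>R sgn x) \<partial>lborel \<partial>lborel)"
  proof (rule nn_integral_cong)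
    fix \<rho> :: real
    show "(\<integral>\<^sup>+x. indicator (ball 0 1) x * (ennreal (h \<rho>) * G (\<rho> *\<^sub>R sgn x)) \<partial>lborel) =
      (\<integral>\<^sup>+x. ennreal (if norm x < \<rho> then ?d / \<rho> else 0) * G (\<rho> *\<^sub>R sgn x) \<partial>lborel)"
    proof (cases "0 < \<rho>")
      case False
      then have "\<not> norm x < \<rho>" for x :: 'a using norm_ge_zero[of x] by linarith
      then show ?thesis using False by (simp add: h_def)
    next
      case True
      have ball: "indicator (ball 0 1) ((1 / \<rho>) *\<^sub>R x) = (if norm x < \<rho> then 1 else 0 :: ennreal)" for x :: 'a
        using True by (auto simp: indicator_def field_simps)
      have sgn: "sgn ((1 / \<rho>) *\<^sub>R x) = sgn x" for x :: 'a
        using True by (simp add: sgn_scaleR)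
      have "(\<integral>\<^sup>+x. indicator (ball 0 1) x * (ennreal (h \<rho>) * G (\<rho> *\<^sub>R sgn x)) \<partial>lborel) =
        ennreal ((1 / \<rho>) ^ ?d) * (\<integral>\<^sup>+x. indicator (ball 0 1) ((1 / \<rho>) *\<^sub>R x) *
            (ennreal (h \<rho>) * G (\<rho> *\<^sub>R sgn ((1 / \<rho>) *\<^sub>R x))) \<partial>lborel)"
        using True by (intro nn_integral_dilation) (unfold indicator_def mem_ball dist_0_norm, measurable)
      also have "\<dots> = (\<integral>\<^sup>+x. ennreal ((1 / \<rho>) ^ ?d) * ((if norm x < \<rho> then 1 else 0) *
            (ennreal (h \<rho>) * G (\<rho> *\<^sub>R sgn x))) \<partial>lborel)"
        unfolding ball sgn by (rule nn_integral_cmult[symmetric]) simp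
      also have "\<dots> = (\<integral>\<^sup>+x. ennreal (if norm x < \<rho> then ?d / \<rho> else 0) * G (\<rho> *\<^sub>R sgn x) \<partial>lborel)"
      proof (rule nn_integral_cong)
        fix x :: 'a
        have "ennreal ((1 / \<rho>) ^ ?d) * ennreal (h \<rho>) = ennreal (?d / \<rho>)"
          using True by (simp add: h_def ennreal_mult'[symmetric] power_d power_divide)
        then show "ennreal ((1 / \<rho>) ^ ?d) * ((if norm x < \<rho> then 1 else 0) *
            (ennreal (h \<rho>) * G (\<rho> *\<^sub>R sgn x))) =
          ennreal (if norm x < \<rho> then ?d / \<rho> else 0) * G (\<rho> *\<^sub>R sgn x)"
          by (simp add: mult.assoc[symmetric])
      qed
      finally show ?thesis .
    qed
  qed
  also have "\<dots> = (\<integral>\<^sup>+x. \<integral>\<^sup>+\<rho>. ennreal (if norm x < \<rho> then ?d / \<rho> else 0) * G (\<rho> *\<^sub>R sgn x) \<partial>lborel \<partial>lborel)"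
    by (rule lborel_pair.Fubini') measurable
  also have "\<dots> = (\<integral>\<^sup>+x. \<integral>\<^sup>+s. ennreal (if 1 < s then ?d / s else 0) * G (s *\<^sub>R x) \<partial>lborel \<partial>lborel)"
  proof (rule nn_integral_cong_AE, rule AE_mp[OF AE_lborel_negligible[OF negligible_sing[of 0]]], rule AE_I2, rule impI)
    fix x :: 'a assume "x \<notin> {0}"
    then have x: "0 < norm x" by simp
    have "(\<integral>\<^sup>+\<rho>. ennreal (if norm x < \<rho> then ?d / \<rho> else 0) * G (\<rho> *\<^sub>R sgn x) \<partial>lborel) =
      ennreal \<bar>norm x\<bar> * (\<integral>\<^sup>+s. ennreal (if norm x < 0 + norm x * s then ?d / (0 + norm x * s) else 0) *
          G ((0 + norm x * s) *\<^sub>R sgn x) \<partial>lborel)"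
      using x by (intro nn_integral_real_affine) auto
    also have "\<dots> = (\<integral>\<^sup>+s. ennreal (norm x) * (ennreal (if norm x < norm x * s then ?d / (norm x * s) else 0) *
          G ((norm x * s) *\<^sub>R sgn x)) \<partial>lborel)"
      unfolding add_0_left abs_norm_cancel by (rule nn_integral_cmult[symmetric]) simp
    also have "\<dots> = (\<integral>\<^sup>+s. ennreal (if 1 < s then ?d / s else 0) * G (s *\<^sub>R x) \<partial>lborel)"
    proof (rule nn_integral_cong)
      fix s :: real
      have "(norm x * s) *\<^sub>R sgn x = s *\<^sub>R x" using x by (simp add: sgn_div_norm)
      moreover have "ennreal (norm x) * ennreal (if norm x < norm x * s then ?d / (norm x * s) else 0) =
          ennreal (if 1 < s then ?d / s else 0)"
        using x by (auto simp: ennreal_mult'[symmetric])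
      ultimately show "ennreal (norm x) * (ennreal (if norm x < norm x * s then ?d / (norm x * s) else 0) *
          G ((norm x * s) *\<^sub>R sgn x)) = ennreal (if 1 < s then ?d / s else 0) * G (s *\<^sub>R x)"
        by (simp add: mult.assoc[symmetric])
    qed
    finally show "(\<integral>\<^sup>+\<rho>. ennreal (if norm x < \<rho> then ?d / \<rho> else 0) * G (\<rho> *\<^sub>R sgn x) \<partial>lborel) =
      (\<integral>\<^sup>+s. ennreal (if 1 < s then ?d / s else 0) * G (s *\<^sub>R x) \<partial>lborel)" .
  qed
  also have "\<dots> = (\<integral>\<^sup>+s. \<integral>\<^sup>+x. ennreal (if 1 < s then ?d / s else 0) * G (s *\<^sub>R x) \<partial>lborel \<partial>lborel)"
    by (rule lborel_pair.Fubini') measurable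
  also have "\<dots> = (\<integral>\<^sup>+s. ennreal (if 1 < s then ?d / (s ^ ?d * s) else 0) * (\<integral>\<^sup>+x. G x \<partial>lborel) \<partial>lborel)"
  proof (rule nn_integral_cong)
    fix s :: real
    show "(\<integral>\<^sup>+x. ennreal (if 1 < s then ?d / s else 0) * G (s *\<^sub>R x) \<partial>lborel) =
      ennreal (if 1 < s then ?d / (s ^ ?d * s) else 0) * (\<integral>\<^sup>+x. G x \<partial>lborel)"
    proof (cases "1 < s")
      case True
      have "ennreal (?d / (s ^ ?d * s)) * (\<integral>\<^sup>+x. G x \<partial>lborel) =
          ennreal (?d / (s ^ ?d * s)) * (ennreal (s ^ ?d) * (\<integral>\<^sup>+x. G (s *\<^sub>R x) \<partial>lborel))"
        using True by (subst nn_integral_dilation[of G s]) simp_all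
      also have "\<dots> = ennreal (?d / s) * (\<integral>\<^sup>+x. G (s *\<^sub>R x) \<partial>lborel)"
        using True by (simp add: mult.assoc[symmetric] ennreal_mult'[symmetric])
      finally show ?thesis using True by (simp add: nn_integral_cmult)
    qed simp
  qed
  also have "\<dots> = (\<integral>\<^sup>+s. ennreal (if 1 < s then ?d / (s ^ ?d * s) else 0) \<partial>lborel) * (\<integral>\<^sup>+x. G x \<partial>lborel)"
    by (rule nn_integral_multc) simp
  also have "(\<integral>\<^sup>+s. ennreal (if 1 < s then ?d / (s ^ ?d * s) else 0) \<partial>lborel) =
      (\<integral>\<^sup>+s. ennreal (if 1 \<le> s then ?d / (s ^ ?d * s) else 0) * indicator {1..} s \<partial>lborel)"
  proof (rule nn_integral_cong_AE, rule AE_mp[OF AE_lborel_negligible[OF negligible_sing[of 1]]], rule AE_I2, rule impI)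
    fix s :: real assume "s \<notin> {1}"
    then show "ennreal (if 1 < s then ?d / (s ^ ?d * s) else 0) =
        ennreal (if 1 \<le> s then ?d / (s ^ ?d * s) else 0) * indicator {1..} s" by auto
  qed
  also have "\<dots> = ennreal (0 - (- inverse (1 ^ ?d)))"
  proof (rule nn_integral_FTC_atLeast[where F = "\<lambda>s. - inverse (s ^ ?d)" and T = 0])
    fix s :: real assume s: "1 \<le> s"
    have "((\<lambda>s. - inverse (s ^ ?d)) has_real_derivative
        (?d * s ^ (?d - 1)) * inverse ((s ^ ?d)\<^sup>2)) (at s)"
      using s by (auto intro!: derivative_eq_intros simp: power2_eq_square)
    also have "(?d * s ^ (?d - 1)) * inverse ((s ^ ?d)\<^sup>2) = (if 1 \<le> s then ?d / (s ^ ?d * s) else 0)"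
      using s by (simp add: power_d power2_eq_square field_simps)
    finally show "((\<lambda>s. - inverse (s ^ ?d)) has_real_derivative (if 1 \<le> s then ?d / (s ^ ?d * s) else 0)) (at s)" .
  next
    show "((\<lambda>s::real. - inverse (s ^ ?d)) \<longlongrightarrow> 0) at_top"
      using tendsto_inverse_0_at_top[OF filterlim_pow_at_top[OF DIM_positive[where 'a='a] filterlim_ident]]
        tendsto_minus by fastforce
  qed auto
  finally show ?thesis by (simp add: h_def)
qed

section \<open>The weak form of the Dunkl Laplacian\<close>

subsection \<open>Auxiliary facts on measurability and Lipschitz functions\<close>

text \<open>A function given on an open set \<open>S\<close> may be non-measurable outside; a factor vanishing there repairs this.\<close>

lemma borel_measurable_times_continuous_on:
  fixes q h :: "'a::euclidean_space \<Rightarrow> real"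
  assumes [measurable]: "q \<in> borel_measurable borel" and S: "open S" "continuous_on S h"
    and q: "\<And>x. x \<notin> S \<Longrightarrow> q x = 0"
  shows "(\<lambda>x. q x * h x) \<in> borel_measurable borel"
proof -
  have [measurable]: "(\<lambda>x. if x \<in> S then h x else 0) \<in> borel_measurable borel"
    using S by (intro borel_measurable_continuous_on_if) auto
  have "(\<lambda>x. q x * (if x \<in> S then h x else 0)) \<in> borel_measurable borel" by measurable
  also have "(\<lambda>x. q x * (if x \<in> S then h x else 0)) = (\<lambda>x. q x * h x)" using q by auto
  finally show ?thesis .
qed

lemma integrable_bounded_support:
  fixes h :: "'a::euclidean_space \<Rightarrow> real"
  assumes "h \<in> borel_measurable borel" "\<And>x. \<bar>h x\<bar> \<le> B" "\<And>x. r \<le> norm x \<Longrightarrow> h x = 0"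
  shows "integrable lborel h"
proof (rule Bochner_Integration.integrable_bound)
  show "integrable lborel (\<lambda>x::'a. B * indicator (cball 0 r) x)"
    by (intro integrable_mult_right integrable_real_indicator)
      (auto simp: emeasure_bounded_finite[OF bounded_cball, unfolded infinity_ennreal_def])
  show "AE x in lborel. norm (h x) \<le> norm (B * indicator (cball 0 r) x)"
    using assms(2,3) order_trans[OF abs_ge_zero assms(2)] by (auto simp: indicator_def)
qed (use assms in simp)

text \<open>The values of \<open>v\<close> outside the ball are arbitrary. A pair of points on both sides of the sphere is
  estimated by the factor \<open>\<psi>\<close> alone, which vanishes at the outer point.\<close>

lemma lipschitz_times_extend:
  fixes \<psi> v :: "'a::euclidean_space \<Rightarrow> real"
  assumes \<psi>: "\<And>x y. \<bar>\<psi> x - \<psi> y\<bar> \<le> L * norm (x - y)" "\<And>x. \<bar>\<psi> x\<bar> \<le> B"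
      "\<And>x. r \<le> norm x \<Longrightarrow> \<psi> x = 0"
    and v: "\<And>x y. norm x \<le> r \<Longrightarrow> norm y \<le> r \<Longrightarrow> \<bar>v x - v y\<bar> \<le> M * norm (x - y)"
      "\<And>x. norm x \<le> r \<Longrightarrow> \<bar>v x\<bar> \<le> C"
    and M: "0 \<le> M" and C: "0 \<le> C" and B: "0 \<le> B"
  shows "\<bar>\<psi> x * v x - \<psi> y * v y\<bar> \<le> (L * C + B * M) * norm (x - y)"
proof -
  have outside: "\<bar>\<psi> x * v x - \<psi> y * v y\<bar> \<le> (L * C + B * M) * norm (x - y)"
    if "norm x \<le> r" "r \<le> norm y" for x y
  proof -
    have "\<bar>\<psi> x * v x - \<psi> y * v y\<bar> = \<bar>\<psi> x - \<psi> y\<bar> * \<bar>v x\<bar>"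
      using \<psi>(3)[of y] that by (simp add: abs_mult)
    also have "\<dots> \<le> (L * norm (x - y)) * C"
      using \<psi>(1)[of x y] v(2)[of x] that abs_ge_zero[of "\<psi> x - \<psi> y"] by (intro mult_mono) linarith+
    also have "\<dots> \<le> (L * C + B * M) * norm (x - y)"
      using B M by (simp add: algebra_simps)
    finally show ?thesis .
  qed
  show ?thesis
  proof (cases "norm x \<le> r"; cases "norm y \<le> r")
    assume xy: "norm x \<le> r" "norm y \<le> r"
    have "\<psi> x * v x - \<psi> y * v y = (\<psi> x - \<psi> y) * v x + \<psi> y * (v x - v y)" by (simp add: algebra_simps)
    then have "\<bar>\<psi> x * v x - \<psi> y * v y\<bar> \<le> \<bar>\<psi> x - \<psi> y\<bar> * \<bar>v x\<bar> + \<bar>\<psi> y\<bar> * \<bar>v x - v y\<bar>"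
      by (metis abs_mult abs_triangle_ineq)
    also have "\<dots> \<le> (L * norm (x - y)) * C + B * (M * norm (x - y))"
      using \<psi>(1)[of x y] \<psi>(2)[of y] v xy B abs_ge_zero[of "\<psi> x - \<psi> y"]
      by (intro add_mono mult_mono) (auto intro: order_trans)
    finally show ?thesis by (simp add: algebra_simps)
  next
    assume "norm x \<le> r" "\<not> norm y \<le> r" then show ?thesis by (intro outside) auto
  next
    assume "\<not> norm x \<le> r" "norm y \<le> r"
    then show ?thesis using outside[of y x] by (simp add: abs_minus_commute norm_minus_commute)
  next
    assume "\<not> norm x \<le> r" "\<not> norm y \<le> r"
    then have "\<psi> x = 0" "\<psi> y = 0" using \<psi>(3) by auto
    moreover have "0 \<le> L * norm (x - y)" using \<psi>(1)[of x y] by linarith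
    ultimately show ?thesis using C B M by (simp add: distrib_right mult.commute[of _ C] mult.assoc)
  qed
qed

lemma lipschitz_on_compact_convex:
  fixes h :: "'a::euclidean_space \<Rightarrow> real"
  assumes K: "compact K" "convex K"
    and der: "\<And>x. x \<in> K \<Longrightarrow> (h has_derivative (\<lambda>v. G x \<bullet> v)) (at x)" and G: "continuous_on K G"
  obtains M where "0 \<le> M" "\<And>x y. x \<in> K \<Longrightarrow> y \<in> K \<Longrightarrow> \<bar>h x - h y\<bar> \<le> M * norm (x - y)"
    "\<And>x. x \<in> K \<Longrightarrow> norm (G x) \<le> M"
proof -
  obtain M where M: "\<And>x. x \<in> K \<Longrightarrow> norm (G x) \<le> M"
    using compact_imp_bounded[OF compact_continuous_image[OF G K(1)]] by (auto simp: bounded_iff)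
  have "norm (h x - h y) \<le> \<bar>M\<bar> * norm (x - y)" if "x \<in> K" "y \<in> K" for x y
  proof (rule differentiable_bound[OF K(2) _ _ that])
    fix z assume z: "z \<in> K"
    show "(h has_derivative (\<lambda>v. G z \<bullet> v)) (at z within K)"
      using der[OF z] by (rule has_derivative_at_withinI)
    show "onorm (\<lambda>v. G z \<bullet> v) \<le> \<bar>M\<bar>"
    proof (rule onorm_le)
      fix v
      have "norm (G z \<bullet> v) \<le> norm (G z) * norm v" by (simp add: Cauchy_Schwarz_ineq2)
      also have "\<dots> \<le> \<bar>M\<bar> * norm v" using M[OF z] by (intro mult_right_mono) auto
      finally show "norm (G z \<bullet> v) \<le> \<bar>M\<bar> * norm v" .
    qed
  qed
  then show ?thesis using M by (intro that[of "\<bar>M\<bar>"]) (auto intro: order_trans[OF M abs_ge_self])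
qed

lemma continuous_on_rpow_abs:
  assumes "continuous_on S f" "0 \<le> c"
  shows "continuous_on S (\<lambda>x. rpow \<bar>f x\<bar> c)"
proof (cases "c = 0")
  case False
  then have "continuous_on S (\<lambda>x. \<bar>f x\<bar> powr c)"
    using assms by (intro continuous_on_powr' continuous_intros) auto
  then show ?thesis using False by (simp add: rpow_def)
qed (simp add: rpow_def)

lemma rpow_mult: "0 \<le> x \<Longrightarrow> 0 \<le> y \<Longrightarrow> rpow (x * y) a = rpow x a * rpow y a"
  by (simp add: rpow_def powr_mult)

lemma rpow_nonneg [simp]: "0 \<le> rpow x a"
  by (simp add: rpow_def)

lemma rpow_pos: "0 < x \<Longrightarrow> rpow x a = x powr a"
  by (simp add: rpow_def)

subsection \<open>The weight\<close>

context root_data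
begin

abbreviation w :: "'a \<Rightarrow> real" where "w \<equiv> dunkl_weight Rp k"

text \<open>A smooth approximation of the weight; for \<open>0 < k \<alpha> < 1 / 2\<close> the weight itself has an unbounded
  gradient near the hyperplane of \<open>\<alpha>\<close>.\<close>

definition smooth_weight :: "real \<Rightarrow> 'a \<Rightarrow> real" where
  "smooth_weight \<epsilon> x = (\<Prod>\<alpha>\<in>Rp. ((\<alpha> \<bullet> x)\<^sup>2 + \<epsilon>) powr k \<alpha>)"

lemma weight_nonneg [simp]: "0 \<le> w x"
  by (simp add: dunkl_weight_def prod_nonneg)

lemma continuous_on_weight: "continuous_on S w"
  unfolding dunkl_weight_def
  by (intro continuous_on_prod continuous_on_rpow_abs continuous_intros) (simp add: Rp_k_nonneg)

lemma borel_measurable_weight [measurable]: "w \<in> borel_measurable borel"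
  by (rule borel_measurable_continuous_onI[OF continuous_on_weight])

lemma weight_reflection: "\<alpha> \<in> R \<Longrightarrow> w (reflection \<alpha> x) = w x"
  using prod_Rp_reflection[of \<alpha> "\<lambda>c t. rpow \<bar>t\<bar> (2 * c)" x] by (simp add: dunkl_weight_def)

lemma weight_scaleR:
  assumes "0 < c" shows "w (c *\<^sub>R x) = c powr (2 * dunkl_gamma Rp k) * w x"
proof -
  have "w (c *\<^sub>R x) = (\<Prod>\<alpha>\<in>Rp. c powr (2 * k \<alpha>)) * w x"
    using assms by (simp add: dunkl_weight_def abs_mult rpow_mult rpow_pos prod.distrib)
  also have "(\<Prod>\<alpha>\<in>Rp. c powr (2 * k \<alpha>)) = c powr (2 * dunkl_gamma Rp k)"
    using assms by (simp add: dunkl_gamma_def sum_distrib_left powr_sum)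
  finally show ?thesis .
qed

lemma weight_pos: "x \<in> regular \<Longrightarrow> 0 < w x"
  using Rp_R by (auto simp: dunkl_weight_def regular_def rpow_pos intro!: prod_pos)

lemma negligible_not_regular: "negligible (- regular)"
proof -
  have "- regular = (\<Union>\<alpha>\<in>R. {x. \<alpha> \<bullet> x = 0})" by (auto simp: regular_def)
  then show ?thesis using root_nonzero by (auto intro!: negligible_Union negligible_hyperplane)
qed

lemma AE_regular: "AE x in lborel. x \<in> regular"
  using AE_lborel_negligible[OF negligible_not_regular] by simp

lemma smooth_weight_pos:
  assumes "0 < \<epsilon>" shows "0 < smooth_weight \<epsilon> x"
proof -
  have "0 < (\<alpha> \<bullet> x)\<^sup>2 + \<epsilon>" for \<alpha> using assms by (simp add: add_nonneg_pos)
  then show ?thesis unfolding smooth_weight_def by (intro prod_pos) (simp add: less_imp_neq[symmetric])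
qed

lemma smooth_weight_reflection:
  "\<alpha> \<in> R \<Longrightarrow> smooth_weight \<epsilon> (reflection \<alpha> x) = smooth_weight \<epsilon> x"
  using prod_Rp_reflection[of \<alpha> "\<lambda>c t. (t\<^sup>2 + \<epsilon>) powr c" x] by (simp add: smooth_weight_def)

lemma smooth_weight_le:
  assumes "0 < \<epsilon>" "\<epsilon> \<le> 1" "norm x \<le> 1"
  shows "smooth_weight \<epsilon> x \<le> (\<Prod>\<alpha>\<in>Rp. ((norm \<alpha>)\<^sup>2 + 1) powr k \<alpha>)"
  unfolding smooth_weight_def
proof (intro prod_mono conjI powr_mono2 add_mono)
  fix \<alpha>
  have "\<bar>\<alpha> \<bullet> x\<bar> \<le> norm \<alpha> * 1"
    using Cauchy_Schwarz_ineq2[of \<alpha> x] assms(3) mult_left_mono[of "norm x" 1 "norm \<alpha>"] by auto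
  then show "(\<alpha> \<bullet> x)\<^sup>2 \<le> (norm \<alpha>)\<^sup>2" by (metis abs_le_square_iff abs_norm_cancel mult.right_neutral)
qed (use assms Rp_k_nonneg in auto)

lemma smooth_weight_tendsto:
  assumes "e \<longlonglongrightarrow> 0" "\<And>n. 0 < e n"
  shows "(\<lambda>n. smooth_weight (e n) x) \<longlonglongrightarrow> w x"
  unfolding smooth_weight_def dunkl_weight_def
proof (rule tendsto_prod)
  fix \<alpha> assume \<alpha>: "\<alpha> \<in> Rp"
  have pos: "0 < (\<alpha> \<bullet> x)\<^sup>2 + e n" for n using assms(2)[of n] by (simp add: add_nonneg_pos)
  show "(\<lambda>n. ((\<alpha> \<bullet> x)\<^sup>2 + e n) powr k \<alpha>) \<longlonglongrightarrow> rpow \<bar>\<alpha> \<bullet> x\<bar> (2 * k \<alpha>)"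
  proof (cases "k \<alpha> = 0")
    case True
    have "(\<alpha> \<bullet> x)\<^sup>2 + e n \<noteq> 0" for n using pos[of n] by simp
    then show ?thesis using True by (simp add: rpow_def)
  next
    case False
    have "(\<lambda>n. ((\<alpha> \<bullet> x)\<^sup>2 + e n) powr k \<alpha>) \<longlonglongrightarrow> ((\<alpha> \<bullet> x)\<^sup>2 + 0) powr k \<alpha>"
      using False Rp_k_nonneg[OF \<alpha>] less_imp_le[OF pos]
      by (intro tendsto_powr' tendsto_intros assms(1)) (auto intro!: always_eventually)
    also have "((\<alpha> \<bullet> x)\<^sup>2 + 0) powr k \<alpha> = rpow \<bar>\<alpha> \<bullet> x\<bar> (2 * k \<alpha>)"
    proof (cases "\<alpha> \<bullet> x = 0")
      case t: False
      then have "(\<alpha> \<bullet> x)\<^sup>2 = \<bar>\<alpha> \<bullet> x\<bar> powr 2" by simp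
      then show ?thesis using False t by (simp add: rpow_def powr_powr del: powr_numeral)
    qed (use False in \<open>simp add: rpow_def\<close>)
    finally show ?thesis .
  qed
qed

definition log_derivative :: "real \<Rightarrow> 'a \<Rightarrow> 'a" where
  "log_derivative \<epsilon> x = (\<Sum>\<alpha>\<in>Rp. (2 * k \<alpha> * (\<alpha> \<bullet> x) / ((\<alpha> \<bullet> x)\<^sup>2 + \<epsilon>)) *\<^sub>R \<alpha>)"

lemma smooth_weight_derivative:
  assumes "0 < \<epsilon>"
  shows "(smooth_weight \<epsilon> has_derivative (\<lambda>h. smooth_weight \<epsilon> x *\<^sub>R log_derivative \<epsilon> x \<bullet> h)) (at x)"
proof -
  have pos: "0 < (\<alpha> \<bullet> x)\<^sup>2 + \<epsilon>" for \<alpha> x :: 'a using assms by (simp add: add_nonneg_pos)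
  have factor: "((\<lambda>x. ((\<alpha> \<bullet> x)\<^sup>2 + \<epsilon>) powr k \<alpha>) has_derivative
      (\<lambda>h. ((\<alpha> \<bullet> x)\<^sup>2 + \<epsilon>) powr k \<alpha> * ((2 * k \<alpha> * (\<alpha> \<bullet> x) / ((\<alpha> \<bullet> x)\<^sup>2 + \<epsilon>)) * (\<alpha> \<bullet> h)))) (at x)" for \<alpha>
    using pos[of \<alpha> x] by (auto intro!: derivative_eq_intros simp: fun_eq_iff field_simps)
  have "(smooth_weight \<epsilon> has_derivative (\<lambda>h. \<Sum>\<alpha>\<in>Rp.
      (((\<alpha> \<bullet> x)\<^sup>2 + \<epsilon>) powr k \<alpha> * ((2 * k \<alpha> * (\<alpha> \<bullet> x) / ((\<alpha> \<bullet> x)\<^sup>2 + \<epsilon>)) * (\<alpha> \<bullet> h))) *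
      (\<Prod>\<beta>\<in>Rp - {\<alpha>}. ((\<beta> \<bullet> x)\<^sup>2 + \<epsilon>) powr k \<beta>))) (at x)"
    unfolding smooth_weight_def[abs_def] by (intro has_derivative_prod factor)
  also have "(\<lambda>h. \<Sum>\<alpha>\<in>Rp.
      (((\<alpha> \<bullet> x)\<^sup>2 + \<epsilon>) powr k \<alpha> * ((2 * k \<alpha> * (\<alpha> \<bullet> x) / ((\<alpha> \<bullet> x)\<^sup>2 + \<epsilon>)) * (\<alpha> \<bullet> h))) *
      (\<Prod>\<beta>\<in>Rp - {\<alpha>}. ((\<beta> \<bullet> x)\<^sup>2 + \<epsilon>) powr k \<beta>)) = (\<lambda>h. smooth_weight \<epsilon> x *\<^sub>R log_derivative \<epsilon> x \<bullet> h)"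
  proof
    fix h
    have "smooth_weight \<epsilon> x *\<^sub>R log_derivative \<epsilon> x \<bullet> h =
      (\<Sum>\<alpha>\<in>Rp. smooth_weight \<epsilon> x * ((2 * k \<alpha> * (\<alpha> \<bullet> x) / ((\<alpha> \<bullet> x)\<^sup>2 + \<epsilon>)) * (\<alpha> \<bullet> h)))"
      by (simp add: log_derivative_def inner_sum_left sum_distrib_left)
    also have "\<dots> = (\<Sum>\<alpha>\<in>Rp.
      (((\<alpha> \<bullet> x)\<^sup>2 + \<epsilon>) powr k \<alpha> * ((2 * k \<alpha> * (\<alpha> \<bullet> x) / ((\<alpha> \<bullet> x)\<^sup>2 + \<epsilon>)) * (\<alpha> \<bullet> h))) *
      (\<Prod>\<beta>\<in>Rp - {\<alpha>}. ((\<beta> \<bullet> x)\<^sup>2 + \<epsilon>) powr k \<beta>))"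
      by (intro sum.cong refl) (simp add: smooth_weight_def prod.remove[OF finite_Rp])
    finally show "(\<Sum>\<alpha>\<in>Rp.
      (((\<alpha> \<bullet> x)\<^sup>2 + \<epsilon>) powr k \<alpha> * ((2 * k \<alpha> * (\<alpha> \<bullet> x) / ((\<alpha> \<bullet> x)\<^sup>2 + \<epsilon>)) * (\<alpha> \<bullet> h))) *
      (\<Prod>\<beta>\<in>Rp - {\<alpha>}. ((\<beta> \<bullet> x)\<^sup>2 + \<epsilon>) powr k \<beta>)) = smooth_weight \<epsilon> x *\<^sub>R log_derivative \<epsilon> x \<bullet> h" ..
  qed
  finally show ?thesis .
qed

lemma continuous_on_smooth_weight: "0 < \<epsilon> \<Longrightarrow> continuous_on S (smooth_weight \<epsilon>)"
  using smooth_weight_derivative by (meson continuous_at_imp_continuous_on has_derivative_continuous)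

lemma continuous_on_log_derivative:
  assumes "0 < \<epsilon>" shows "continuous_on S (log_derivative \<epsilon>)"
proof -
  have "(\<alpha> \<bullet> x)\<^sup>2 + \<epsilon> \<noteq> 0" for \<alpha> x :: 'a using assms by (smt (verit) zero_le_power2)
  then show ?thesis unfolding log_derivative_def by (intro continuous_intros) auto
qed

end

subsection \<open>Integration against an invariant test function\<close>

text \<open>The test function is Lipschitz and differentiable only almost everywhere, so that truncated Green
  functions are admitted; \<open>g\<close> is its gradient.\<close>

locale test_function = root_data R Rp k + C2_function "ball 0 1" f
  for R Rp :: "'a::euclidean_space set" and k and f :: "'a \<Rightarrow> real" +
  fixes \<psi> :: "'a \<Rightarrow> real" and g :: "'a \<Rightarrow> 'a" and \<rho> L B :: real
  assumes \<rho>: "0 < \<rho>" "\<rho> < 1"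
    and \<psi>_lipschitz: "\<And>x y. \<bar>\<psi> x - \<psi> y\<bar> \<le> L * norm (x - y)"
    and \<psi>_bound: "\<And>x. \<bar>\<psi> x\<bar> \<le> B"
    and \<psi>_support: "\<And>x. \<rho> \<le> norm x \<Longrightarrow> \<psi> x = 0"
    and \<psi>_reflection: "\<And>\<alpha> x. \<alpha> \<in> R \<Longrightarrow> \<psi> (reflection \<alpha> x) = \<psi> x"
    and \<psi>_derivative: "AE x in lborel. (\<psi> has_derivative (\<lambda>h. g x \<bullet> h)) (at x)"
    and g_measurable [measurable]: "g \<in> borel_measurable borel"
    and g_bound: "\<And>x. norm (g x) \<le> L"
    and g_support: "\<And>x. \<rho> \<le> norm x \<Longrightarrow> g x = 0"
begin

lemma B_nonneg: "0 \<le> B" and L_nonneg: "0 \<le> L"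
  using order_trans[OF abs_ge_zero \<psi>_bound] order_trans[OF norm_ge_zero g_bound] by blast+

lemma cball_subset: "cball 0 \<rho> \<subseteq> ball (0::'a) 1"
  using \<rho> by auto

lemma \<psi>_measurable [measurable]: "\<psi> \<in> borel_measurable borel"
proof -
  have "L-lipschitz_on UNIV \<psi>"
    using \<psi>_lipschitz L_nonneg by (intro lipschitz_onI) (auto simp: dist_norm)
  then show ?thesis
    by (intro borel_measurable_continuous_onI lipschitz_on_continuous_on)
qed

lemma measurable_\<psi>_times [measurable]:
  "continuous_on (ball 0 1) h \<Longrightarrow> (\<lambda>x. \<psi> x * h x) \<in> borel_measurable borel"
  using \<rho> by (intro borel_measurable_times_continuous_on[of _ "ball 0 1"]) (auto intro!: \<psi>_support)

lemma measurable_g_times: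
  "continuous_on (ball 0 1) h \<Longrightarrow> (\<lambda>x. (g x \<bullet> b) * h x) \<in> borel_measurable borel"
  using \<rho> by (intro borel_measurable_times_continuous_on[of _ "ball 0 1"]) (auto simp: g_support)

lemma measurable_g_inner:
  assumes "continuous_on (ball 0 1) v"
  shows "(\<lambda>x. g x \<bullet> v x) \<in> borel_measurable borel"
proof -
  have "(\<lambda>x. \<Sum>b\<in>Basis. (g x \<bullet> b) * (v x \<bullet> b)) \<in> borel_measurable borel"
    using assms by (intro borel_measurable_sum measurable_g_times continuous_intros)
  then show ?thesis by (simp only: euclidean_inner[symmetric])
qed

text \<open>Integration by parts in direction \<open>b\<close> for \<open>\<psi> * smooth_weight \<epsilon> * partial b\<close>.\<close>

lemma integral_partial:
  assumes \<epsilon>: "0 < \<epsilon>" and b: "b \<in> Basis"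
  defines "D \<equiv> \<lambda>x. (g x \<bullet> b) * (smooth_weight \<epsilon> x * partial b x) + \<psi> x * (smooth_weight \<epsilon> x *
      (frechet_derivative (partial b) (at x) b + partial b x * (log_derivative \<epsilon> x \<bullet> b)))"
  shows "integrable lborel D" "(LINT x|lborel. D x) = 0"
proof -
  let ?K = "cball (0::'a) \<rho>"
  have "continuous_on ?K (\<lambda>x. smooth_weight \<epsilon> x *\<^sub>R log_derivative \<epsilon> x)"
    by (intro continuous_intros continuous_on_smooth_weight continuous_on_log_derivative \<epsilon>)
  then have "\<exists>M1\<ge>0. \<forall>x\<in>?K. \<forall>y\<in>?K. \<bar>smooth_weight \<epsilon> x - smooth_weight \<epsilon> y\<bar> \<le> M1 * norm (x - y)"
    by (rule lipschitz_on_compact_convex[OF compact_cball[of 0 \<rho>] convex_cball[of 0 \<rho>]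
          smooth_weight_derivative[OF \<epsilon>]]) blast
  then obtain M1 where M1: "0 \<le> M1" "\<And>x y. x \<in> ?K \<Longrightarrow> y \<in> ?K \<Longrightarrow>
      \<bar>smooth_weight \<epsilon> x - smooth_weight \<epsilon> y\<bar> \<le> M1 * norm (x - y)" by blast
  have "bounded (smooth_weight \<epsilon> ` ?K)"
    by (intro compact_imp_bounded compact_continuous_image continuous_on_smooth_weight \<epsilon> compact_cball)
  then obtain C1 where C1: "\<And>x. x \<in> ?K \<Longrightarrow> norm (smooth_weight \<epsilon> x) \<le> C1"
    unfolding bounded_iff by blast
  obtain M2 where M2: "0 \<le> M2" "\<And>x y. x \<in> ?K \<Longrightarrow> y \<in> ?K \<Longrightarrow>
      norm (gradient f x - gradient f y) \<le> M2 * norm (x - y)"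
    using taylor_bounds[OF compact_cball convex_cball cball_subset] by metis
  obtain C2 where C2: "0 \<le> C2" "\<And>x. x \<in> ?K \<Longrightarrow> norm (gradient f x) \<le> C2"
    using compact_bounds[OF compact_cball cball_subset] by metis
  have C1_nonneg: "0 \<le> C1" using C1[of 0] \<rho> norm_ge_zero order_trans by fastforce
  have lip1: "\<bar>\<psi> x * smooth_weight \<epsilon> x - \<psi> y * smooth_weight \<epsilon> y\<bar> \<le> (L * C1 + B * M1) * norm (x - y)" for x y
    by (rule lipschitz_times_extend[where r = \<rho>])
      (use \<psi>_lipschitz \<psi>_bound \<psi>_support M1 C1 C1_nonneg B_nonneg in auto)
  have bound1: "\<bar>\<psi> x * smooth_weight \<epsilon> x\<bar> \<le> B * C1" for x
  proof (cases "x \<in> ?K")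
    case True
    then show ?thesis
      using C1[OF True] \<psi>_bound[of x] B_nonneg unfolding abs_mult real_norm_def by (intro mult_mono) auto
  next
    case False
    then show ?thesis using \<psi>_support[of x] B_nonneg C1_nonneg by simp
  qed
  have partial_lip: "\<bar>partial b x - partial b y\<bar> \<le> M2 * norm (x - y)" if "norm x \<le> \<rho>" "norm y \<le> \<rho>" for x y
  proof -
    have "\<bar>partial b x - partial b y\<bar> = \<bar>(gradient f x - gradient f y) \<bullet> b\<bar>"
      using b by (simp add: inner_diff_left gradient_inner_Basis)
    also have "\<dots> \<le> norm (gradient f x - gradient f y)" by (rule Basis_le_norm[OF b])
    finally show ?thesis using M2(2)[of x y] that by simp
  qed
  have partial_bound: "\<bar>partial b x\<bar> \<le> C2" if "norm x \<le> \<rho>" for x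
    using Basis_le_norm[OF b, of "gradient f x"] C2(2)[of x] that b by (simp add: gradient_inner_Basis)
  define V where "V = (\<lambda>x. (\<psi> x * smooth_weight \<epsilon> x) * partial b x)"
  have "\<bar>V x - V y\<bar> \<le> ((L * C1 + B * M1) * C2 + (B * C1) * M2) * norm (x - y)" for x y
    unfolding V_def
    by (rule lipschitz_times_extend[where r = \<rho>])
      (use lip1 bound1 \<psi>_support partial_lip partial_bound M2 C2 C1_nonneg B_nonneg in auto)
  note V_lip = this
  have V_supp: "V x = 0" if "\<rho> \<le> norm x" for x using \<psi>_support[OF that] by (simp add: V_def)
  have meas: "D \<in> borel_measurable borel"
    unfolding D_def using b \<epsilon>
    by (intro borel_measurable_add measurable_g_times measurable_\<psi>_times continuous_intros
        continuous_on_smooth_weight continuous_on_partial continuous_on_second continuous_on_log_derivative)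
  have der: "AE x in lborel. \<exists>V'. (V has_derivative V') (at x) \<and> V' b = D x"
    using \<psi>_derivative
  proof eventually_elim
    case (elim x)
    show ?case
    proof (cases "norm x < 1")
      case True
      then have x: "x \<in> ball 0 1" by simp
      have "(V has_derivative (\<lambda>h. (\<psi> x * smooth_weight \<epsilon> x) * frechet_derivative (partial b) (at x) h +
          (\<psi> x * (smooth_weight \<epsilon> x *\<^sub>R log_derivative \<epsilon> x \<bullet> h) + (g x \<bullet> h) * smooth_weight \<epsilon> x) * partial b x)) (at x)"
        unfolding V_def
        by (intro has_derivative_mult elim smooth_weight_derivative \<epsilon> partial_derivative x b)
      then show ?thesis by (intro exI conjI) (assumption, simp add: D_def algebra_simps)
    next
      case False
      have "(V has_derivative (\<lambda>h. 0)) (at x)"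
      proof (rule has_derivative_transform_within_open[OF _ open_Compl[OF closed_cball[of 0 \<rho>]]])
        show "((\<lambda>x. 0) has_derivative (\<lambda>h. 0)) (at x)" by simp
      qed (use V_supp False \<rho> in \<open>auto simp: less_imp_le\<close>)
      moreover have "D x = 0" using \<psi>_support[of x] g_support[of x] False \<rho> by (simp add: D_def)
      ultimately show ?thesis by (intro exI conjI) auto
    qed
  qed
  show "integrable lborel D" "(LINT x|lborel. D x) = 0"
    by (rule integral_directional_derivative_zero[OF V_lip V_supp meas der], assumption)+
qed

definition P :: "'a \<Rightarrow> 'a \<Rightarrow> real" where "P \<alpha> x = \<alpha> \<bullet> gradient f x"
definition P' :: "'a \<Rightarrow> 'a \<Rightarrow> real" where "P' \<alpha> x = \<alpha> \<bullet> gradient f (reflection \<alpha> x)"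

lemma P_reflection: "P \<alpha> (reflection \<alpha> x) = P' \<alpha> x" "P' \<alpha> (reflection \<alpha> x) = P \<alpha> x"
  by (simp_all add: P_def P'_def)

lemma continuous_on_P: "continuous_on (ball 0 1) (P \<alpha>)" "continuous_on (ball 0 1) (P' \<alpha>)"
proof -
  show "continuous_on (ball 0 1) (P \<alpha>)"
    unfolding P_def[abs_def] by (intro continuous_intros continuous_on_gradient)
  show "continuous_on (ball 0 1) (P' \<alpha>)"
    unfolding P'_def[abs_def]
    by (intro continuous_intros continuous_on_compose2[OF continuous_on_gradient]) auto
qed

lemma continuous_on_f_reflection: "continuous_on (ball 0 1) (\<lambda>x. f (reflection \<alpha> x))"
  by (intro continuous_intros continuous_on_compose2[OF continuous_on_f]) auto

lemma measurable_\<psi>_divide: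
  assumes "continuous_on (ball 0 1) h"
  shows "(\<lambda>x. \<psi> x * (h x / (\<alpha> \<bullet> x))) \<in> borel_measurable borel"
    and "(\<lambda>x. \<psi> x * (h x / (\<alpha> \<bullet> x)\<^sup>2)) \<in> borel_measurable borel"
proof -
  have [measurable]: "(\<lambda>x. \<psi> x * h x) \<in> borel_measurable borel" using assms by (rule measurable_\<psi>_times)
  have "(\<lambda>x. (\<psi> x * h x) / (\<alpha> \<bullet> x)) \<in> borel_measurable borel"
    "(\<lambda>x. (\<psi> x * h x) / (\<alpha> \<bullet> x)\<^sup>2) \<in> borel_measurable borel" by measurable
  then show "(\<lambda>x. \<psi> x * (h x / (\<alpha> \<bullet> x))) \<in> borel_measurable borel"
    "(\<lambda>x. \<psi> x * (h x / (\<alpha> \<bullet> x)\<^sup>2)) \<in> borel_measurable borel" by simp_all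
qed

text \<open>Taylor expansion along the segment from \<open>x\<close> to its reflection, whose length is proportional to \<open>\<alpha> \<bullet> x\<close>. These
  estimates keep all quotients by \<open>\<alpha> \<bullet> x\<close> below bounded.\<close>

lemma root_bounds:
  obtains C where "0 \<le> C" "\<And>x. norm x \<le> \<rho> \<Longrightarrow> norm (gradient f x) \<le> C"
    "\<And>x. norm x \<le> \<rho> \<Longrightarrow> \<bar>laplace f x\<bar> \<le> C"
    "\<And>\<alpha> x. \<alpha> \<in> Rp \<Longrightarrow> norm x \<le> \<rho> \<Longrightarrow> \<bar>P \<alpha> x - P' \<alpha> x\<bar> \<le> C * \<bar>\<alpha> \<bullet> x\<bar>"
    "\<And>\<alpha> x. \<alpha> \<in> Rp \<Longrightarrow> norm x \<le> \<rho> \<Longrightarrow>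
      \<bar>(\<alpha> \<bullet> \<alpha>) * (f (reflection \<alpha> x) - f x) + 2 * (\<alpha> \<bullet> x) * P \<alpha> x\<bar> \<le> C * (\<alpha> \<bullet> x)\<^sup>2"
proof -
  obtain M where M: "0 \<le> M" "\<And>x. x \<in> cball 0 \<rho> \<Longrightarrow> norm (gradient f x) \<le> M"
    "\<And>x. x \<in> cball 0 \<rho> \<Longrightarrow> \<bar>laplace f x\<bar> \<le> M"
    using compact_bounds[OF compact_cball cball_subset] by metis
  obtain T where T: "0 \<le> T" "\<And>x y. x \<in> cball 0 \<rho> \<Longrightarrow> y \<in> cball 0 \<rho> \<Longrightarrow>
      norm (gradient f x - gradient f y) \<le> T * norm (x - y)"
    "\<And>x y. x \<in> cball 0 \<rho> \<Longrightarrow> y \<in> cball 0 \<rho> \<Longrightarrow>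
      \<bar>f y - f x - gradient f x \<bullet> (y - x)\<bar> \<le> T * (norm (y - x))\<^sup>2"
    using taylor_bounds[OF compact_cball convex_cball cball_subset] by metis
  define C where "C = M + 4 * T"
  have \<sigma>: "reflection \<alpha> x - x = - ((2 * (\<alpha> \<bullet> x) / (\<alpha> \<bullet> \<alpha>)) *\<^sub>R \<alpha>)" for \<alpha> x :: 'a
    by (simp add: reflection_def)
  have norm_\<sigma>: "norm \<alpha> * norm (reflection \<alpha> x - x) = 2 * \<bar>\<alpha> \<bullet> x\<bar>" if "\<alpha> \<in> Rp" for \<alpha> x :: 'a
    using Rp_nonzero[OF that] by (simp add: \<sigma> dot_square_norm power2_eq_square)
  show ?thesis
  proof (rule that[of C])
    fix \<alpha> x :: 'a assume \<alpha>: "\<alpha> \<in> Rp" and x: "norm x \<le> \<rho>"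
    have "\<bar>P \<alpha> x - P' \<alpha> x\<bar> \<le> norm \<alpha> * norm (gradient f x - gradient f (reflection \<alpha> x))"
      unfolding P_def P'_def by (metis Cauchy_Schwarz_ineq2 inner_diff_right)
    also have "\<dots> \<le> norm \<alpha> * (T * norm (x - reflection \<alpha> x))"
      using T(2)[of x "reflection \<alpha> x"] x by (intro mult_left_mono) auto
    also have "\<dots> = T * (2 * \<bar>\<alpha> \<bullet> x\<bar>)"
      using norm_\<sigma>[OF \<alpha>, of x] by (simp add: norm_minus_commute algebra_simps)
    also have "\<dots> \<le> C * \<bar>\<alpha> \<bullet> x\<bar>" using M T by (simp add: C_def algebra_simps)
    finally show "\<bar>P \<alpha> x - P' \<alpha> x\<bar> \<le> C * \<bar>\<alpha> \<bullet> x\<bar>" .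
    have "(\<alpha> \<bullet> \<alpha>) * (gradient f x \<bullet> (reflection \<alpha> x - x)) = - (2 * (\<alpha> \<bullet> x) * P \<alpha> x)"
      using Rp_nonzero[OF \<alpha>] by (simp add: \<sigma> P_def inner_commute)
    then have "\<bar>(\<alpha> \<bullet> \<alpha>) * (f (reflection \<alpha> x) - f x) + 2 * (\<alpha> \<bullet> x) * P \<alpha> x\<bar> =
        \<bar>(\<alpha> \<bullet> \<alpha>) * (f (reflection \<alpha> x) - f x - gradient f x \<bullet> (reflection \<alpha> x - x))\<bar>"
      by (simp only: right_diff_distrib[of "\<alpha> \<bullet> \<alpha>"])
    also have "\<dots> = (norm \<alpha>)\<^sup>2 * \<bar>f (reflection \<alpha> x) - f x - gradient f x \<bullet> (reflection \<alpha> x - x)\<bar>"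
      by (simp add: abs_mult dot_square_norm)
    also have "\<dots> \<le> (norm \<alpha>)\<^sup>2 * (T * (norm (reflection \<alpha> x - x))\<^sup>2)"
      using T(3)[of x "reflection \<alpha> x"] x by (intro mult_left_mono) auto
    also have "\<dots> = T * (norm \<alpha> * norm (reflection \<alpha> x - x))\<^sup>2" by (simp add: power_mult_distrib)
    also have "\<dots> = 4 * T * (\<alpha> \<bullet> x)\<^sup>2" using norm_\<sigma>[OF \<alpha>, of x] by (simp add: power_mult_distrib)
    also have "\<dots> \<le> C * (\<alpha> \<bullet> x)\<^sup>2" using M by (intro mult_right_mono) (auto simp: C_def)
    finally show "\<bar>(\<alpha> \<bullet> \<alpha>) * (f (reflection \<alpha> x) - f x) + 2 * (\<alpha> \<bullet> x) * P \<alpha> x\<bar> \<le> C * (\<alpha> \<bullet> x)\<^sup>2" .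
  qed (use M(1) T(1) in \<open>auto simp: C_def intro!: order_trans[OF M(2)] order_trans[OF M(3)]\<close>)
qed

text \<open>Summing the integrations by parts over an orthonormal basis, the terms from the weight contain
  \<open>P \<alpha> x\<close> divided by \<open>\<alpha> \<bullet> x\<close> in the limit, which is singular. Replacing \<open>P \<alpha>\<close> by \<open>(P \<alpha> - P' \<alpha>) / 2\<close> changes
  them by terms antisymmetric under the reflection, and makes the quotients bounded.\<close>

definition symmetrized :: "real \<Rightarrow> 'a \<Rightarrow> real" where
  "symmetrized \<epsilon> x = smooth_weight \<epsilon> x * (g x \<bullet> gradient f x) + \<psi> x * (smooth_weight \<epsilon> x *
     (laplace f x + (\<Sum>\<alpha>\<in>Rp. k \<alpha> * ((\<alpha> \<bullet> x) / ((\<alpha> \<bullet> x)\<^sup>2 + \<epsilon>) * (P \<alpha> x - P' \<alpha> x)))))"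

lemma quotient_regularized:
  assumes \<epsilon>: "0 < (\<epsilon>::real)" shows "t\<^sup>2 + \<epsilon> \<noteq> 0" "\<bar>t / (t\<^sup>2 + \<epsilon>)\<bar> * \<bar>t\<bar> \<le> 1"
proof -
  have pos: "0 < t\<^sup>2 + \<epsilon>" using \<epsilon> by (simp add: add_nonneg_pos)
  then show "t\<^sup>2 + \<epsilon> \<noteq> 0" by simp
  show "\<bar>t / (t\<^sup>2 + \<epsilon>)\<bar> * \<bar>t\<bar> \<le> 1" using \<epsilon> pos
    by (simp add: abs_divide abs_mult[symmetric] power2_eq_square[symmetric] divide_le_eq)
qed

lemma integral_symmetrized:
  assumes \<epsilon>: "0 < \<epsilon>"
  shows "integrable lborel (symmetrized \<epsilon>)" "(LINT x|lborel. symmetrized \<epsilon> x) = 0"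
proof -
  define D where "D = (\<lambda>b x. (g x \<bullet> b) * (smooth_weight \<epsilon> x * partial b x) + \<psi> x * (smooth_weight \<epsilon> x *
      (frechet_derivative (partial b) (at x) b + partial b x * (log_derivative \<epsilon> x \<bullet> b))))"
  have D: "integrable lborel (D b)" "(LINT x|lborel. D b x) = 0" if "b \<in> Basis" for b
    using integral_partial[OF \<epsilon> that] by (simp_all add: D_def)
  define q where "q \<alpha> x = (\<alpha> \<bullet> x) / ((\<alpha> \<bullet> x)\<^sup>2 + \<epsilon>)" for \<alpha> x :: 'a
  define a where "a \<alpha> x = smooth_weight \<epsilon> x * (k \<alpha> * (q \<alpha> x * (P \<alpha> x + P' \<alpha> x)))" for \<alpha> x
  define A where "A \<alpha> x = \<psi> x * a \<alpha> x" for \<alpha> x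
  have q_cont: "continuous_on S (q \<alpha>)" for S \<alpha>
    unfolding q_def[abs_def] using quotient_regularized(1)[OF \<epsilon>] by (intro continuous_intros) auto
  have A_meas: "A \<alpha> \<in> borel_measurable borel" for \<alpha>
    unfolding A_def[abs_def] a_def
    by (intro measurable_\<psi>_times continuous_intros continuous_on_smooth_weight \<epsilon> q_cont continuous_on_P)
  have A_zero: "(LINT x|lborel. A \<alpha> x) = 0" if "\<alpha> \<in> Rp" for \<alpha>
  proof (rule integral_antisymmetric[OF A_meas])
    fix x
    show "A \<alpha> (reflection \<alpha> x) = - A \<alpha> x"
      using Rp_R[OF that] by (simp add: A_def a_def q_def \<psi>_reflection smooth_weight_reflection P_reflection add.commute)
  qed
  have A_int: "integrable lborel (A \<alpha>)" for \<alpha>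
  proof -
    have "continuous_on (ball 0 1) (a \<alpha>)"
      unfolding a_def[abs_def] by (intro continuous_intros continuous_on_smooth_weight \<epsilon> q_cont continuous_on_P)
    then have "bounded ((a \<alpha>) ` cball 0 \<rho>)"
      by (intro compact_imp_bounded compact_continuous_image compact_cball) (rule continuous_on_subset[OF _ cball_subset])
    then obtain C where "\<forall>y\<in>(a \<alpha>) ` cball 0 \<rho>. norm y \<le> C"
      unfolding bounded_iff by blast
    then have C: "\<bar>a \<alpha> x\<bar> \<le> C" if "norm x \<le> \<rho>" for x
      using that by auto
    show ?thesis
    proof (rule integrable_bounded_support[OF A_meas, where B = "B * C" and r = \<rho>])
      fix x show "\<bar>A \<alpha> x\<bar> \<le> B * C"
      proof (cases "norm x \<le> \<rho>")
        case True
        then show ?thesis unfolding A_def abs_mult[of "\<psi> x"]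
          using \<psi>_bound[of x] C[OF True] B_nonneg by (intro mult_mono) auto
      next
        case False
        have "0 \<le> C" using C[of 0] \<rho> by (auto intro: order_trans[OF abs_ge_zero])
        then show ?thesis using False \<psi>_support[of x] B_nonneg by (simp add: A_def)
      qed
    qed (simp add: A_def \<psi>_support)
  qed
  have eq: "symmetrized \<epsilon> x = (\<Sum>b\<in>Basis. D b x) - (\<Sum>\<alpha>\<in>Rp. A \<alpha> x)" for x
  proof -
    have L: "log_derivative \<epsilon> x \<bullet> gradient f x = (\<Sum>\<alpha>\<in>Rp. 2 * k \<alpha> * (q \<alpha> x * P \<alpha> x))"
      by (simp add: log_derivative_def inner_sum_left q_def P_def mult.assoc)
    have D_sum: "(\<Sum>b\<in>Basis. D b x) = smooth_weight \<epsilon> x * (g x \<bullet> gradient f x) +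
        \<psi> x * (smooth_weight \<epsilon> x * (laplace f x + log_derivative \<epsilon> x \<bullet> gradient f x))"
    proof -
      have inner: "v \<bullet> gradient f x = (\<Sum>b\<in>Basis. (v \<bullet> b) * partial b x)" for v
        by (subst euclidean_inner) (simp add: gradient_inner_Basis)
      show ?thesis
        unfolding inner by (simp add: D_def laplace_def sum.distrib sum_distrib_left algebra_simps)
    qed
    have A_sum: "(\<Sum>\<alpha>\<in>Rp. A \<alpha> x) = \<psi> x * (smooth_weight \<epsilon> x * (\<Sum>\<alpha>\<in>Rp. k \<alpha> * (q \<alpha> x * (P \<alpha> x + P' \<alpha> x))))"
      by (simp only: A_def a_def sum_distrib_left)
    have regroup: "a + p * (s * (l + y)) - p * (s * z) = a + p * (s * (l + (y - z)))" for a p s l y z :: real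
      by (simp add: algebra_simps)
    have "(\<Sum>b\<in>Basis. D b x) - (\<Sum>\<alpha>\<in>Rp. A \<alpha> x) = smooth_weight \<epsilon> x * (g x \<bullet> gradient f x) +
        \<psi> x * (smooth_weight \<epsilon> x * (laplace f x + ((\<Sum>\<alpha>\<in>Rp. 2 * k \<alpha> * (q \<alpha> x * P \<alpha> x)) -
          (\<Sum>\<alpha>\<in>Rp. k \<alpha> * (q \<alpha> x * (P \<alpha> x + P' \<alpha> x))))))"
      unfolding D_sum L A_sum by (rule regroup)
    also have "(\<Sum>\<alpha>\<in>Rp. 2 * k \<alpha> * (q \<alpha> x * P \<alpha> x)) - (\<Sum>\<alpha>\<in>Rp. k \<alpha> * (q \<alpha> x * (P \<alpha> x + P' \<alpha> x))) =
        (\<Sum>\<alpha>\<in>Rp. k \<alpha> * (q \<alpha> x * (P \<alpha> x - P' \<alpha> x)))"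
      unfolding sum_subtractf[symmetric] by (intro sum.cong refl) (simp add: algebra_simps)
    finally show ?thesis by (simp add: symmetrized_def q_def)
  qed
  show "integrable lborel (symmetrized \<epsilon>)"
    unfolding eq[abs_def] using D(1) A_int by (intro Bochner_Integration.integrable_diff Bochner_Integration.integrable_sum)
  show "(LINT x|lborel. symmetrized \<epsilon> x) = 0"
    unfolding eq using D A_int A_zero by (simp add: Bochner_Integration.integral_diff Bochner_Integration.integral_sum)
qed

text \<open>The pointwise limit of \<open>symmetrized \<epsilon>\<close> contains \<open>(P \<alpha> x - P' \<alpha> x) / (\<alpha> \<bullet> x)\<close> where the Dunkl
  Laplacian has \<open>2 * P \<alpha> x / (\<alpha> \<bullet> x)\<close> and a difference quotient; their difference is again antisymmetric and bounded.\<close>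

lemma integral_dunkl_expr:
  shows "integrable lborel (\<lambda>x. \<psi> x * (w x * dunkl_expr f x))"
    and "(LINT x|lborel. \<psi> x * (w x * dunkl_expr f x)) = - (LINT x|lborel. w x * (g x \<bullet> gradient f x))"
proof -
  obtain C where C: "0 \<le> C" "\<And>x. norm x \<le> \<rho> \<Longrightarrow> norm (gradient f x) \<le> C"
    "\<And>x. norm x \<le> \<rho> \<Longrightarrow> \<bar>laplace f x\<bar> \<le> C"
    "\<And>\<alpha> x. \<alpha> \<in> Rp \<Longrightarrow> norm x \<le> \<rho> \<Longrightarrow> \<bar>P \<alpha> x - P' \<alpha> x\<bar> \<le> C * \<bar>\<alpha> \<bullet> x\<bar>"
    "\<And>\<alpha> x. \<alpha> \<in> Rp \<Longrightarrow> norm x \<le> \<rho> \<Longrightarrow>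
      \<bar>(\<alpha> \<bullet> \<alpha>) * (f (reflection \<alpha> x) - f x) + 2 * (\<alpha> \<bullet> x) * P \<alpha> x\<bar> \<le> C * (\<alpha> \<bullet> x)\<^sup>2"
    by (rule root_bounds) (rule that; assumption)
  \<comment> \<open>A bound of the weight and of all its approximations with \<open>\<epsilon> \<le> 1\<close> on the unit ball.\<close>
  define W where "W = (\<Prod>\<alpha>\<in>Rp. ((norm \<alpha>)\<^sup>2 + 1) powr k \<alpha>)"
  have W: "0 \<le> W" by (simp add: W_def prod_nonneg)
  have w_le: "w x \<le> W" if "norm x \<le> 1" for x
  proof (rule LIMSEQ_le_const2)
    show "(\<lambda>n. smooth_weight (1 / real (Suc n)) x) \<longlonglongrightarrow> w x"
      using LIMSEQ_inverse_real_of_nat by (intro smooth_weight_tendsto) (auto simp: inverse_eq_divide)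
    show "\<exists>N. \<forall>n\<ge>N. smooth_weight (1 / real (Suc n)) x \<le> W"
      unfolding W_def using that by (intro exI[of _ 0] allI impI smooth_weight_le) auto
  qed
  define limit where "limit x = w x * (g x \<bullet> gradient f x) + \<psi> x * (w x *
     (laplace f x + (\<Sum>\<alpha>\<in>Rp. k \<alpha> * ((P \<alpha> x - P' \<alpha> x) / (\<alpha> \<bullet> x)))))" for x
  define bnd where "bnd x = (W * (L * C) + B * (W * (C + (\<Sum>\<alpha>\<in>Rp. k \<alpha> * C)))) * indicator (cball 0 \<rho>) x" for x :: 'a
  have bnd: "integrable lborel bnd"
    unfolding bnd_def by (intro integrable_mult_right integrable_real_indicator) (auto simp: emeasure_cball \<rho> less_imp_le)
  have grad_bound: "\<bar>g x \<bullet> gradient f x\<bar> \<le> L * C" if "norm x \<le> \<rho>" for x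
    using Cauchy_Schwarz_ineq2[of "g x" "gradient f x"] mult_mono[OF g_bound C(2)[OF that] L_nonneg norm_ge_zero]
    by (meson order_trans)
  have bound: "\<bar>s * (g x \<bullet> gradient f x) + \<psi> x * (s * (laplace f x + (\<Sum>\<alpha>\<in>Rp. k \<alpha> * c \<alpha>)))\<bar> \<le> bnd x"
    if s: "norm x \<le> 1 \<Longrightarrow> 0 \<le> s \<and> s \<le> W" and c: "\<And>\<alpha>. \<alpha> \<in> Rp \<Longrightarrow> norm x \<le> \<rho> \<Longrightarrow> \<bar>c \<alpha>\<bar> \<le> C" for x s c
  proof (cases "norm x \<le> \<rho>")
    case True
    have sW: "0 \<le> s" "s \<le> W" using s True \<rho> by auto
    have "\<bar>\<Sum>\<alpha>\<in>Rp. k \<alpha> * c \<alpha>\<bar> \<le> (\<Sum>\<alpha>\<in>Rp. k \<alpha> * C)"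
      using c[OF _ True] Rp_k_nonneg
      by (intro order_trans[OF sum_abs] sum_mono) (auto simp: abs_mult intro!: mult_left_mono)
    then have "\<bar>laplace f x + (\<Sum>\<alpha>\<in>Rp. k \<alpha> * c \<alpha>)\<bar> \<le> C + (\<Sum>\<alpha>\<in>Rp. k \<alpha> * C)"
      using C(3)[OF True] by linarith
    then have "\<bar>\<psi> x * (s * (laplace f x + (\<Sum>\<alpha>\<in>Rp. k \<alpha> * c \<alpha>)))\<bar> \<le> B * (W * (C + (\<Sum>\<alpha>\<in>Rp. k \<alpha> * C)))"
      using \<psi>_bound[of x] sW B_nonneg W unfolding abs_mult by (intro mult_mono) auto
    moreover have "\<bar>s * (g x \<bullet> gradient f x)\<bar> \<le> W * (L * C)"
      using grad_bound[OF True] sW W unfolding abs_mult by (intro mult_mono) auto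
    ultimately show ?thesis using True by (simp add: bnd_def)
  next
    case False
    then show ?thesis using \<psi>_support[of x] g_support[of x] by (simp add: bnd_def)
  qed
  have quotient_bound: "\<bar>(P \<alpha> x - P' \<alpha> x) / (\<alpha> \<bullet> x)\<bar> \<le> C" if "\<alpha> \<in> Rp" "norm x \<le> \<rho>" for \<alpha> x
    using C(4)[OF that] C(1) by (cases "\<alpha> \<bullet> x = 0") (simp_all add: abs_divide divide_le_eq)
  have limit_meas: "limit \<in> borel_measurable borel"
  proof -
    have [measurable]: "(\<lambda>x. g x \<bullet> gradient f x) \<in> borel_measurable borel"
      by (intro measurable_g_inner continuous_on_gradient)
    have [measurable]: "(\<lambda>x. \<psi> x * laplace f x) \<in> borel_measurable borel"
      by (intro measurable_\<psi>_times continuous_on_laplace)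
    have [measurable]: "(\<lambda>x. \<psi> x * ((P \<alpha> x - P' \<alpha> x) / (\<alpha> \<bullet> x))) \<in> borel_measurable borel" for \<alpha>
      by (intro measurable_\<psi>_divide continuous_intros continuous_on_P)
    have "limit = (\<lambda>x. w x * (g x \<bullet> gradient f x) + w x * (\<psi> x * laplace f x +
        (\<Sum>\<alpha>\<in>Rp. k \<alpha> * (\<psi> x * ((P \<alpha> x - P' \<alpha> x) / (\<alpha> \<bullet> x))))))"
      by (auto simp: limit_def fun_eq_iff distrib_left sum_distrib_left ac_simps)
    also have "\<dots> \<in> borel_measurable borel" by measurable
    finally show ?thesis .
  qed
  define e where "e n = 1 / real (Suc n)" for n
  have e: "0 < e n" "e n \<le> 1" for n by (auto simp: e_def)
  have e0: "e \<longlonglongrightarrow> 0" using LIMSEQ_inverse_real_of_nat unfolding e_def[abs_def] inverse_eq_divide .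
  have conv: "(\<lambda>n. symmetrized (e n) x) \<longlonglongrightarrow> limit x" for x
  proof -
    have "(\<lambda>n. (\<alpha> \<bullet> x) / ((\<alpha> \<bullet> x)\<^sup>2 + e n) * (P \<alpha> x - P' \<alpha> x)) \<longlonglongrightarrow> (P \<alpha> x - P' \<alpha> x) / (\<alpha> \<bullet> x)" for \<alpha>
    proof (cases "\<alpha> \<bullet> x = 0")
      case False
      have "(\<lambda>n. (\<alpha> \<bullet> x) / ((\<alpha> \<bullet> x)\<^sup>2 + e n) * (P \<alpha> x - P' \<alpha> x)) \<longlonglongrightarrow>
          (\<alpha> \<bullet> x) / ((\<alpha> \<bullet> x)\<^sup>2 + 0) * (P \<alpha> x - P' \<alpha> x)"
        using False by (intro tendsto_intros e0) auto
      then show ?thesis using False by (simp add: power2_eq_square)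
    qed simp
    then show ?thesis unfolding symmetrized_def limit_def
      by (intro tendsto_intros smooth_weight_tendsto e0 e)
  qed
  have dom: "\<bar>symmetrized (e n) x\<bar> \<le> bnd x" for n x
    unfolding symmetrized_def
  proof (rule bound)
    show "0 \<le> smooth_weight (e n) x \<and> smooth_weight (e n) x \<le> W" if "norm x \<le> 1"
      using smooth_weight_pos[of "e n" x] smooth_weight_le[OF e that] e by (simp add: W_def less_imp_le)
    fix \<alpha> assume \<alpha>: "\<alpha> \<in> Rp" "norm x \<le> \<rho>"
    have "\<bar>(\<alpha> \<bullet> x) / ((\<alpha> \<bullet> x)\<^sup>2 + e n)\<bar> * \<bar>P \<alpha> x - P' \<alpha> x\<bar> \<le> \<bar>(\<alpha> \<bullet> x) / ((\<alpha> \<bullet> x)\<^sup>2 + e n)\<bar> * (C * \<bar>\<alpha> \<bullet> x\<bar>)"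
      using C(4)[OF \<alpha>] by (intro mult_left_mono) auto
    also have "\<dots> = C * (\<bar>(\<alpha> \<bullet> x) / ((\<alpha> \<bullet> x)\<^sup>2 + e n)\<bar> * \<bar>\<alpha> \<bullet> x\<bar>)" by simp
    also have "\<dots> \<le> C * 1" using quotient_regularized(2)[OF e(1)] C(1) by (intro mult_left_mono)
    finally show "\<bar>(\<alpha> \<bullet> x) / ((\<alpha> \<bullet> x)\<^sup>2 + e n) * (P \<alpha> x - P' \<alpha> x)\<bar> \<le> C" by (simp add: abs_mult)
  qed
  have "(\<lambda>n. LINT x|lborel. symmetrized (e n) x) \<longlonglongrightarrow> (LINT x|lborel. limit x)"
    by (rule integral_dominated_convergence[OF _ _ bnd])
      (use limit_meas integral_symmetrized(1)[OF e(1)] conv dom in auto)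
  then have limit_zero: "(LINT x|lborel. limit x) = 0"
    using integral_symmetrized(2)[OF e(1)] by (simp add: LIMSEQ_const_iff)
  have limit_int: "integrable lborel limit"
  proof (rule Bochner_Integration.integrable_bound[OF bnd])
    have "\<bar>limit x\<bar> \<le> bnd x" for x
      unfolding limit_def using w_le[of x] quotient_bound[of _ x] by (intro bound) auto
    then show "AE x in lborel. norm (limit x) \<le> norm (bnd x)"
      by (auto intro: order_trans[OF _ abs_ge_self])
  qed (use limit_meas in simp)

  \<comment> \<open>By Taylor's formula the two singular parts below cancel up to a bounded term.\<close>
  define E where "E \<alpha> x = \<psi> x * (w x * (k \<alpha> * (- (P \<alpha> x + P' \<alpha> x) / (\<alpha> \<bullet> x)
      - (\<alpha> \<bullet> \<alpha>) * (f (reflection \<alpha> x) - f x) / (\<alpha> \<bullet> x)\<^sup>2)))" for \<alpha> x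
  have E_meas: "E \<alpha> \<in> borel_measurable borel" for \<alpha>
  proof -
    have [measurable]: "(\<lambda>x. \<psi> x * ((- (P \<alpha> x + P' \<alpha> x)) / (\<alpha> \<bullet> x))) \<in> borel_measurable borel"
      by (intro measurable_\<psi>_divide continuous_intros continuous_on_P)
    have [measurable]: "(\<lambda>x. \<psi> x * (((\<alpha> \<bullet> \<alpha>) * (f (reflection \<alpha> x) - f x)) / (\<alpha> \<bullet> x)\<^sup>2)) \<in> borel_measurable borel"
      by (intro measurable_\<psi>_divide continuous_intros continuous_on_f_reflection continuous_on_f)
    have regroup: "p * (s * (c * (a - b))) = s * c * (p * a - p * b)" for p s c a b :: real
      by (simp add: algebra_simps)
    have "E \<alpha> = (\<lambda>x. w x * k \<alpha> * (\<psi> x * ((- (P \<alpha> x + P' \<alpha> x)) / (\<alpha> \<bullet> x)) -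
        \<psi> x * (((\<alpha> \<bullet> \<alpha>) * (f (reflection \<alpha> x) - f x)) / (\<alpha> \<bullet> x)\<^sup>2)))"
      unfolding E_def by (rule ext, rule regroup)
    also have "\<dots> \<in> borel_measurable borel" by measurable
    finally show ?thesis .
  qed
  have E_zero: "(LINT x|lborel. E \<alpha> x) = 0" if "\<alpha> \<in> Rp" for \<alpha>
  proof (rule integral_antisymmetric[OF E_meas])
    fix x
    have "(\<alpha> \<bullet> \<alpha>) * (f x - f (reflection \<alpha> x)) = - ((\<alpha> \<bullet> \<alpha>) * (f (reflection \<alpha> x) - f x))"
      by (simp add: algebra_simps)
    then show "E \<alpha> (reflection \<alpha> x) = - E \<alpha> x"
      using Rp_R[OF that] unfolding E_def P_reflection \<psi>_reflection[OF Rp_R[OF that]]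
        weight_reflection[OF Rp_R[OF that]] inner_reflection_self reflection_reflection
      by (simp add: algebra_simps diff_divide_distrib)
  qed
  have E_int: "integrable lborel (E \<alpha>)" if \<alpha>: "\<alpha> \<in> Rp" for \<alpha>
  proof (rule integrable_bounded_support[OF E_meas, where B = "B * (W * (k \<alpha> * (2 * C)))" and r = \<rho>])
    fix x
    show "\<bar>E \<alpha> x\<bar> \<le> B * (W * (k \<alpha> * (2 * C)))"
    proof (cases "norm x \<le> \<rho>")
      case True
      have "\<bar>- (P \<alpha> x + P' \<alpha> x) / (\<alpha> \<bullet> x) - (\<alpha> \<bullet> \<alpha>) * (f (reflection \<alpha> x) - f x) / (\<alpha> \<bullet> x)\<^sup>2\<bar> \<le> 2 * C"
      proof (cases "\<alpha> \<bullet> x = 0")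
        case False
        have "- (P \<alpha> x + P' \<alpha> x) / (\<alpha> \<bullet> x) - (\<alpha> \<bullet> \<alpha>) * (f (reflection \<alpha> x) - f x) / (\<alpha> \<bullet> x)\<^sup>2 =
          (P \<alpha> x - P' \<alpha> x) / (\<alpha> \<bullet> x) -
          ((\<alpha> \<bullet> \<alpha>) * (f (reflection \<alpha> x) - f x) + 2 * (\<alpha> \<bullet> x) * P \<alpha> x) / (\<alpha> \<bullet> x)\<^sup>2"
          using False by (simp add: power2_eq_square field_simps)
        moreover have "\<bar>((\<alpha> \<bullet> \<alpha>) * (f (reflection \<alpha> x) - f x) + 2 * (\<alpha> \<bullet> x) * P \<alpha> x) / (\<alpha> \<bullet> x)\<^sup>2\<bar> \<le> C"
          using C(5)[OF \<alpha> True] False by (simp add: abs_divide divide_le_eq)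
        ultimately show ?thesis using quotient_bound[OF \<alpha> True] by linarith
      qed (use C(1) in simp)
      then show ?thesis unfolding E_def abs_mult
        using \<psi>_bound[of x] w_le[of x] True \<rho> B_nonneg W Rp_k_nonneg[OF \<alpha>] by (intro mult_mono) auto
    next
      case False
      then show ?thesis using \<psi>_support[of x] B_nonneg W Rp_k_nonneg[OF \<alpha>] C(1) by (simp add: E_def)
    qed
  qed (simp add: E_def \<psi>_support)
  have G_int: "integrable lborel (\<lambda>x. w x * (g x \<bullet> gradient f x))"
  proof (rule integrable_bounded_support[where B = "W * (L * C)" and r = \<rho>])
    have [measurable]: "(\<lambda>x. g x \<bullet> gradient f x) \<in> borel_measurable borel"
      by (intro measurable_g_inner continuous_on_gradient)
    show "(\<lambda>x. w x * (g x \<bullet> gradient f x)) \<in> borel_measurable borel" by measurable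
    fix x
    show "\<bar>w x * (g x \<bullet> gradient f x)\<bar> \<le> W * (L * C)"
    proof (cases "norm x \<le> \<rho>")
      case True
      then show ?thesis unfolding abs_mult using w_le[of x] \<rho> grad_bound[OF True] W by (intro mult_mono) auto
    qed (use g_support W L_nonneg C in simp)
  qed (simp add: g_support)
  have eq: "\<psi> x * (w x * dunkl_expr f x) = limit x - w x * (g x \<bullet> gradient f x) - (\<Sum>\<alpha>\<in>Rp. E \<alpha> x)" for x
  proof -
    define s where "s \<alpha> = - (P \<alpha> x + P' \<alpha> x) / (\<alpha> \<bullet> x) - (\<alpha> \<bullet> \<alpha>) * (f (reflection \<alpha> x) - f x) / (\<alpha> \<bullet> x)\<^sup>2" for \<alpha>
    have "limit x - w x * (g x \<bullet> gradient f x) - (\<Sum>\<alpha>\<in>Rp. E \<alpha> x) =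
      \<psi> x * (w x * (laplace f x + ((\<Sum>\<alpha>\<in>Rp. k \<alpha> * ((P \<alpha> x - P' \<alpha> x) / (\<alpha> \<bullet> x))) - (\<Sum>\<alpha>\<in>Rp. k \<alpha> * s \<alpha>))))"
      unfolding E_def s_def[symmetric] sum_distrib_left[symmetric] limit_def by (simp add: right_diff_distrib distrib_left)
    also have "(\<Sum>\<alpha>\<in>Rp. k \<alpha> * ((P \<alpha> x - P' \<alpha> x) / (\<alpha> \<bullet> x))) - (\<Sum>\<alpha>\<in>Rp. k \<alpha> * s \<alpha>) =
        (\<Sum>\<alpha>\<in>Rp. k \<alpha> * (2 * (\<alpha> \<bullet> gradient f x) / (\<alpha> \<bullet> x) - (\<alpha> \<bullet> \<alpha>) * (f x - f (reflection \<alpha> x)) / (\<alpha> \<bullet> x)\<^sup>2))"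
      unfolding sum_subtractf[symmetric] right_diff_distrib[symmetric]
      by (intro sum.cong refl arg_cong2[where f = "(*)"])
        (simp add: s_def P_def[symmetric] diff_divide_distrib add_divide_distrib right_diff_distrib)
    finally show ?thesis by (simp add: dunkl_expr_def)
  qed
  show "integrable lborel (\<lambda>x. \<psi> x * (w x * dunkl_expr f x))"
    unfolding eq using limit_int G_int E_int
    by (intro Bochner_Integration.integrable_diff Bochner_Integration.integrable_sum)
  show "(LINT x|lborel. \<psi> x * (w x * dunkl_expr f x)) = - (LINT x|lborel. w x * (g x \<bullet> gradient f x))"
    unfolding eq using limit_int G_int E_int E_zero limit_zero
    by (simp add: Bochner_Integration.integral_diff Bochner_Integration.integral_sum)
qed

end

section \<open>Spherical means and the Green identity\<close>

context root_data
begin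

abbreviation hom_dim :: real where "hom_dim \<equiv> real DIM('a) + 2 * dunkl_gamma Rp k"

definition sphere_integrand :: "('a \<Rightarrow> real) \<Rightarrow> real \<Rightarrow> 'a \<Rightarrow> real" where
  "sphere_integrand f s x = indicator (ball 0 1) x * (w (sgn x) * f (s *\<^sub>R sgn x))"

text \<open>The integral of \<open>w y * f (s *\<^sub>R y)\<close> with respect to surface measure, in the parametrization of the
  sphere by the unit ball.\<close>

definition sphere_mean :: "('a \<Rightarrow> real) \<Rightarrow> real \<Rightarrow> real" where
  "sphere_mean f s = real DIM('a) * (LINT x|lborel. sphere_integrand f s x)"

lemma norm_scaleR_sgn_le: "0 \<le> s \<Longrightarrow> norm (s *\<^sub>R sgn (x::'a)) \<le> s"
  by (auto simp: norm_sgn)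

lemma sphere_integrand_measurable:
  assumes f: "continuous_on (ball 0 1) f" and s: "0 \<le> s" "s < 1"
  shows "sphere_integrand f s \<in> borel_measurable borel"
proof -
  have [measurable]: "(\<lambda>y. if y \<in> ball 0 1 then f y else 0) \<in> borel_measurable borel"
    using f by (intro borel_measurable_continuous_on_if) auto
  have "s *\<^sub>R sgn x \<in> ball 0 1" for x :: 'a
    using norm_scaleR_sgn_le[OF s(1), of x] s by simp
  then have eq: "sphere_integrand f s = (\<lambda>x. indicator (ball 0 1) x *
      (w (sgn x) * (\<lambda>y. if y \<in> ball 0 1 then f y else 0) (s *\<^sub>R sgn x)))"
    by (auto simp: sphere_integrand_def fun_eq_iff)
  have [measurable]: "(\<lambda>x. (\<lambda>y. if y \<in> ball 0 1 then f y else 0) (s *\<^sub>R sgn x)) \<in> borel_measurable (borel :: 'a measure)"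
    by (rule measurable_compose[where N = borel]) measurable
  have [measurable]: "(indicator (ball 0 1) :: 'a \<Rightarrow> real) \<in> borel_measurable borel"
    by (intro borel_measurable_indicator) simp
  show ?thesis unfolding eq by measurable
qed

lemma sphere_integrand_bound:
  assumes f: "continuous_on (ball 0 1) f" and S: "S < 1"
  obtains C where "0 \<le> C" "\<And>s x. 0 \<le> s \<Longrightarrow> s \<le> S \<Longrightarrow> \<bar>w (sgn x) * f (s *\<^sub>R sgn x)\<bar> \<le> C"
proof -
  have "bounded (f ` cball 0 S)"
    using S by (intro compact_imp_bounded compact_continuous_image continuous_on_subset[OF f]) auto
  then obtain C1 where C1: "\<forall>y\<in>f ` cball 0 S. norm y \<le> C1" unfolding bounded_iff by blast
  have "bounded (w ` cball 0 1)"
    by (intro compact_imp_bounded compact_continuous_image continuous_on_weight) auto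
  then obtain C2 where C2: "\<forall>y\<in>w ` cball 0 1. norm y \<le> C2" unfolding bounded_iff by blast
  show ?thesis
  proof (rule that[of "\<bar>C2\<bar> * \<bar>C1\<bar>"])
    fix s and x :: 'a assume s: "0 \<le> s" "s \<le> S"
    have "s *\<^sub>R sgn x \<in> cball 0 S" using norm_scaleR_sgn_le[OF s(1), of x] s(2) by simp
    then have "norm (f (s *\<^sub>R sgn x)) \<le> C1" using C1 by blast
    then have "\<bar>f (s *\<^sub>R sgn x)\<bar> \<le> \<bar>C1\<bar>" by simp
    moreover have "\<bar>w (sgn x)\<bar> \<le> \<bar>C2\<bar>"
    proof -
      have "sgn x \<in> cball 0 1" by (simp add: norm_sgn)
      then have "norm (w (sgn x)) \<le> C2" using C2 by blast
      then show ?thesis by simp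
    qed
    ultimately show "\<bar>w (sgn x) * f (s *\<^sub>R sgn x)\<bar> \<le> \<bar>C2\<bar> * \<bar>C1\<bar>"
      unfolding abs_mult by (intro mult_mono) auto
  qed simp
qed

lemma sphere_integrand_integrable:
  assumes f: "continuous_on (ball 0 1) f" and s: "0 \<le> s" "s < 1"
  shows "integrable lborel (sphere_integrand f s)"
proof -
  obtain C where C: "0 \<le> C" "\<And>x. \<bar>w (sgn x) * f (s *\<^sub>R sgn x)\<bar> \<le> C"
    using sphere_integrand_bound[OF f s(2)] s by (metis order_refl)
  show ?thesis
    by (rule integrable_bounded_support[OF sphere_integrand_measurable[OF assms], where B = C and r = 1])
      (use C in \<open>auto simp: sphere_integrand_def indicator_def\<close>)
qed

text \<open>The radial derivative: in polar coordinates, with \<open>w\<close> homogeneous of degree \<open>2 * dunkl_gamma Rp k\<close>,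
  the powers of the radius cancel, and what remains is the derivative of \<open>\<rho> \<mapsto> f (\<rho> *\<^sub>R sgn x)\<close>.\<close>

lemma nn_integral_radial_derivative:
  assumes der: "\<And>x. x \<in> ball 0 1 \<Longrightarrow> (f has_derivative (\<lambda>h. G x \<bullet> h)) (at x)"
    and G: "continuous_on (ball 0 1) G"
    and r: "0 < r" "r < S" "S < 1"
    and nonneg: "\<And>x. r \<le> norm x \<Longrightarrow> norm x \<le> S \<Longrightarrow> 0 \<le> x \<bullet> G x"
  defines "A \<equiv> {x. r \<le> norm x \<and> norm x \<le> S}"
  shows "(\<integral>\<^sup>+x. ennreal (indicator A x * (norm x powr (- hom_dim) * w x) * (x \<bullet> G x)) \<partial>lborel) =
      ennreal (sphere_mean f S - sphere_mean f r)" (is "?lhs = _")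
    and "0 \<le> sphere_mean f S - sphere_mean f r"
proof -
  let ?d = "DIM('a)"
  have f: "continuous_on (ball 0 1) f"
    using der has_derivative_continuous by (blast intro: continuous_at_imp_continuous_on)
  define K where "K x = indicator A x * (norm x powr (- hom_dim) * w x) * (x \<bullet> G x)" for x
  define h where "h \<rho> = (if 0 < \<rho> then ?d * \<rho> ^ (?d - 1) else 0)" for \<rho> :: real
  have [measurable]: "A \<in> sets borel" unfolding A_def by measurable
  have K_meas: "(\<lambda>x. ennreal (K x)) \<in> borel_measurable borel"
  proof -
    have "K \<in> borel_measurable borel" unfolding K_def[abs_def]
      by (rule borel_measurable_times_continuous_on[of _ "ball 0 1"])
        (use G r in \<open>auto simp: A_def indicator_def intro!: continuous_intros\<close>)
    then show ?thesis by measurable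
  qed
  define T where "T x = real ?d * (w (sgn x) * f (S *\<^sub>R sgn x) - w (sgn x) * f (r *\<^sub>R sgn x))" for x
  have inner: "(\<integral>\<^sup>+\<rho>. ennreal (h \<rho>) * ennreal (K (\<rho> *\<^sub>R sgn x)) \<partial>lborel) = ennreal (T x) \<and> 0 \<le> T x"
    if x: "x \<noteq> 0" for x
  proof -
    let ?\<theta> = "sgn x"
    have norm\<theta>: "norm ?\<theta> = 1" using x by (simp add: norm_sgn)
    have inball: "\<rho> *\<^sub>R ?\<theta> \<in> ball 0 1" if "\<rho> \<in> {r..S}" for \<rho>
      using that r norm\<theta> by simp
    define F' where "F' \<rho> = (if \<rho> \<in> {r..S} then ?d * w ?\<theta> * (?\<theta> \<bullet> G (\<rho> *\<^sub>R ?\<theta>)) else 0)" for \<rho>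
    have F'_meas: "F' \<in> borel_measurable borel"
      unfolding F'_def[abs_def] using inball
      by (intro borel_measurable_continuous_on_if continuous_intros continuous_on_compose2[OF G]) auto
    have eq: "ennreal (h \<rho>) * ennreal (K (\<rho> *\<^sub>R ?\<theta>)) = ennreal (F' \<rho>) * indicator {r..S} \<rho>" for \<rho>
    proof (cases "\<rho> \<in> {r..S}")
      case True
      then have \<rho>: "0 < \<rho>" using r by auto
      have "\<rho> ^ (?d - 1) * (\<rho> powr (- hom_dim) * \<rho> powr (2 * dunkl_gamma Rp k)) * \<rho> = 1"
      proof -
        have "\<rho> ^ (?d - 1) * (\<rho> powr (- hom_dim) * \<rho> powr (2 * dunkl_gamma Rp k)) * \<rho> =
          \<rho> ^ ?d * \<rho> powr (- real ?d)"
          using \<rho> power_Suc[of \<rho> "?d - 1"] by (simp add: powr_add[symmetric])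
        then show ?thesis using \<rho> by (simp add: powr_minus powr_realpow)
      qed
      then have one: "\<rho> ^ (?d - 1) * (\<rho> powr (- hom_dim) * (\<rho> powr (2 * dunkl_gamma Rp k) * v) * (\<rho> * z)) = v * z" for v z
        by (metis (no_types, opaque_lifting) mult.assoc mult.commute mult.left_neutral)
      have "h \<rho> * K (\<rho> *\<^sub>R ?\<theta>) = F' \<rho>"
        using True \<rho> norm\<theta> one[of "w ?\<theta>" "?\<theta> \<bullet> G (\<rho> *\<^sub>R ?\<theta>)"]
        by (simp add: h_def K_def F'_def A_def weight_scaleR mult.assoc)
      moreover have "0 \<le> h \<rho>" using \<rho> by (simp add: h_def)
      ultimately show ?thesis using True by (simp add: ennreal_mult'[symmetric])
    next
      case False
      have "K (\<rho> *\<^sub>R ?\<theta>) = 0 \<or> h \<rho> = 0"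
        using False norm\<theta> by (auto simp: K_def A_def h_def)
      then show ?thesis using False by auto
    qed
    have F'_nonneg: "0 \<le> F' \<rho>" if "\<rho> \<in> {r..S}" for \<rho>
    proof -
      have "0 \<le> \<rho> * (?\<theta> \<bullet> G (\<rho> *\<^sub>R ?\<theta>))"
        using nonneg[of "\<rho> *\<^sub>R ?\<theta>"] that r norm\<theta> by simp
      then have "0 \<le> ?\<theta> \<bullet> G (\<rho> *\<^sub>R ?\<theta>)" using that r by (simp add: zero_le_mult_iff)
      then show ?thesis using that by (simp add: F'_def)
    qed
    have DERIV: "((\<lambda>\<rho>. ?d * w ?\<theta> * f (\<rho> *\<^sub>R ?\<theta>)) has_real_derivative F' \<rho>) (at \<rho>)" if "\<rho> \<in> {r..S}" for \<rho>
    proof -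
      have "((\<lambda>\<rho>. f (\<rho> *\<^sub>R ?\<theta>)) has_derivative (\<lambda>t. G (\<rho> *\<^sub>R ?\<theta>) \<bullet> (t *\<^sub>R ?\<theta>))) (at \<rho>)"
        by (rule has_derivative_compose[where f = "\<lambda>\<rho>. \<rho> *\<^sub>R ?\<theta>" and g = f])
          (auto intro!: derivative_eq_intros der[OF inball[OF that]])
      then have "((\<lambda>\<rho>. f (\<rho> *\<^sub>R ?\<theta>)) has_real_derivative (?\<theta> \<bullet> G (\<rho> *\<^sub>R ?\<theta>))) (at \<rho>)"
        by (simp add: has_field_derivative_def mult_commute_abs inner_commute)
      from DERIV_cmult[OF this, of "?d * w ?\<theta>"] show ?thesis using that by (simp add: F'_def)
    qed
    have "(\<integral>\<^sup>+\<rho>. ennreal (F' \<rho>) * indicator {r..S} \<rho> \<partial>lborel) =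
        ennreal (?d * w ?\<theta> * f (S *\<^sub>R ?\<theta>) - ?d * w ?\<theta> * f (r *\<^sub>R ?\<theta>))"
      using r by (intro nn_integral_FTC_Icc[OF F'_meas DERIV F'_nonneg]) auto
    moreover have "?d * w ?\<theta> * f (r *\<^sub>R ?\<theta>) \<le> ?d * w ?\<theta> * f (S *\<^sub>R ?\<theta>)"
    proof (rule DERIV_nonneg_imp_nondecreasing[of r S "\<lambda>\<rho>. ?d * w ?\<theta> * f (\<rho> *\<^sub>R ?\<theta>)"])
      fix \<rho> assume "r \<le> \<rho>" "\<rho> \<le> S"
      then show "\<exists>y. ((\<lambda>\<rho>. ?d * w ?\<theta> * f (\<rho> *\<^sub>R ?\<theta>)) has_real_derivative y) (at \<rho>) \<and> 0 \<le> y"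
        using DERIV[of \<rho>] F'_nonneg[of \<rho>] by auto
    qed (use r in simp)
    ultimately show ?thesis unfolding eq by (simp add: T_def algebra_simps)
  qed
  define Q where "Q x = real ?d * (sphere_integrand f S x - sphere_integrand f r x)" for x
  have Q: "indicator (ball 0 1) x * T x = Q x" for x
    by (simp add: Q_def T_def sphere_integrand_def algebra_simps)
  have Q_int: "integrable lborel Q"
    unfolding Q_def[abs_def] using r
    by (intro integrable_mult_right Bochner_Integration.integrable_diff sphere_integrand_integrable f) auto
  have nonzero: "AE x in lborel. x \<noteq> (0::'a)"
    using AE_lborel_negligible[OF negligible_sing] by simp
  have Q_nonneg: "AE x in lborel. 0 \<le> Q x"
    using nonzero by eventually_elim (use inner in \<open>auto simp: Q[symmetric] indicator_def\<close>)
  have LQ: "(LINT x|lborel. Q x) = sphere_mean f S - sphere_mean f r"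
    using r sphere_integrand_integrable[OF f, of S] sphere_integrand_integrable[OF f, of r]
    by (simp add: Q_def sphere_mean_def right_diff_distrib)
  have "?lhs = (\<integral>\<^sup>+x. indicator (ball 0 1) x *
      (\<integral>\<^sup>+\<rho>. ennreal (h \<rho>) * ennreal (K (\<rho> *\<^sub>R sgn x)) \<partial>lborel) \<partial>lborel)"
    using nn_integral_polar[OF K_meas] by (simp add: K_def h_def)
  also have "\<dots> = (\<integral>\<^sup>+x. ennreal (Q x) \<partial>lborel)"
  proof (rule nn_integral_cong_AE)
    show "AE x in lborel. indicator (ball 0 1) x *
      (\<integral>\<^sup>+\<rho>. ennreal (h \<rho>) * ennreal (K (\<rho> *\<^sub>R sgn x)) \<partial>lborel) = ennreal (Q x)"
      using nonzero by eventually_elim (use inner in \<open>auto simp: Q[symmetric] indicator_def\<close>)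
  qed
  also have "\<dots> = ennreal (LINT x|lborel. Q x)"
    by (rule nn_integral_eq_integral[OF Q_int Q_nonneg])
  finally show "?lhs = ennreal (sphere_mean f S - sphere_mean f r)" by (simp add: LQ)
  show "0 \<le> sphere_mean f S - sphere_mean f r"
    unfolding LQ[symmetric] by (rule integral_nonneg_AE[OF Q_nonneg])
qed

text \<open>The sign condition is removed by adding a multiple of \<open>x \<bullet> x\<close>, which has a radial
  derivative bounded below on the shell.\<close>

lemma integral_radial_derivative:
  assumes der: "\<And>x. x \<in> ball 0 1 \<Longrightarrow> (f has_derivative (\<lambda>h. G x \<bullet> h)) (at x)"
    and G: "continuous_on (ball 0 1) G"
    and r: "0 < r" "r < S" "S < 1"
  defines "A \<equiv> {x. r \<le> norm x \<and> norm x \<le> S}"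
  shows "(LINT x|lborel. indicator A x * (norm x powr (- hom_dim) * w x) * (x \<bullet> G x)) =
      sphere_mean f S - sphere_mean f r"
proof -
  have [measurable]: "A \<in> sets borel" unfolding A_def by measurable
  have A_ball: "A \<subseteq> ball 0 1" using r by (auto simp: A_def)
  have compact_A: "compact A"
  proof -
    have "A = cball 0 S - ball 0 r" by (auto simp: A_def)
    then show ?thesis by (simp add: compact_diff)
  qed
  define q where "q x = indicator A x * (norm x powr (- hom_dim) * w x)" for x
  have q_meas [measurable]: "q \<in> borel_measurable borel" unfolding q_def[abs_def] by measurable
  define K where "K H x = q x * (x \<bullet> H x)" for H x
  have K_meas: "K H \<in> borel_measurable borel" if "continuous_on (ball 0 1) H" for H
    unfolding K_def[abs_def]
    by (rule borel_measurable_times_continuous_on[of _ "ball 0 1"])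
      (use that A_ball in \<open>auto simp: q_def indicator_def intro!: continuous_intros\<close>)
  have K_int: "integrable lborel (K H)" if H: "continuous_on (ball 0 1) H" for H
  proof -
    have "continuous_on A (\<lambda>x. (norm x powr (- hom_dim) * w x) * (x \<bullet> H x))"
      using r by (intro continuous_intros continuous_on_weight continuous_on_subset[OF H A_ball]) (auto simp: A_def)
    then have "bounded ((\<lambda>x. (norm x powr (- hom_dim) * w x) * (x \<bullet> H x)) ` A)"
      by (intro compact_imp_bounded compact_continuous_image compact_A)
    then obtain C where C: "\<forall>y\<in>(\<lambda>x. (norm x powr (- hom_dim) * w x) * (x \<bullet> H x)) ` A. norm y \<le> C"
      unfolding bounded_iff by blast
    show ?thesis
    proof (rule integrable_bounded_support[OF K_meas[OF H], where B = "\<bar>C\<bar>" and r = 1])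
      fix x show "\<bar>K H x\<bar> \<le> \<bar>C\<bar>" using C by (cases "x \<in> A") (fastforce simp: K_def q_def)+
    qed (use A_ball in \<open>force simp: K_def q_def indicator_def\<close>)
  qed
  have main: "(LINT x|lborel. K H x) = sphere_mean F S - sphere_mean F r"
    if F: "\<And>x. x \<in> ball 0 1 \<Longrightarrow> (F has_derivative (\<lambda>h. H x \<bullet> h)) (at x)"
      and H: "continuous_on (ball 0 1) H" and nn: "\<And>x. r \<le> norm x \<Longrightarrow> norm x \<le> S \<Longrightarrow> 0 \<le> x \<bullet> H x" for F H
  proof -
    have "0 \<le> K H x" for x
      using nn[of x] by (auto simp: K_def q_def A_def indicator_def)
    then have "(LINT x|lborel. K H x) = enn2real (\<integral>\<^sup>+x. ennreal (K H x) \<partial>lborel)"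
      using K_meas[OF H] by (intro integral_eq_nn_integral) auto
    then show ?thesis
      using nn_integral_radial_derivative[OF F H r nn] by (simp add: K_def q_def A_def)
  qed
  have "bounded ((\<lambda>x. x \<bullet> G x) ` A)"
    by (intro compact_imp_bounded compact_continuous_image compact_A continuous_intros
        continuous_on_subset[OF G A_ball])
  then obtain C where C: "\<forall>y\<in>(\<lambda>x. x \<bullet> G x) ` A. norm y \<le> C" unfolding bounded_iff by blast
  \<comment> \<open>On the shell \<open>x \<bullet> (2 *\<^sub>R x) \<ge> 2 * r\<^sup>2\<close>, so this multiple outweighs \<open>x \<bullet> G x \<ge> - \<bar>C\<bar>\<close>.\<close>
  define c where "c = \<bar>C\<bar> / (2 * r\<^sup>2)"
  define sq where "sq x = x \<bullet> x" for x :: 'a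
  have sq_der: "(sq has_derivative (\<lambda>h. (2 *\<^sub>R x) \<bullet> h)) (at x)" for x
    unfolding sq_def[abs_def] by (auto intro!: derivative_eq_intros simp: inner_commute)
  have f_cont: "continuous_on (ball 0 1) f" and sq_cont: "continuous_on (ball 0 1) sq"
    using der sq_der has_derivative_continuous by (blast intro: continuous_at_imp_continuous_on)+
  have total: "(LINT x|lborel. K (\<lambda>x. G x + c *\<^sub>R 2 *\<^sub>R x) x) =
      sphere_mean (\<lambda>x. f x + c * sq x) S - sphere_mean (\<lambda>x. f x + c * sq x) r"
  proof (rule main)
    fix x :: 'a assume "x \<in> ball 0 1"
    then show "((\<lambda>x. f x + c * sq x) has_derivative (\<lambda>h. (G x + c *\<^sub>R 2 *\<^sub>R x) \<bullet> h)) (at x)"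
      by (auto intro!: derivative_eq_intros der sq_der simp: inner_add_left)
  next
    fix x :: 'a assume x: "r \<le> norm x" "norm x \<le> S"
    then have "\<bar>x \<bullet> G x\<bar> \<le> \<bar>C\<bar>" using C by (fastforce simp: A_def)
    moreover have "\<bar>C\<bar> \<le> c * (2 * (norm x)\<^sup>2)"
    proof -
      have "r\<^sup>2 \<le> (norm x)\<^sup>2" using x r by (intro power_mono) auto
      then have "c * (2 * r\<^sup>2) \<le> c * (2 * (norm x)\<^sup>2)" by (intro mult_left_mono) (auto simp: c_def)
      then show ?thesis using r by (simp add: c_def)
    qed
    ultimately show "0 \<le> x \<bullet> (G x + c *\<^sub>R 2 *\<^sub>R x)"
      by (simp add: inner_add_right dot_square_norm)
  qed (intro continuous_intros G)
  have square: "(LINT x|lborel. K (\<lambda>x. 2 *\<^sub>R x) x) = sphere_mean sq S - sphere_mean sq r"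
    by (rule main[OF sq_der]) (auto intro!: continuous_intros)
  have split: "(LINT x|lborel. K (\<lambda>x. G x + c *\<^sub>R 2 *\<^sub>R x) x) =
      (LINT x|lborel. K G x) + c * (LINT x|lborel. K (\<lambda>x. 2 *\<^sub>R x) x)"
  proof -
    have "K (\<lambda>x. G x + c *\<^sub>R 2 *\<^sub>R x) x = K G x + c * K (\<lambda>x. 2 *\<^sub>R x) x" for x
      by (simp add: K_def inner_add_right distrib_left)
    moreover have "integrable lborel (K (\<lambda>x. 2 *\<^sub>R x))"
      by (intro K_int continuous_intros)
    ultimately show ?thesis using K_int[OF G] by simp
  qed
  have means: "sphere_mean (\<lambda>x. f x + c * sq x) s = sphere_mean f s + c * sphere_mean sq s"
    if "0 \<le> s" "s < 1" for s
  proof -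
    have "sphere_integrand (\<lambda>x. f x + c * sq x) s x = sphere_integrand f s x + c * sphere_integrand sq s x" for x
      by (simp add: sphere_integrand_def algebra_simps)
    then show ?thesis
      using sphere_integrand_integrable[OF f_cont that] sphere_integrand_integrable[OF sq_cont that]
      by (simp add: sphere_mean_def distrib_left)
  qed
  have "c * (LINT x|lborel. K (\<lambda>x. 2 *\<^sub>R x) x) = c * sphere_mean sq S - c * sphere_mean sq r"
    unfolding square by (rule right_diff_distrib)
  then have "(LINT x|lborel. K G x) = sphere_mean f S - sphere_mean f r"
    using total split means[of r] means[of S] r by linarith
  then show ?thesis by (simp add: K_def q_def)
qed

text \<open>The Green function of the ball of radius \<open>S\<close> with pole \<open>0\<close>, for the radial part
  \<open>h'' + (hom_dim - 1) * h' / \<rho>\<close> of the Dunkl Laplacian, truncated near the pole.\<close>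

definition truncated_green :: "real \<Rightarrow> real \<Rightarrow> 'a \<Rightarrow> real" where
  "truncated_green r S x =
     (max r (min (norm x) S) powr (2 - hom_dim) - S powr (2 - hom_dim)) / (hom_dim - 2)"

text \<open>The gradient of the truncated Green function is \<open>- (norm x powr (- hom_dim)) *\<^sub>R x\<close> on the shell and \<open>0\<close> elsewhere, so
  the weak form of the Dunkl Laplacian is the integral of the radial derivative.\<close>

lemma green_identity:
  assumes dim: "2 < hom_dim" and f: "C2_on (ball 0 1) f" and r: "0 < r" "r < S" "S < 1"
  shows "integrable lborel (\<lambda>x. truncated_green r S x * (w x * dunkl_expr f x))"
    and "(LINT x|lborel. truncated_green r S x * (w x * dunkl_expr f x)) = sphere_mean f S - sphere_mean f r"
proof -
  let ?a = "2 - hom_dim"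
  define \<kappa> where "\<kappa> s = (s powr ?a - S powr ?a) / (hom_dim - 2)" for s
  define clamp where "clamp s = max r (min s S)" for s
  have \<psi>_eq: "truncated_green r S x = \<kappa> (clamp (norm x))" for x
    by (simp add: truncated_green_def \<kappa>_def clamp_def)
  define g where "g x = (if r < norm x \<and> norm x < S then - (norm x powr (- hom_dim)) *\<^sub>R x else 0)" for x :: 'a
  \<comment> \<open>The size of the gradient on the inner sphere, where it is largest.\<close>
  define L where "L = r powr (1 - hom_dim)"
  have power_split: "norm x powr (1 - hom_dim) = norm x * norm x powr (- hom_dim)" for x :: 'a
  proof -
    have "1 - hom_dim = 1 + (- hom_dim)" by simp
    then show ?thesis by (simp only: powr_mult_base[OF norm_ge_zero])
  qed
  have \<kappa>_der: "(\<kappa> has_real_derivative - (s powr (1 - hom_dim))) (at s)" if "0 < s" for s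
  proof -
    have "(\<kappa> has_real_derivative (?a * s powr (?a - 1) - 0) / (hom_dim - 2)) (at s)"
      unfolding \<kappa>_def[abs_def] using that dim
      by (intro DERIV_cdivide DERIV_diff DERIV_const has_real_derivative_powr)
    also have "(?a * s powr (?a - 1) - 0) / (hom_dim - 2) = - (s powr (1 - hom_dim))"
      using dim by (simp add: field_simps)
    finally show ?thesis .
  qed
  have power_le: "s powr (1 - hom_dim) \<le> L" if "r \<le> s" for s
    unfolding L_def using that r dim by (intro powr_mono2') auto
  have \<kappa>_lip: "\<bar>\<kappa> s - \<kappa> t\<bar> \<le> L * \<bar>s - t\<bar>" if st: "r \<le> s" "r \<le> t" for s t
  proof -
    have "norm (\<kappa> s - \<kappa> t) \<le> L * norm (s - t)"
    proof (rule field_differentiable_bound[of "{r..}"])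
      fix z assume "z \<in> {r..}"
      then show "(\<kappa> has_field_derivative - (z powr (1 - hom_dim))) (at z within {r..})"
        using \<kappa>_der[of z] r by (auto intro: DERIV_subset)
      show "norm (- (z powr (1 - hom_dim))) \<le> L" using power_le[of z] \<open>z \<in> {r..}\<close> by simp
    qed (use st in auto)
    then show ?thesis by simp
  qed
  have clamp: "r \<le> clamp s" "clamp s \<le> S" "\<bar>clamp s - clamp t\<bar> \<le> \<bar>s - t\<bar>" for s t
    using r by (auto simp: clamp_def)
  have lip: "\<bar>truncated_green r S x - truncated_green r S y\<bar> \<le> L * norm (x - y)" for x y
  proof -
    have "\<bar>\<kappa> (clamp (norm x)) - \<kappa> (clamp (norm y))\<bar> \<le> L * \<bar>clamp (norm x) - clamp (norm y)\<bar>"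
      by (intro \<kappa>_lip clamp)
    also have "\<dots> \<le> L * norm (x - y)"
      using clamp(3)[of "norm x" "norm y"] norm_triangle_ineq3[of x y]
      by (intro mult_left_mono) (auto simp: L_def)
    finally show ?thesis by (simp add: \<psi>_eq)
  qed
  have \<kappa>_S: "\<kappa> S = 0" by (simp add: \<kappa>_def)
  have bound: "\<bar>truncated_green r S x\<bar> \<le> L * S" for x
  proof -
    have "\<bar>\<kappa> (clamp (norm x)) - \<kappa> S\<bar> \<le> L * \<bar>clamp (norm x) - S\<bar>"
      using r by (intro \<kappa>_lip clamp) auto
    also have "\<dots> \<le> L * S" using clamp(1,2)[of "norm x"] r by (intro mult_left_mono) (auto simp: L_def)
    finally show ?thesis by (simp add: \<psi>_eq \<kappa>_S)
  qed
  have der: "(truncated_green r S has_derivative (\<lambda>h. g x \<bullet> h)) (at x)"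
    if x: "norm x \<noteq> r" "norm x \<noteq> S" for x
  proof -
    consider "norm x < r" | "r < norm x" "norm x < S" | "S < norm x" using x by linarith
    then show ?thesis
    proof cases
      case 1
      have "(truncated_green r S has_derivative (\<lambda>h. 0)) (at x)"
      proof (rule has_derivative_transform_within_open[OF _ open_ball[of 0 r]])
        show "((\<lambda>x. \<kappa> r) has_derivative (\<lambda>h. 0)) (at x)" by simp
      qed (use 1 r in \<open>auto simp: \<psi>_eq clamp_def\<close>)
      then show ?thesis using 1 by (simp add: g_def)
    next
      case 2
      have x0: "x \<noteq> 0" using 2 r by auto
      have "((\<lambda>x. \<kappa> (norm x)) has_derivative (\<lambda>h. - (norm x powr (1 - hom_dim)) * (h \<bullet> sgn x))) (at x)"
      proof (rule has_derivative_compose[where f = norm and f' = "\<lambda>h. h \<bullet> sgn x" and g = \<kappa>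
            and g' = "\<lambda>t. - (norm x powr (1 - hom_dim)) * t"])
        show "(norm has_derivative (\<lambda>h. h \<bullet> sgn x)) (at x)"
          by (rule has_derivative_norm[OF x0])
        show "(\<kappa> has_derivative (\<lambda>t. - (norm x powr (1 - hom_dim)) * t)) (at (norm x))"
          by (rule \<kappa>_der[unfolded has_field_derivative_def]) (use x0 in simp)
      qed
      also have "(\<lambda>h. - (norm x powr (1 - hom_dim)) * (h \<bullet> sgn x)) = (\<lambda>h. g x \<bullet> h)"
        unfolding power_split using 2 x0 by (simp add: g_def sgn_div_norm fun_eq_iff inner_commute)
      finally show ?thesis
      proof (rule has_derivative_transform_within_open[of _ _ _ _ "{x. r < norm x \<and> norm x < S}"])
        show "open {x::'a. r < norm x \<and> norm x < S}"
          by (intro open_Collect_conj open_Collect_less continuous_intros)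
      qed (use 2 in \<open>auto simp: \<psi>_eq clamp_def\<close>)
    next
      case 3
      have "(truncated_green r S has_derivative (\<lambda>h. 0)) (at x)"
      proof (rule has_derivative_transform_within_open[OF _ open_Compl[OF closed_cball[of 0 S]]])
        show "((\<lambda>x. \<kappa> S) has_derivative (\<lambda>h. 0)) (at x)" by simp
      qed (use 3 r in \<open>auto simp: \<psi>_eq clamp_def\<close>)
      then show ?thesis using 3 by (simp add: g_def)
    qed
  qed
  have spheres: "AE x in lborel. norm (x::'a) \<noteq> r \<and> norm x \<noteq> S"
    using AE_lborel_negligible[OF negligible_sphere[of "0::'a" r]] AE_lborel_negligible[OF negligible_sphere[of "0::'a" S]]
    by eventually_elim auto
  interpret test_function R Rp k f "truncated_green r S" g S L "L * S"
  proof unfold_locales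
    show "AE x in lborel. (truncated_green r S has_derivative (\<lambda>h. g x \<bullet> h)) (at x)"
      using spheres by eventually_elim (use der in auto)
    show "g \<in> borel_measurable borel" unfolding g_def[abs_def] by measurable
    show "norm (g x) \<le> L" for x
    proof (cases "r < norm x \<and> norm x < S")
      case True
      then have "norm (g x) = norm x powr (1 - hom_dim)"
        unfolding power_split by (simp add: g_def)
      then show ?thesis using power_le[of "norm x"] True by simp
    next
      case False
      then have "g x = 0" by (auto simp: g_def)
      then show ?thesis by (simp add: L_def)
    qed
  qed (use r f lip bound in \<open>auto simp: \<psi>_eq clamp_def \<kappa>_S g_def\<close>)
  show "integrable lborel (\<lambda>x. truncated_green r S x * (w x * dunkl_expr f x))"
    by (rule integral_dunkl_expr)
  have "(LINT x|lborel. truncated_green r S x * (w x * dunkl_expr f x)) =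
      - (LINT x|lborel. w x * (g x \<bullet> gradient f x))" by (rule integral_dunkl_expr)
  also have "\<dots> = (LINT x|lborel. - (w x * (g x \<bullet> gradient f x)))" by simp
  also have "\<dots> = (LINT x|lborel. indicator {x. r \<le> norm x \<and> norm x \<le> S} x *
      (norm x powr (- hom_dim) * w x) * (x \<bullet> gradient f x))"
  proof (rule Bochner_Integration.integral_cong_AE)
    show "(\<lambda>x. - (w x * (g x \<bullet> gradient f x))) \<in> borel_measurable lborel"
      using measurable_g_inner[OF continuous_on_gradient] by simp
    have "(\<lambda>x. indicator {x. r \<le> norm x \<and> norm x \<le> S} x *
      (norm x powr (- hom_dim) * w x) * (x \<bullet> gradient f x)) \<in> borel_measurable borel"
    proof (rule borel_measurable_times_continuous_on[of _ "ball 0 1"])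
      show "(\<lambda>x. indicator {x. r \<le> norm x \<and> norm x \<le> S} x * (norm x powr (- hom_dim) * w x)) \<in> borel_measurable borel"
        by measurable
    qed (use r in \<open>auto simp: indicator_def intro!: continuous_intros continuous_on_gradient\<close>)
    then show "(\<lambda>x. indicator {x. r \<le> norm x \<and> norm x \<le> S} x *
      (norm x powr (- hom_dim) * w x) * (x \<bullet> gradient f x)) \<in> borel_measurable lborel" by (simp only: measurable_lborel2)
    show "AE x in lborel. - (w x * (g x \<bullet> gradient f x)) = indicator {x. r \<le> norm x \<and> norm x \<le> S} x *
      (norm x powr (- hom_dim) * w x) * (x \<bullet> gradient f x)"
      using spheres by eventually_elim (auto simp: g_def indicator_def)
  qed
  also have "\<dots> = sphere_mean f S - sphere_mean f r"
    by (rule integral_radial_derivative[OF derivative continuous_on_gradient r])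
  finally show "(LINT x|lborel. truncated_green r S x * (w x * dunkl_expr f x)) =
      sphere_mean f S - sphere_mean f r" .
qed

end

section \<open>Convex functions of a Dunkl harmonic function\<close>

context C2_function
begin

lemma compose_C2:
  assumes \<Phi>: "\<And>t. (\<Phi> has_real_derivative \<phi> t) (at t)" and \<phi>: "\<And>t. (\<phi> has_real_derivative \<eta> t) (at t)"
    and \<eta>: "continuous_on UNIV \<eta>"
  shows "C2_on S (\<lambda>x. \<Phi> (f x))"
    and "x \<in> S \<Longrightarrow> gradient (\<lambda>x. \<Phi> (f x)) x = \<phi> (f x) *\<^sub>R gradient f x"
    and "x \<in> S \<Longrightarrow> laplace (\<lambda>x. \<Phi> (f x)) x = \<eta> (f x) * (norm (gradient f x))\<^sup>2 + \<phi> (f x) * laplace f x"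
proof -
  let ?F = "\<lambda>x. \<Phi> (f x)"
  have d1: "(?F has_derivative (\<lambda>h. (\<phi> (f x) *\<^sub>R gradient f x) \<bullet> h)) (at x)" if "x \<in> S" for x
    using has_derivative_compose[OF derivative[OF that] \<Phi>[unfolded has_field_derivative_def]]
    by (simp add: mult_commute_abs)
  show grad: "gradient ?F x = \<phi> (f x) *\<^sub>R gradient f x" if "x \<in> S" for x
    by (rule gradient_eqI[OF d1[OF that]])
  have partial1: "\<phi> (f x) * partial b x = frechet_derivative ?F (at x) b" if "x \<in> S" "b \<in> Basis" for x b
    using grad[OF that(1)] gradient_inner_Basis[OF that(2), of ?F x] gradient_inner_Basis[OF that(2), of f x] by simp
  have d2: "((\<lambda>y. frechet_derivative ?F (at y) b) has_derivative
      (\<lambda>h. \<phi> (f x) * frechet_derivative (partial b) (at x) h + \<eta> (f x) * (gradient f x \<bullet> h) * partial b x)) (at x)"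
    if x: "x \<in> S" and b: "b \<in> Basis" for x b
  proof (rule has_derivative_transform_within_open[OF _ open_S x])
    have "((\<lambda>y. \<phi> (f y)) has_derivative (\<lambda>h. \<eta> (f x) * (gradient f x \<bullet> h))) (at x)"
      using has_derivative_compose[OF derivative[OF x] \<phi>[unfolded has_field_derivative_def]] .
    from has_derivative_mult[OF this partial_derivative[OF x b]]
    show "((\<lambda>y. \<phi> (f y) * partial b y) has_derivative
      (\<lambda>h. \<phi> (f x) * frechet_derivative (partial b) (at x) h + \<eta> (f x) * (gradient f x \<bullet> h) * partial b x)) (at x)" .
  qed (use partial1 b in auto)
  have second: "frechet_derivative (\<lambda>y. frechet_derivative ?F (at y) b) (at x) h =
      \<phi> (f x) * frechet_derivative (partial b) (at x) h + \<eta> (f x) * (gradient f x \<bullet> h) * partial b x"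
    if "x \<in> S" "b \<in> Basis" for x b h
    by (rule fun_cong[OF frechet_derivative_at[OF d2[OF that], symmetric]])
  show "C2_on S ?F"
    unfolding C2_on_def
  proof (intro conjI ballI)
    show "?F differentiable_on S"
      using d1 by (auto simp: differentiable_on_def differentiable_def intro: has_derivative_at_withinI)
    fix b :: 'a assume b: "b \<in> Basis"
    show "(\<lambda>x. frechet_derivative ?F (at x) b) differentiable_on S"
      using d2[OF _ b] by (auto simp: differentiable_on_def differentiable_def intro: has_derivative_at_withinI)
    fix c :: 'a assume c: "c \<in> Basis"
    have "continuous_on UNIV \<phi>"
      using \<phi> DERIV_continuous by (blast intro: continuous_at_imp_continuous_on)
    then have "continuous_on S (\<lambda>x. \<phi> (f x) * frechet_derivative (partial b) (at x) c
        + \<eta> (f x) * (gradient f x \<bullet> c) * partial b x)"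
      by (intro continuous_intros continuous_on_second b c continuous_on_gradient continuous_on_partial
          continuous_on_compose2[OF _ continuous_on_f, of UNIV \<phi>] continuous_on_compose2[OF \<eta> continuous_on_f]) auto
    then show "continuous_on S (\<lambda>x. frechet_derivative (\<lambda>y. frechet_derivative ?F (at y) b) (at x) c)"
      by (simp add: second b cong: continuous_on_cong_simp)
  qed
  assume x: "x \<in> S"
  have "laplace ?F x = (\<Sum>b\<in>Basis. \<phi> (f x) * frechet_derivative (partial b) (at x) b +
      \<eta> (f x) * ((gradient f x \<bullet> b) * (gradient f x \<bullet> b)))"
    unfolding laplace_def by (intro sum.cong refl) (simp add: second x gradient_inner_Basis)
  also have "\<dots> = \<phi> (f x) * laplace f x + \<eta> (f x) * (gradient f x \<bullet> gradient f x)"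
    by (simp only: sum.distrib sum_distrib_left[symmetric] laplace_def euclidean_inner[symmetric])
  finally show "laplace ?F x = \<eta> (f x) * (norm (gradient f x))\<^sup>2 + \<phi> (f x) * laplace f x"
    by (simp add: dot_square_norm)
qed

end

lemma bregman_nonneg:
  fixes \<Phi> \<phi> :: "real \<Rightarrow> real"
  assumes \<Phi>: "\<And>t. (\<Phi> has_real_derivative \<phi> t) (at t)"
    and \<phi>: "\<And>t. (\<phi> has_real_derivative \<eta> t) (at t)" "\<And>t. 0 \<le> \<eta> t"
  shows "0 \<le> \<Phi> b - \<Phi> a - \<phi> a * (b - a)"
proof -
  have mono: "\<phi> s \<le> \<phi> t" if "s \<le> t" for s t
    using DERIV_nonneg_imp_nondecreasing[OF that, of \<phi>] \<phi> by blast
  show ?thesis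
  proof (cases a b rule: linorder_cases)
    case less
    obtain z where z: "a < z" "z < b" "\<Phi> b - \<Phi> a = (b - a) * \<phi> z"
      using MVT2[OF less, of \<Phi> \<phi>] \<Phi> by blast
    have "(b - a) * \<phi> a \<le> (b - a) * \<phi> z" using z less mono by (intro mult_left_mono) auto
    then show ?thesis using z by (simp add: mult.commute)
  next
    case greater
    obtain z where z: "b < z" "z < a" "\<Phi> a - \<Phi> b = (a - b) * \<phi> z"
      using MVT2[OF greater, of \<Phi> \<phi>] \<Phi> by blast
    have "(a - b) * \<phi> z \<le> (a - b) * \<phi> a" using z greater mono by (intro mult_left_mono) auto
    then show ?thesis using z by (simp add: algebra_simps)
  qed simp
qed

context root_data
begin

text \<open>The two terms of the integrand, with the second derivative \<open>\<eta>\<close> of a convex function, its remainder \<open>F\<close> of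
  first order, and coefficients \<open>c\<close> for the jumps.\<close>

definition stein_density ::
  "(real \<Rightarrow> real) \<Rightarrow> (real \<Rightarrow> real \<Rightarrow> real) \<Rightarrow> ('a \<Rightarrow> real) \<Rightarrow> ('a \<Rightarrow> real) \<Rightarrow> 'a \<Rightarrow> real" where
  "stein_density \<eta> F c u x = \<eta> (u x) * (norm (gradient u x))\<^sup>2 +
     (\<Sum>\<alpha>\<in>Rp. c \<alpha> * (F (u x) (u (reflection \<alpha> x)) / (\<alpha> \<bullet> x)\<^sup>2))"

abbreviation jump_coeff :: "'a \<Rightarrow> real" where "jump_coeff \<alpha> \<equiv> k \<alpha> * (\<alpha> \<bullet> \<alpha>)"

text \<open>The chain rule of the Dunkl Laplacian. The reflection terms of \<open>\<Phi> \<circ> u\<close> differ from \<open>\<phi> (u x)\<close> times those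
  of \<open>u\<close> by the first order remainders of \<open>\<Phi>\<close>.\<close>

lemma dunkl_expr_compose:
  assumes u: "C2_on (ball 0 1) u" and x: "x \<in> ball 0 1"
    and \<Phi>: "\<And>t. (\<Phi> has_real_derivative \<phi> t) (at t)" and \<phi>: "\<And>t. (\<phi> has_real_derivative \<eta> t) (at t)"
    and \<eta>: "continuous_on UNIV \<eta>"
  shows "dunkl_expr (\<lambda>x. \<Phi> (u x)) x = \<phi> (u x) * dunkl_expr u x +
      stein_density \<eta> (\<lambda>a b. \<Phi> b - \<Phi> a - \<phi> a * (b - a)) jump_coeff u x"
proof -
  interpret C2_function "ball 0 1" u using u by unfold_locales auto
  let ?\<sigma> = reflection
  have term_eq: "k \<alpha> * (2 * (\<alpha> \<bullet> (\<phi> (u x) *\<^sub>R gradient u x)) / (\<alpha> \<bullet> x)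
        - (\<alpha> \<bullet> \<alpha>) * (\<Phi> (u x) - \<Phi> (u (?\<sigma> \<alpha> x))) / (\<alpha> \<bullet> x)\<^sup>2) =
      \<phi> (u x) * (k \<alpha> * (2 * (\<alpha> \<bullet> gradient u x) / (\<alpha> \<bullet> x) - (\<alpha> \<bullet> \<alpha>) * (u x - u (?\<sigma> \<alpha> x)) / (\<alpha> \<bullet> x)\<^sup>2)) +
      jump_coeff \<alpha> * ((\<Phi> (u (?\<sigma> \<alpha> x)) - \<Phi> (u x) - \<phi> (u x) * (u (?\<sigma> \<alpha> x) - u x)) / (\<alpha> \<bullet> x)\<^sup>2)" for \<alpha>
    by (simp add: diff_divide_distrib add_divide_distrib algebra_simps)
  show ?thesis
    unfolding dunkl_expr_def stein_density_def compose_C2(2)[OF \<Phi> \<phi> \<eta> x] compose_C2(3)[OF \<Phi> \<phi> \<eta> x] term_eq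
    by (simp add: sum.distrib sum_distrib_left distrib_left)
qed

lemma stein_density_nonneg:
  "(\<And>t. 0 \<le> \<eta> t) \<Longrightarrow> (\<And>a b. 0 \<le> F a b) \<Longrightarrow> (\<And>\<alpha>. \<alpha> \<in> Rp \<Longrightarrow> 0 \<le> c \<alpha>) \<Longrightarrow> 0 \<le> stein_density \<eta> F c u x"
  unfolding stein_density_def by (intro add_nonneg_nonneg mult_nonneg_nonneg sum_nonneg divide_nonneg_nonneg) auto

lemma stein_density_measurable:
  assumes u: "C2_on (ball 0 1) u" and [measurable]: "\<eta> \<in> borel_measurable borel"
    "(\<lambda>(a, b). F a b) \<in> borel_measurable (borel \<Otimes>\<^sub>M borel)"
  shows "(\<lambda>x. indicator (ball 0 1) x * stein_density \<eta> F c u x) \<in> borel_measurable borel"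
proof -
  interpret C2_function "ball 0 1" u using u by unfold_locales auto
  define U where "U x = (if x \<in> ball 0 1 then u x else 0)" for x
  define G where "G x = (if x \<in> ball 0 1 then norm (gradient u x) else 0)" for x
  have [measurable]: "U \<in> borel_measurable borel" "G \<in> borel_measurable borel"
    unfolding U_def[abs_def] G_def[abs_def]
    by (intro borel_measurable_continuous_on_if continuous_intros continuous_on_f continuous_on_gradient; simp)+
  have [measurable]: "(indicator (ball 0 1) :: 'a \<Rightarrow> real) \<in> borel_measurable borel"
    by (intro borel_measurable_indicator) simp
  have "(\<lambda>x. indicator (ball 0 1) x * stein_density \<eta> F c u x) = (\<lambda>x. indicator (ball 0 1) x *
      (\<eta> (U x) * (G x)\<^sup>2 + (\<Sum>\<alpha>\<in>Rp. c \<alpha> * ((\<lambda>(a, b). F a b) (U x, U (reflection \<alpha> x)) / (\<alpha> \<bullet> x)\<^sup>2))))"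
    by (auto simp: fun_eq_iff stein_density_def U_def G_def indicator_def)
  also have "\<dots> \<in> borel_measurable borel" by measurable
  finally show ?thesis .
qed

definition green :: "real \<Rightarrow> 'a \<Rightarrow> real" where
  "green S x = (if x \<noteq> 0 \<and> norm x < S
     then (norm x powr (2 - hom_dim) - S powr (2 - hom_dim)) / (hom_dim - 2) else 0)"

lemma green_nonneg:
  assumes "2 < hom_dim" shows "0 \<le> green S x"
  unfolding green_def using assms
  by (auto intro!: divide_nonneg_nonneg powr_mono2')

lemma green_measurable [measurable]: "green S \<in> borel_measurable borel"
  unfolding green_def[abs_def] by measurable

lemma sphere_mean_tendsto_0:
  assumes f: "continuous_on (ball 0 1) f" and r: "\<And>n. 0 \<le> r n" "\<And>n. r n \<le> S" "S < 1" "r \<longlonglongrightarrow> 0"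
  shows "(\<lambda>n. sphere_mean f (r n)) \<longlonglongrightarrow> f 0 * sphere_mean (\<lambda>_. 1) 0"
proof -
  obtain C where C: "0 \<le> C" "\<And>s x. 0 \<le> s \<Longrightarrow> s \<le> S \<Longrightarrow> \<bar>w (sgn x) * f (s *\<^sub>R sgn x)\<bar> \<le> C"
    using sphere_integrand_bound[OF f \<open>S < 1\<close>] by metis
  have r1: "r n < 1" for n using r(2)[of n] r(3) by simp
  have bnd: "integrable lborel (\<lambda>x::'a. C * indicator (ball 0 1) x)"
    by (intro integrable_mult_right integrable_real_indicator)
      (auto simp: emeasure_bounded_finite[OF bounded_ball, unfolded infinity_ennreal_def])
  have "(\<lambda>n. LINT x|lborel. sphere_integrand f (r n) x) \<longlonglongrightarrow> (LINT x|lborel. sphere_integrand f 0 x)"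
  proof (rule integral_dominated_convergence[OF _ _ bnd])
    show "sphere_integrand f 0 \<in> borel_measurable lborel" "sphere_integrand f (r n) \<in> borel_measurable lborel" for n
      using sphere_integrand_measurable[OF f, of 0] sphere_integrand_measurable[OF f r(1) r1] by simp_all
    show "AE x in lborel. (\<lambda>n. sphere_integrand f (r n) x) \<longlonglongrightarrow> sphere_integrand f 0 x"
    proof (rule AE_I2)
      fix x :: 'a
      have "(\<lambda>n. r n *\<^sub>R sgn x) \<longlonglongrightarrow> 0 *\<^sub>R sgn x" by (intro tendsto_intros r(4))
      moreover have "isCont f 0" using f by (simp add: continuous_on_eq_continuous_at)
      ultimately have "(\<lambda>n. f (r n *\<^sub>R sgn x)) \<longlonglongrightarrow> f (0 *\<^sub>R sgn x)"
        by (intro isCont_tendsto_compose[of _ f]) simp_all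
      then show "(\<lambda>n. sphere_integrand f (r n) x) \<longlonglongrightarrow> sphere_integrand f 0 x"
        unfolding sphere_integrand_def by (intro tendsto_intros)
    qed
    show "AE x in lborel. norm (sphere_integrand f (r n) x) \<le> C * indicator (ball 0 1) x" for n
      using C r(1,2) by (auto simp: sphere_integrand_def indicator_def)
  qed
  then have "(\<lambda>n. sphere_mean f (r n)) \<longlonglongrightarrow> sphere_mean f 0"
    unfolding sphere_mean_def by (intro tendsto_intros)
  also have "sphere_mean f 0 = f 0 * sphere_mean (\<lambda>_. 1) 0"
  proof -
    have "sphere_integrand f 0 x = f 0 * sphere_integrand (\<lambda>_. 1) 0 x" for x
      by (simp add: sphere_integrand_def)
    then show ?thesis by (simp add: sphere_mean_def)
  qed
  finally show ?thesis .
qed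

text \<open>The Green identity for \<open>\<Phi> \<circ> u\<close>, with the truncation at the pole removed by monotone convergence. On the
  right, \<open>sphere_mean (\<lambda>_. 1) 0\<close> is the total mass of the weighted sphere.\<close>

lemma nn_integral_green_compose:
  assumes dim: "2 < hom_dim" and u: "C2_on (ball 0 1) u"
    and harmonic: "\<And>x. x \<in> ball 0 1 \<Longrightarrow> x \<in> regular \<Longrightarrow> dunkl_expr u x = 0"
    and \<Phi>: "\<And>t. (\<Phi> has_real_derivative \<phi> t) (at t)" and \<phi>: "\<And>t. (\<phi> has_real_derivative \<eta> t) (at t)"
    and \<eta>: "continuous_on UNIV \<eta>" "\<And>t. 0 \<le> \<eta> t"
    and S: "0 < S" "S < 1"
  defines "H \<equiv> stein_density \<eta> (\<lambda>a b. \<Phi> b - \<Phi> a - \<phi> a * (b - a)) jump_coeff u"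
  shows "(\<integral>\<^sup>+x. ennreal (green S x * (w x * H x)) \<partial>lborel) =
      ennreal (sphere_mean (\<lambda>x. \<Phi> (u x)) S - \<Phi> (u 0) * sphere_mean (\<lambda>_. 1) 0)"
proof -
  interpret C2_function "ball 0 1" u using u by unfold_locales auto
  let ?f = "\<lambda>x. \<Phi> (u x)"
  have f: "C2_on (ball 0 1) ?f" by (rule compose_C2(1)[OF \<Phi> \<phi> \<eta>(1)])
  interpret F: C2_function "ball 0 1" ?f using f by unfold_locales auto
  have H_nonneg: "0 \<le> H x" for x unfolding H_def
    using \<eta>(2) bregman_nonneg[OF \<Phi> \<phi> \<eta>(2)] Rp_k_nonneg by (intro stein_density_nonneg) auto
  have expr: "dunkl_expr ?f x = H x" if "x \<in> ball 0 1" "x \<in> regular" for x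
    using dunkl_expr_compose[OF u that(1) \<Phi> \<phi> \<eta>(1)] harmonic[OF that] by (simp add: H_def)
  define r where "r n = S / real (n + 2)" for n
  have r: "0 < r n" "r n < S" for n using S by (auto simp: r_def divide_less_eq)
  have r0: "r \<longlonglongrightarrow> 0"
    unfolding r_def[abs_def] using LIMSEQ_ignore_initial_segment[OF lim_const_over_n[of S], of 2] by simp
  have anti: "r n \<le> r m" if "m \<le> n" for m n
    using that S by (auto simp: r_def intro!: divide_left_mono)
  \<comment> \<open>The set on which \<open>dunkl_expr\<close> is known and the truncated Green functions converge to \<open>green S\<close>.\<close>
  define J where "J = regular \<inter> ball 0 1 - {0}"
  have J_AE: "AE x in lborel. x \<in> ball 0 1 \<longrightarrow> x \<in> J"
    using AE_regular AE_lborel_negligible[OF negligible_sing[of 0]]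
    by eventually_elim (auto simp: J_def)
  have [measurable]: "J \<in> sets borel" unfolding J_def
    using open_regular by (intro sets.Diff sets.Int) auto
  have tg_nonneg: "0 \<le> truncated_green (r n) S x" for n x
    unfolding truncated_green_def using r[of n] dim
    by (intro divide_nonneg_nonneg) (auto intro!: powr_mono2')
  have tg_support: "truncated_green (r n) S x = 0" if "S \<le> norm x" for n x
    using that r[of n] by (simp add: truncated_green_def)
  define T where "T n x = ennreal (truncated_green (r n) S x * (w x * dunkl_expr ?f x)) * indicator J x" for n x
  have tg_meas: "(\<lambda>x. truncated_green (r n) S x * (w x * dunkl_expr ?f x)) \<in> borel_measurable lborel" for n
    using green_identity(1)[OF dim f r[of n] S(2)] by (rule borel_measurable_integrable)
  have T_meas: "T n \<in> borel_measurable lborel" for n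
    unfolding T_def[abs_def] using tg_meas by measurable
  have T_int: "integral\<^sup>N lborel (T n) = ennreal (sphere_mean ?f S - sphere_mean ?f (r n))" for n
  proof -
    have nn: "AE x in lborel. 0 \<le> truncated_green (r n) S x * (w x * dunkl_expr ?f x)"
      using J_AE
    proof eventually_elim
      case (elim x)
      show ?case
      proof (cases "norm x < S")
        case True
        then have "x \<in> J" using elim S by simp
        then show ?thesis using expr[of x] H_nonneg[of x] tg_nonneg[of n x] by (simp add: J_def)
      qed (use tg_support in simp)
    qed
    have "integral\<^sup>N lborel (T n) = (\<integral>\<^sup>+x. ennreal (truncated_green (r n) S x * (w x * dunkl_expr ?f x)) \<partial>lborel)"
    proof (rule nn_integral_cong_AE, use J_AE in eventually_elim)
      fix x assume "x \<in> ball 0 1 \<longrightarrow> x \<in> J"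
      then show "T n x = ennreal (truncated_green (r n) S x * (w x * dunkl_expr ?f x))"
        using tg_support[of x n] S by (cases "norm x < S") (auto simp: T_def)
    qed
    also have "\<dots> = ennreal (LINT x|lborel. truncated_green (r n) S x * (w x * dunkl_expr ?f x))"
      by (rule nn_integral_eq_integral[OF green_identity(1)[OF dim f r[of n] S(2)] nn])
    finally show ?thesis by (simp add: green_identity(2)[OF dim f r[of n] S(2)])
  qed
  have "(\<lambda>n. integral\<^sup>N lborel (T n)) \<longlonglongrightarrow> (\<integral>\<^sup>+x. ennreal (green S x * (w x * H x)) * indicator J x \<partial>lborel)"
  proof (rule nn_integral_LIMSEQ[OF _ T_meas])
    show "incseq T"
    proof (intro incseq_SucI le_funI)
      fix n x
      have "truncated_green (r n) S x \<le> truncated_green (r (Suc n)) S x"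
        unfolding truncated_green_def using r[of n] r[of "Suc n"] anti[of n "Suc n"] dim
        by (intro divide_right_mono diff_right_mono powr_mono2') auto
      then have "truncated_green (r n) S x * (w x * H x) \<le> truncated_green (r (Suc n)) S x * (w x * H x)"
        using H_nonneg by (intro mult_right_mono) auto
      then show "T n x \<le> T (Suc n) x"
        unfolding T_def using expr[of x] by (auto simp: indicator_def J_def intro: ennreal_leI)
    qed
    fix x
    show "(\<lambda>n. T n x) \<longlonglongrightarrow> ennreal (green S x * (w x * H x)) * indicator J x"
    proof (cases "x \<in> J")
      case True
      then have x: "0 < norm x" "x \<in> ball 0 1" "x \<in> regular" by (auto simp: J_def)
      have "eventually (\<lambda>n. r n < norm x) sequentially"
        using order_tendstoD(2)[OF r0 x(1)] .
      then have "eventually (\<lambda>n. T n x = ennreal (green S x * (w x * H x)) * indicator J x) sequentially"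
      proof eventually_elim
        case (elim n)
        have "truncated_green (r n) S x = green S x"
        proof (cases "norm x < S")
          case False
          then show ?thesis using tg_support[of x n] by (simp add: green_def)
        qed (use elim x in \<open>simp add: truncated_green_def green_def\<close>)
        then show ?case using expr[OF x(2,3)] by (simp add: T_def)
      qed
      then show ?thesis by (rule tendsto_eventually)
    qed (simp add: T_def)
  qed
  moreover have "(\<lambda>n. integral\<^sup>N lborel (T n)) \<longlonglongrightarrow>
      ennreal (sphere_mean ?f S - \<Phi> (u 0) * sphere_mean (\<lambda>_. 1) 0)"
    unfolding T_int
    by (intro tendsto_ennrealI tendsto_diff tendsto_const
        sphere_mean_tendsto_0[where f = ?f and S = S, simplified] F.continuous_on_f r0 S(2))
      (use r in \<open>auto simp: less_imp_le\<close>)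
  ultimately have "(\<integral>\<^sup>+x. ennreal (green S x * (w x * H x)) * indicator J x \<partial>lborel) =
      ennreal (sphere_mean ?f S - \<Phi> (u 0) * sphere_mean (\<lambda>_. 1) 0)"
    using LIMSEQ_unique by blast
  moreover have "(\<integral>\<^sup>+x. ennreal (green S x * (w x * H x)) * indicator J x \<partial>lborel) =
      (\<integral>\<^sup>+x. ennreal (green S x * (w x * H x)) \<partial>lborel)"
  proof (rule nn_integral_cong_AE, use J_AE in eventually_elim)
    fix x assume "x \<in> ball 0 1 \<longrightarrow> x \<in> J"
    then show "ennreal (green S x * (w x * H x)) * indicator J x = ennreal (green S x * (w x * H x))"
      using S by (cases "x \<in> ball 0 1") (auto simp: green_def)
  qed
  ultimately show ?thesis by simp
qed

end

section \<open>Powers of the absolute value\<close>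

lemma has_real_derivative_powr_within:
  assumes q: "1 \<le> q" and s: "0 \<le> s"
  shows "((\<lambda>s. s powr q) has_real_derivative q * rpow s (q - 1)) (at s within {0..})"
proof (cases "s = 0")
  case False
  then have "((\<lambda>s. s powr q) has_real_derivative q * s powr (q - 1)) (at s)"
    using s by (intro has_real_derivative_powr) auto
  then show ?thesis using False s by (auto simp: rpow_pos intro: DERIV_subset)
next
  case True
  have "continuous_on UNIV (\<lambda>y::real. rpow \<bar>y\<bar> (q - 1))"
    using q by (intro continuous_on_rpow_abs continuous_intros) auto
  then have "((\<lambda>y. rpow \<bar>y\<bar> (q - 1)) \<longlongrightarrow> rpow \<bar>0\<bar> (q - 1)) (at 0 within {0..})"
    by (meson UNIV_I continuous_on_def subset_UNIV tendsto_within_subset)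
  moreover have "rpow \<bar>0\<bar> (q - 1) = q * rpow 0 (q - 1)" by (simp add: rpow_def)
  ultimately have "((\<lambda>y. rpow \<bar>y\<bar> (q - 1)) \<longlongrightarrow> q * rpow 0 (q - 1)) (at 0 within {0..})" by (simp only:)
  moreover have "eventually (\<lambda>y. rpow \<bar>y\<bar> (q - 1) = (y powr q - 0 powr q) / (y - 0)) (at 0 within {0..})"
  proof -
    have "rpow \<bar>y\<bar> (q - 1) = (y powr q - 0 powr q) / (y - 0)" if "0 < y" for y
      using that by (simp add: rpow_pos powr_diff)
    then show ?thesis by (auto simp: eventually_at_filter intro!: always_eventually)
  qed
  ultimately show ?thesis unfolding True has_field_derivative_iff by (rule Lim_transform_eventually)
qed

lemma filterlim_abs_at_0: "filterlim (\<lambda>t::real. \<bar>t\<bar>) (at 0 within {0..}) (at 0)"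
proof -
  have "((\<lambda>t::real. \<bar>t\<bar>) \<longlongrightarrow> 0) (at 0)" using tendsto_rabs[of "\<lambda>t. t" 0 "at 0"] by simp
  then show ?thesis by (auto simp: filterlim_at eventually_at_filter)
qed

lemma even_extension_derivative:
  fixes h A :: "real \<Rightarrow> real"
  assumes h: "\<And>s. 0 \<le> s \<Longrightarrow> (h has_real_derivative A s) (at s within {0..})" and A0: "A 0 = 0"
  shows "((\<lambda>t. h \<bar>t\<bar>) has_real_derivative sgn t * A \<bar>t\<bar>) (at t)"
proof -
  have pos: "(h has_real_derivative A s) (at s)" if "0 < s" for s
    proof -
    have "at s within {0..} = at s"
      by (rule at_within_interior) (use that in \<open>simp add: interior_real_atLeast\<close>)
    then show ?thesis using h[of s] that by simp
  qed
  consider "0 < t" | "t < 0" | "t = 0" by linarith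
  then show ?thesis
  proof cases
    case 1
    have "(h has_real_derivative sgn t * A \<bar>t\<bar>) (at t)" using pos[OF 1] 1 by simp
    then show ?thesis
      by (rule has_field_derivative_transform_within_open[where S = "{0<..}"]) (use 1 in auto)
  next
    case 2
    have "((\<lambda>t. h (- t)) has_real_derivative A (- t) * (- 1)) (at t)"
      by (rule DERIV_chain2[of h]) (use pos[of "- t"] 2 in \<open>auto intro!: derivative_eq_intros\<close>)
    then have "((\<lambda>t. h (- t)) has_real_derivative sgn t * A \<bar>t\<bar>) (at t)" using 2 by simp
    then show ?thesis
      by (rule has_field_derivative_transform_within_open[where S = "{..<0}"]) (use 2 in auto)
  next
    case 3
    have "((\<lambda>s. (h s - h 0) / (s - 0)) \<longlongrightarrow> 0) (at 0 within {0..})"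
      using h[of 0] A0 by (simp add: has_field_derivative_iff)
    from filterlim_compose[OF this filterlim_abs_at_0]
    have "((\<lambda>t. (h \<bar>t\<bar> - h 0) / \<bar>t\<bar>) \<longlongrightarrow> 0) (at 0)" by simp
    then have "((\<lambda>t. \<bar>(h \<bar>t\<bar> - h 0) / t\<bar>) \<longlongrightarrow> 0) (at 0)"
      by (drule_tac tendsto_rabs_zero) (simp add: abs_divide)
    then have "((\<lambda>t. (h \<bar>t\<bar> - h 0) / t) \<longlongrightarrow> 0) (at 0)"
      by (simp only: tendsto_rabs_zero_iff)
    then show ?thesis using 3 by (simp add: has_field_derivative_iff)
  qed
qed

lemma odd_extension_derivative:
  fixes A B :: "real \<Rightarrow> real"
  assumes A: "\<And>s. 0 \<le> s \<Longrightarrow> (A has_real_derivative B s) (at s within {0..})" and A0: "A 0 = 0"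
  shows "((\<lambda>t. sgn t * A \<bar>t\<bar>) has_real_derivative B \<bar>t\<bar>) (at t)"
proof -
  have pos: "(A has_real_derivative B s) (at s)" if "0 < s" for s
    proof -
    have "at s within {0..} = at s"
      by (rule at_within_interior) (use that in \<open>simp add: interior_real_atLeast\<close>)
    then show ?thesis using A[of s] that by simp
  qed
  consider "0 < t" | "t < 0" | "t = 0" by linarith
  then show ?thesis
  proof cases
    case 1
    then have "(A has_real_derivative B \<bar>t\<bar>) (at t)" using pos by simp
    then show ?thesis
      by (rule has_field_derivative_transform_within_open[where S = "{0<..}"]) (use 1 in auto)
  next
    case 2
    have "((\<lambda>t. A (- t)) has_real_derivative B (- t) * (- 1)) (at t)"
      by (rule DERIV_chain2[of A]) (use pos[of "- t"] 2 in \<open>auto intro!: derivative_eq_intros\<close>)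
    from DERIV_minus[OF this] have "((\<lambda>t. - A (- t)) has_real_derivative B \<bar>t\<bar>) (at t)" using 2 by simp
    then show ?thesis
      by (rule has_field_derivative_transform_within_open[where S = "{..<0}"]) (use 2 in auto)
  next
    case 3
    have "((\<lambda>s. (A s - A 0) / (s - 0)) \<longlongrightarrow> B 0) (at 0 within {0..})"
      using A[of 0] by (simp add: has_field_derivative_iff)
    from filterlim_compose[OF this filterlim_abs_at_0]
    have "((\<lambda>t. A \<bar>t\<bar> / \<bar>t\<bar>) \<longlongrightarrow> B 0) (at 0)" using A0 by simp
    moreover have "(\<lambda>t. A \<bar>t\<bar> / \<bar>t\<bar>) = (\<lambda>t. sgn t * A \<bar>t\<bar> / t)"
      by (auto simp: fun_eq_iff sgn_if)
    ultimately show ?thesis using 3 by (simp add: has_field_derivative_iff)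
  qed
qed

text \<open>The derivative \<open>p * a * \<bar>a\<bar> powr (p - 2)\<close> in a form that is continuous at \<open>a = 0\<close>, which absorbs the separate case.\<close>

lemma bregman_F_eq:
  "1 < p \<Longrightarrow> bregman_F p a b = \<bar>b\<bar> powr p - \<bar>a\<bar> powr p - (sgn a * (p * \<bar>a\<bar> powr (p - 1))) * (b - a)"
proof (cases "a = 0")
  case False
  assume "1 < p"
  have "\<bar>a\<bar> powr (p - 1) = \<bar>a\<bar> * \<bar>a\<bar> powr (p - 2)"
    using powr_mult_base[of "\<bar>a\<bar>" "p - 2"] by simp
  then have "sgn a * (p * \<bar>a\<bar> powr (p - 1)) = p * a * \<bar>a\<bar> powr (p - 2)"
    by (simp add: sgn_mult_abs mult.assoc[symmetric])
  then show ?thesis using False by (auto simp: bregman_F_def)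
qed (simp add: bregman_F_def)

definition power_second :: "real \<Rightarrow> real \<Rightarrow> real" where
  "power_second p t = p * (p - 1) * rpow \<bar>t\<bar> (p - 2)"

lemma power_derivatives:
  assumes "2 \<le> p"
  shows "((\<lambda>t. \<bar>t\<bar> powr p) has_real_derivative sgn t * (p * \<bar>t\<bar> powr (p - 1))) (at t)"
    and "((\<lambda>t. sgn t * (p * \<bar>t\<bar> powr (p - 1))) has_real_derivative power_second p t) (at t)"
    and "continuous_on UNIV (power_second p)"
proof -
  show "((\<lambda>t. \<bar>t\<bar> powr p) has_real_derivative sgn t * (p * \<bar>t\<bar> powr (p - 1))) (at t)"
    using has_real_derivative_powr_within[of p] assms
    by (intro even_extension_derivative[where h = "\<lambda>s. s powr p" and A = "\<lambda>s. p * s powr (p - 1)"])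
      (auto simp: rpow_def)
  show "((\<lambda>t. sgn t * (p * \<bar>t\<bar> powr (p - 1))) has_real_derivative power_second p t) (at t)"
    unfolding power_second_def
  proof (rule odd_extension_derivative[where A = "\<lambda>s. p * s powr (p - 1)" and B = "\<lambda>s. p * (p - 1) * rpow s (p - 2)"])
    fix s :: real assume "0 \<le> s"
    from DERIV_cmult[OF has_real_derivative_powr_within[OF _ this, of "p - 1"], of p]
    show "((\<lambda>s. p * s powr (p - 1)) has_real_derivative p * (p - 1) * rpow s (p - 2)) (at s within {0..})"
      using assms by (simp add: mult.assoc)
  qed (use assms in simp)
  show "continuous_on UNIV (power_second p)"
    unfolding power_second_def[abs_def] using assms
    by (intro continuous_intros continuous_on_rpow_abs) auto
qed

lemma power_second_nonneg: "1 < p \<Longrightarrow> 0 \<le> power_second p t"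
  by (simp add: power_second_def)

text \<open>For \<open>p < 2\<close> the second derivative of \<open>\<bar>t\<bar> powr p\<close> is unbounded at \<open>0\<close>. It is the increasing limit, as \<open>\<delta>\<close>
  decreases to \<open>0\<close>, of the continuous functions \<open>p * (p - 1) * s * (s + \<delta>) powr (p - 3)\<close> with \<open>s = \<bar>t\<bar>\<close>. These vanish
  at \<open>t = 0\<close>, in agreement with the value \<open>rpow 0 (p - 2) = 0\<close>, so that the limit holds at every point and
  the zero set of the harmonic function needs no separate treatment.\<close>

definition approx_second :: "real \<Rightarrow> real \<Rightarrow> real \<Rightarrow> real" where
  "approx_second p \<delta> s = p * (p - 1) * ((s + \<delta>) powr (p - 2) - \<delta> * (s + \<delta>) powr (p - 3))"

text \<open>Explicit primitives for \<open>s \<ge> 0\<close>, normalized to vanish at \<open>0\<close>; they extend to the line as an odd and an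
  even function.\<close>

definition approx_first :: "real \<Rightarrow> real \<Rightarrow> real \<Rightarrow> real" where
  "approx_first p \<delta> s = p * (p - 1) * ((s + \<delta>) powr (p - 1) / (p - 1) - \<delta> * (s + \<delta>) powr (p - 2) / (p - 2)
     - \<delta> powr (p - 1) * (1 / (p - 1) - 1 / (p - 2)))"

definition approx_power :: "real \<Rightarrow> real \<Rightarrow> real \<Rightarrow> real" where
  "approx_power p \<delta> s = p * (p - 1) * ((s + \<delta>) powr p / (p * (p - 1)) - \<delta> * (s + \<delta>) powr (p - 1) / ((p - 1) * (p - 2))
     - \<delta> powr (p - 1) * (1 / (p - 1) - 1 / (p - 2)) * s
     - (\<delta> powr p / (p * (p - 1)) - \<delta> * \<delta> powr (p - 1) / ((p - 1) * (p - 2))))"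

context
  fixes p \<delta> :: real
  assumes p: "1 < p" "p < 2" and \<delta>: "0 < \<delta>"
begin

lemma shifted_powr_derivative:
  "0 \<le> s \<Longrightarrow> q' = q - 1 \<Longrightarrow> ((\<lambda>s. (s + \<delta>) powr q) has_real_derivative q * (s + \<delta>) powr q') (at s)"
  using \<delta> by (auto intro!: derivative_eq_intros)

lemma approx_second_eq:
  assumes "0 \<le> s" shows "approx_second p \<delta> s = p * (p - 1) * (s * (s + \<delta>) powr (p - 3))"
proof -
  have "(s + \<delta>) powr (p - 2) = (s + \<delta>) * (s + \<delta>) powr (p - 3)"
    using powr_mult_base[of "s + \<delta>" "p - 3"] assms \<delta> by simp
  then show ?thesis unfolding approx_second_def by (simp add: algebra_simps)
qed

lemma approx_power_derivative:
  "((\<lambda>t. approx_power p \<delta> \<bar>t\<bar>) has_real_derivative sgn t * approx_first p \<delta> \<bar>t\<bar>) (at t)"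
proof (rule even_extension_derivative)
  fix s :: real assume s: "0 \<le> s"
  have "(approx_power p \<delta> has_real_derivative
      p * (p - 1) * (p * (s + \<delta>) powr (p - 1) / (p * (p - 1)) - \<delta> * ((p - 1) * (s + \<delta>) powr (p - 2)) / ((p - 1) * (p - 2))
     - \<delta> powr (p - 1) * (1 / (p - 1) - 1 / (p - 2)) * 1 - 0)) (at s)"
    unfolding approx_power_def[abs_def]
    by (intro DERIV_cmult DERIV_diff DERIV_cdivide DERIV_const DERIV_ident shifted_powr_derivative s) simp_all
  also have "p * (p - 1) * (p * (s + \<delta>) powr (p - 1) / (p * (p - 1)) - \<delta> * ((p - 1) * (s + \<delta>) powr (p - 2)) / ((p - 1) * (p - 2))
     - \<delta> powr (p - 1) * (1 / (p - 1) - 1 / (p - 2)) * 1 - 0) = approx_first p \<delta> s"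
    using p by (simp add: approx_first_def)
  finally show "(approx_power p \<delta> has_real_derivative approx_first p \<delta> s) (at s within {0..})"
    by (rule has_field_derivative_at_within)
next
  have "\<delta> * \<delta> powr (p - 2) = \<delta> powr (p - 1)" using powr_mult_base[of \<delta> "p - 2"] \<delta> by simp
  then show "approx_first p \<delta> 0 = 0" using p by (simp add: approx_first_def right_diff_distrib)
qed

lemma approx_first_derivative:
  "((\<lambda>t. sgn t * approx_first p \<delta> \<bar>t\<bar>) has_real_derivative approx_second p \<delta> \<bar>t\<bar>) (at t)"
proof (rule odd_extension_derivative)
  fix s :: real assume s: "0 \<le> s"
  have "(approx_first p \<delta> has_real_derivative
      p * (p - 1) * ((p - 1) * (s + \<delta>) powr (p - 2) / (p - 1) - \<delta> * ((p - 2) * (s + \<delta>) powr (p - 3)) / (p - 2) - 0)) (at s)"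
    unfolding approx_first_def[abs_def]
    by (intro DERIV_cmult DERIV_diff DERIV_cdivide DERIV_const shifted_powr_derivative s) simp_all
  also have "p * (p - 1) * ((p - 1) * (s + \<delta>) powr (p - 2) / (p - 1) - \<delta> * ((p - 2) * (s + \<delta>) powr (p - 3)) / (p - 2) - 0) =
      approx_second p \<delta> s"
    using p by (simp add: approx_second_def)
  finally show "(approx_first p \<delta> has_real_derivative approx_second p \<delta> s) (at s within {0..})"
    by (rule has_field_derivative_at_within)
next
  have "\<delta> * \<delta> powr (p - 2) = \<delta> powr (p - 1)" using powr_mult_base[of \<delta> "p - 2"] \<delta> by simp
  then show "approx_first p \<delta> 0 = 0" using p by (simp add: approx_first_def right_diff_distrib)
qed

lemma approx_second_nonneg: "0 \<le> approx_second p \<delta> \<bar>t\<bar>"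
  using p by (simp add: approx_second_eq)

lemma approx_second_continuous: "continuous_on UNIV (\<lambda>t. approx_second p \<delta> \<bar>t\<bar>)"
proof -
  have "\<bar>t\<bar> + \<delta> \<noteq> 0" for t :: real using \<delta> by linarith
  then show ?thesis unfolding approx_second_def by (intro continuous_intros) auto
qed

end

definition approx_bregman :: "real \<Rightarrow> real \<Rightarrow> real \<Rightarrow> real \<Rightarrow> real" where
  "approx_bregman p \<delta> a b = approx_power p \<delta> \<bar>b\<bar> - approx_power p \<delta> \<bar>a\<bar> - (sgn a * approx_first p \<delta> \<bar>a\<bar>) * (b - a)"

lemma approx_second_antimono:
  assumes "1 < p" "p < 2" "0 < \<delta>'" "\<delta>' \<le> \<delta>"
  shows "approx_second p \<delta> \<bar>t\<bar> \<le> approx_second p \<delta>' \<bar>t\<bar>"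
  using assms by (auto simp: approx_second_eq intro!: mult_left_mono powr_mono2')

text \<open>The remainder of the difference of two approximations is nonnegative, because this
  difference is convex.\<close>

lemma approx_bregman_antimono:
  assumes "1 < p" "p < 2" "0 < \<delta>'" "\<delta>' \<le> \<delta>"
  shows "approx_bregman p \<delta> a b \<le> approx_bregman p \<delta>' a b"
proof -
  have \<delta>: "0 < \<delta>" using assms by linarith
  define \<Phi> where "\<Phi> t = approx_power p \<delta>' \<bar>t\<bar> - approx_power p \<delta> \<bar>t\<bar>" for t
  define \<phi> where "\<phi> t = sgn t * approx_first p \<delta>' \<bar>t\<bar> - sgn t * approx_first p \<delta> \<bar>t\<bar>" for t
  have d1: "(\<Phi> has_real_derivative \<phi> t) (at t)" for t
    unfolding \<Phi>_def[abs_def] \<phi>_def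
    by (intro DERIV_diff approx_power_derivative assms \<delta>)
  have d2: "(\<phi> has_real_derivative (approx_second p \<delta>' \<bar>t\<bar> - approx_second p \<delta> \<bar>t\<bar>)) (at t)" for t
    unfolding \<phi>_def[abs_def] by (intro DERIV_diff approx_first_derivative assms \<delta>)
  have "0 \<le> \<Phi> b - \<Phi> a - \<phi> a * (b - a)" 
    by (rule bregman_nonneg[OF d1 d2]) (simp add: approx_second_antimono[OF assms])
  then show ?thesis by (simp add: \<Phi>_def \<phi>_def approx_bregman_def algebra_simps)
qed

lemma approx_tendsto:
  assumes p: "1 < p" "p < 2" and e: "\<And>n. 0 < e n" "e \<longlonglongrightarrow> (0::real)"
  shows "(\<lambda>n. approx_second p (e n) \<bar>t\<bar>) \<longlonglongrightarrow> power_second p t"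
    and "(\<lambda>n. sgn t * approx_first p (e n) \<bar>t\<bar>) \<longlonglongrightarrow> sgn t * (p * \<bar>t\<bar> powr (p - 1))"
    and "(\<lambda>n. approx_power p (e n) \<bar>t\<bar>) \<longlonglongrightarrow> \<bar>t\<bar> powr p"
    and "(\<lambda>n. approx_bregman p (e n) a b) \<longlonglongrightarrow> bregman_F p a b"
proof -
  have pos: "(\<lambda>n. (\<bar>t\<bar> + e n) powr q) \<longlonglongrightarrow> \<bar>t\<bar> powr q" if "0 < q" for q t :: real
  proof -
    have "(\<lambda>n. (\<bar>t\<bar> + e n) powr q) \<longlonglongrightarrow> (\<bar>t\<bar> + 0) powr q"
      using that e(1) by (intro tendsto_powr' tendsto_intros e(2)) (auto intro!: always_eventually add_nonneg_nonneg less_imp_le)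
    then show ?thesis by simp
  qed
  have any: "(\<lambda>n. (\<bar>t\<bar> + e n) powr q) \<longlonglongrightarrow> \<bar>t\<bar> powr q" if "t \<noteq> 0" for q t :: real
  proof -
    have "(\<lambda>n. (\<bar>t\<bar> + e n) powr q) \<longlonglongrightarrow> (\<bar>t\<bar> + 0) powr q"
      using that by (intro tendsto_powr tendsto_intros e(2)) auto
    then show ?thesis by simp
  qed
  have e_pow: "(\<lambda>n. e n powr q) \<longlonglongrightarrow> 0" if "0 < q" for q
    using pos[OF that, of 0] by simp
  show "(\<lambda>n. approx_second p (e n) \<bar>t\<bar>) \<longlonglongrightarrow> power_second p t" for t
  proof (cases "t = 0")
    case True
    then show ?thesis using p by (simp add: approx_second_eq e power_second_def rpow_def)
  next
    case False
    have "(\<lambda>n. p * (p - 1) * (\<bar>t\<bar> * (\<bar>t\<bar> + e n) powr (p - 3))) \<longlonglongrightarrow> p * (p - 1) * (\<bar>t\<bar> * \<bar>t\<bar> powr (p - 3))"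
      by (intro tendsto_intros any False)
    moreover have "\<bar>t\<bar> * \<bar>t\<bar> powr (p - 3) = rpow \<bar>t\<bar> (p - 2)"
      using False powr_mult_base[of "\<bar>t\<bar>" "p - 3"] by (simp add: rpow_pos)
    ultimately show ?thesis using p by (simp add: approx_second_eq e power_second_def)
  qed
  show first: "(\<lambda>n. sgn t * approx_first p (e n) \<bar>t\<bar>) \<longlonglongrightarrow> sgn t * (p * \<bar>t\<bar> powr (p - 1))" for t
  proof (cases "t = 0")
    case False
    have "(\<lambda>n. approx_first p (e n) \<bar>t\<bar>) \<longlonglongrightarrow> p * (p - 1) * (\<bar>t\<bar> powr (p - 1) / (p - 1)
        - 0 * \<bar>t\<bar> powr (p - 2) / (p - 2) - 0 * (1 / (p - 1) - 1 / (p - 2)))"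
      unfolding approx_first_def using p by (intro tendsto_intros pos any False e e_pow) auto
    also have "p * (p - 1) * (\<bar>t\<bar> powr (p - 1) / (p - 1)
        - 0 * \<bar>t\<bar> powr (p - 2) / (p - 2) - 0 * (1 / (p - 1) - 1 / (p - 2))) = p * \<bar>t\<bar> powr (p - 1)"
      using p by simp
    finally show ?thesis by (intro tendsto_intros)
  qed simp
  show power: "(\<lambda>n. approx_power p (e n) \<bar>t\<bar>) \<longlonglongrightarrow> \<bar>t\<bar> powr p" for t
  proof -
    have "(\<lambda>n. approx_power p (e n) \<bar>t\<bar>) \<longlonglongrightarrow> p * (p - 1) * (\<bar>t\<bar> powr p / (p * (p - 1))
        - 0 * \<bar>t\<bar> powr (p - 1) / ((p - 1) * (p - 2)) - 0 * (1 / (p - 1) - 1 / (p - 2)) * \<bar>t\<bar>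
        - (0 / (p * (p - 1)) - 0 * 0 / ((p - 1) * (p - 2))))"
      unfolding approx_power_def using p by (intro tendsto_intros pos e e_pow) auto
    then show ?thesis using p by simp
  qed
  show "(\<lambda>n. approx_bregman p (e n) a b) \<longlonglongrightarrow> bregman_F p a b"
    unfolding approx_bregman_def bregman_F_eq[OF p(1)] by (intro tendsto_intros first power)
qed

lemma approx_power_bounds:
  assumes p: "1 < p" "p < 2" and \<delta>: "0 < \<delta>"
  shows "0 \<le> approx_power p \<delta> \<bar>b\<bar>" "approx_power p \<delta> \<bar>b\<bar> \<le> \<bar>b\<bar> powr p"
proof -
  have eq: "approx_bregman p d 0 b = approx_power p d \<bar>b\<bar>" for d
    by (simp add: approx_bregman_def approx_power_def)
  show "0 \<le> approx_power p \<delta> \<bar>b\<bar>"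
    using bregman_nonneg[OF approx_power_derivative[OF p \<delta>] approx_first_derivative[OF p \<delta>] approx_second_nonneg[OF p \<delta>],
        of b 0] eq by (simp add: approx_bregman_def)
  define e where "e n = \<delta> / real (Suc n)" for n
  have e: "0 < e n" for n using \<delta> by (simp add: e_def)
  have e0: "e \<longlonglongrightarrow> 0"
    unfolding e_def[abs_def] using LIMSEQ_ignore_initial_segment[OF lim_const_over_n[of \<delta>], of 1] by simp
  have "approx_bregman p \<delta> 0 b \<le> bregman_F p 0 b"
  proof (rule LIMSEQ_le_const[OF approx_tendsto(4)[OF p e e0]])
    show "\<exists>N. \<forall>n\<ge>N. approx_bregman p \<delta> 0 b \<le> approx_bregman p (e n) 0 b"
      using \<delta> by (intro exI[of _ 0] allI impI approx_bregman_antimono p e)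
        (auto simp: e_def divide_le_eq mult_le_cancel_left1)
  qed
  then show "approx_power p \<delta> \<bar>b\<bar> \<le> \<bar>b\<bar> powr p" by (simp add: eq bregman_F_def)
qed

lemma bregman_F_nonneg:
  assumes p: "1 < p" shows "0 \<le> bregman_F p a b"
proof (cases "2 \<le> p")
  case True
  from bregman_nonneg[OF power_derivatives(1,2)[OF True] power_second_nonneg[OF p]] show ?thesis by (simp add: bregman_F_eq p)
next
  case False
  then have p2: "p < 2" by simp
  define e where "e n = 1 / real (Suc n)" for n
  have e: "0 < e n" for n by (simp add: e_def)
  have e0: "e \<longlonglongrightarrow> 0" using LIMSEQ_inverse_real_of_nat unfolding e_def[abs_def] inverse_eq_divide .
  show ?thesis
  proof (rule LIMSEQ_le_const[OF approx_tendsto(4)[OF p p2 e e0]])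
    show "\<exists>N. \<forall>n\<ge>N. 0 \<le> approx_bregman p (e n) a b"
      using bregman_nonneg[OF approx_power_derivative[OF p p2 e] approx_first_derivative[OF p p2 e]
          approx_second_nonneg[OF p p2 e]]
      by (intro exI[of _ 0]) (simp add: approx_bregman_def)
  qed
qed

lemma bregman_F_measurable: "1 < p \<Longrightarrow> (\<lambda>(a, b). bregman_F p a b) \<in> borel_measurable (borel \<Otimes>\<^sub>M borel)"
  by (simp add: bregman_F_eq)

lemma power_second_measurable [measurable]: "power_second p \<in> borel_measurable borel"
  unfolding power_second_def[abs_def] rpow_def by measurable

section \<open>The Hardy--Stein identity on smaller balls\<close>

context root_data
begin

definition stein :: "real \<Rightarrow> ('a \<Rightarrow> real) \<Rightarrow> ('a \<Rightarrow> real) \<Rightarrow> 'a \<Rightarrow> real" where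
  "stein p c u = stein_density (power_second p) (bregman_F p) c u"

lemma green_stein_measurable:
  assumes u: "C2_on (ball 0 1) u" and S: "S \<le> 1"
    and [measurable]: "\<eta> \<in> borel_measurable borel" "(\<lambda>(a, b). F a b) \<in> borel_measurable (borel \<Otimes>\<^sub>M borel)"
  shows "(\<lambda>x. green S x * (w x * stein_density \<eta> F c u x)) \<in> borel_measurable borel"
proof -
  have [measurable]: "(\<lambda>x. indicator (ball 0 1) x * stein_density \<eta> F c u x) \<in> borel_measurable borel"
    by (rule stein_density_measurable[OF u]) measurable
  have "(\<lambda>x. green S x * (w x * stein_density \<eta> F c u x)) =
      (\<lambda>x. green S x * (w x * (indicator (ball 0 1) x * stein_density \<eta> F c u x)))"
    using S by (auto simp: fun_eq_iff green_def indicator_def)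
  also have "\<dots> \<in> borel_measurable borel" by measurable
  finally show ?thesis .
qed

text \<open>For \<open>p \<ge> 2\<close> the Green identity applies to the power itself, for \<open>p < 2\<close> to the approximations. The
  densities increase to the one of the power, and the spherical means converge by domination.\<close>

lemma nn_integral_green_power:
  assumes dim: "2 < hom_dim" and p: "1 < p" and u: "C2_on (ball 0 1) u"
    and harmonic: "\<And>x. x \<in> ball 0 1 \<Longrightarrow> x \<in> regular \<Longrightarrow> dunkl_expr u x = 0"
    and S: "0 < S" "S < 1"
  shows "(\<integral>\<^sup>+x. ennreal (green S x * (w x * stein p jump_coeff u x)) \<partial>lborel) =
      ennreal (sphere_mean (\<lambda>x. \<bar>u x\<bar> powr p) S - \<bar>u 0\<bar> powr p * sphere_mean (\<lambda>_. 1) 0)"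
proof (cases "2 \<le> p")
  case True
  have "bregman_F p = (\<lambda>a b. \<bar>b\<bar> powr p - \<bar>a\<bar> powr p - (sgn a * (p * \<bar>a\<bar> powr (p - 1))) * (b - a))"
    by (intro ext bregman_F_eq p)
  then show ?thesis
    unfolding stein_def
    using nn_integral_green_compose[OF dim u harmonic power_derivatives[OF True] power_second_nonneg[OF p] S]
    by simp
next
  case False
  then have p2: "p < 2" by simp
  interpret C2_function "ball 0 1" u using u by unfold_locales auto
  define e where "e n = 1 / real (Suc n)" for n
  have e: "0 < e n" for n by (simp add: e_def)
  have e0: "e \<longlonglongrightarrow> 0" using LIMSEQ_inverse_real_of_nat unfolding e_def[abs_def] inverse_eq_divide .
  have e_anti: "e (Suc n) \<le> e n" for n by (simp add: e_def divide_left_mono)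
  let ?\<eta> = "\<lambda>n t. approx_second p (e n) \<bar>t\<bar>"
  let ?F = "\<lambda>n. approx_bregman p (e n)"
  define H where "H n = stein_density (?\<eta> n) (?F n) jump_coeff u" for n
  define T where "T n x = ennreal (green S x * (w x * H n x))" for n x
  have T_int: "integral\<^sup>N lborel (T n) =
      ennreal (sphere_mean (\<lambda>x. approx_power p (e n) \<bar>u x\<bar>) S - approx_power p (e n) \<bar>u 0\<bar> * sphere_mean (\<lambda>_. 1) 0)" for n
    unfolding T_def[abs_def] H_def approx_bregman_def[abs_def]
    by (rule nn_integral_green_compose[OF dim u harmonic approx_power_derivative[OF p p2 e]
          approx_first_derivative[OF p p2 e] approx_second_continuous[OF p p2 e] approx_second_nonneg[OF p p2 e] S])
  have cont_power: "continuous_on UNIV (\<lambda>t. approx_power p (e n) \<bar>t\<bar>)" for n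
    using approx_power_derivative[OF p p2 e] DERIV_continuous by (blast intro: continuous_at_imp_continuous_on)
  have cont_first: "continuous_on UNIV (\<lambda>t. sgn t * approx_first p (e n) \<bar>t\<bar>)" for n
    using approx_first_derivative[OF p p2 e] DERIV_continuous by (blast intro: continuous_at_imp_continuous_on)
  have [measurable]: "(\<lambda>t. approx_power p (e n) \<bar>t\<bar>) \<in> borel_measurable borel"
    "(\<lambda>t. sgn t * approx_first p (e n) \<bar>t\<bar>) \<in> borel_measurable borel"
    "?\<eta> n \<in> borel_measurable borel" for n
    using cont_power cont_first approx_second_continuous[OF p p2 e] by (auto intro: borel_measurable_continuous_onI)
  have T_meas: "T n \<in> borel_measurable lborel" for n
  proof -
    have "(\<lambda>(a, b). ?F n a b) \<in> borel_measurable (borel \<Otimes>\<^sub>M borel)"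
      unfolding approx_bregman_def by measurable
    then have "(\<lambda>x. green S x * (w x * H n x)) \<in> borel_measurable borel"
      unfolding H_def using S by (intro green_stein_measurable u) auto
    then show ?thesis unfolding T_def[abs_def] by measurable
  qed
  have jump: "0 \<le> jump_coeff \<alpha>" if "\<alpha> \<in> Rp" for \<alpha> using Rp_k_nonneg[OF that] by simp
  have "(\<lambda>n. integral\<^sup>N lborel (T n)) \<longlonglongrightarrow> (\<integral>\<^sup>+x. ennreal (green S x * (w x * stein p jump_coeff u x)) \<partial>lborel)"
  proof (rule nn_integral_LIMSEQ[OF _ T_meas])
    show "incseq T"
    proof (intro incseq_SucI le_funI)
      fix n x
      have "H n x \<le> H (Suc n) x"
        unfolding H_def stein_density_def
        using approx_second_antimono[OF p p2 e e_anti] approx_bregman_antimono[OF p p2 e e_anti] jump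
        by (intro add_mono mult_right_mono sum_mono mult_left_mono divide_right_mono) auto
      then show "T n x \<le> T (Suc n) x"
        unfolding T_def by (intro ennreal_leI mult_left_mono green_nonneg dim weight_nonneg)
    qed
    show "(\<lambda>n. T n x) \<longlonglongrightarrow> ennreal (green S x * (w x * stein p jump_coeff u x))" for x
    proof -
      have "(\<lambda>n. H n x) \<longlonglongrightarrow> stein p jump_coeff u x"
        unfolding H_def stein_def stein_density_def divide_inverse
        by (intro tendsto_intros approx_tendsto p p2 e e0)
      then show ?thesis unfolding T_def by (intro tendsto_ennrealI tendsto_intros)
    qed
  qed
  moreover have "(\<lambda>n. integral\<^sup>N lborel (T n)) \<longlonglongrightarrow>
      ennreal (sphere_mean (\<lambda>x. \<bar>u x\<bar> powr p) S - \<bar>u 0\<bar> powr p * sphere_mean (\<lambda>_. 1) 0)"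
  proof -
    have cont: "continuous_on (ball 0 1) (\<lambda>x. \<bar>u x\<bar> powr p)"
      using p by (intro continuous_on_powr' continuous_intros continuous_on_f) auto
    have cont_n: "continuous_on (ball 0 1) (\<lambda>x. approx_power p (e n) \<bar>u x\<bar>)" for n
      using continuous_on_compose2[OF cont_power continuous_on_f] by auto
    have "(\<lambda>n. LINT x|lborel. sphere_integrand (\<lambda>x. approx_power p (e n) \<bar>u x\<bar>) S x) \<longlonglongrightarrow>
        (LINT x|lborel. sphere_integrand (\<lambda>x. \<bar>u x\<bar> powr p) S x)"
    proof (rule integral_dominated_convergence)
      show "integrable lborel (sphere_integrand (\<lambda>x. \<bar>u x\<bar> powr p) S)"
        using S by (intro sphere_integrand_integrable cont) auto
      show "sphere_integrand (\<lambda>x. \<bar>u x\<bar> powr p) S \<in> borel_measurable lborel"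
        using sphere_integrand_measurable[OF cont, of S] S by simp
      show "sphere_integrand (\<lambda>x. approx_power p (e n) \<bar>u x\<bar>) S \<in> borel_measurable lborel" for n
        using sphere_integrand_measurable[OF cont_n, of S] S by simp
      show "AE x in lborel. (\<lambda>n. sphere_integrand (\<lambda>x. approx_power p (e n) \<bar>u x\<bar>) S x) \<longlonglongrightarrow>
          sphere_integrand (\<lambda>x. \<bar>u x\<bar> powr p) S x"
        unfolding sphere_integrand_def by (intro AE_I2 tendsto_intros approx_tendsto p p2 e e0)
      show "AE x in lborel. norm (sphere_integrand (\<lambda>x. approx_power p (e n) \<bar>u x\<bar>) S x) \<le>
          sphere_integrand (\<lambda>x. \<bar>u x\<bar> powr p) S x" for n
        using approx_power_bounds[OF p p2 e]
        by (intro AE_I2) (auto simp: sphere_integrand_def indicator_def abs_mult intro!: mult_left_mono)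
    qed
    then show ?thesis
      unfolding T_int sphere_mean_def by (intro tendsto_ennrealI tendsto_intros approx_tendsto p p2 e e0)
  qed
  ultimately show ?thesis using LIMSEQ_unique by blast
qed

end

section \<open>The unit ball and the surface measure\<close>

lemma sets_surface_measure:
  "sets (surface_measure :: 'a::euclidean_space measure) = sets (restrict_space borel (sphere 0 1))"
  by (simp add: surface_measure_def)

lemma measurable_surface_measure:
  fixes h :: "'a::euclidean_space \<Rightarrow> real"
  assumes "h \<in> borel_measurable borel" shows "h \<in> borel_measurable surface_measure"
  unfolding measurable_cong_sets[OF sets_surface_measure refl] using assms by (rule measurable_restrict_space1)

lemma nn_integral_surface_measure:
  fixes F :: "'a::euclidean_space \<Rightarrow> ennreal"
  assumes [measurable]: "F \<in> borel_measurable borel"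
  shows "(\<integral>\<^sup>+y. F y \<partial>surface_measure) = DIM('a) * (\<integral>\<^sup>+x. indicator (ball 0 1) x * F (sgn x) \<partial>lborel)"
proof -
  let ?B = "ball (0::'a) 1 - {0}"
  let ?L = "restrict_space lborel ?B" and ?S = "restrict_space borel (sphere (0::'a) 1)"
  have sgn: "sgn \<in> ?L \<rightarrow>\<^sub>M ?S"
  proof (rule measurable_restrict_space2)
    show "sgn \<in> space ?L \<rightarrow> sphere 0 1" by (auto simp: space_restrict_space norm_sgn)
    have "(sgn :: 'a \<Rightarrow> 'a) \<in> borel_measurable lborel" by measurable
    then show "sgn \<in> ?L \<rightarrow>\<^sub>M borel" by (rule measurable_restrict_space1)
  qed
  have F: "F \<in> borel_measurable ?S" by (rule measurable_restrict_space1) simp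
  have "(\<integral>\<^sup>+y. F y \<partial>surface_measure) = DIM('a) * (\<integral>\<^sup>+y. F y \<partial>distr ?L ?S sgn)"
    unfolding surface_measure_def using F by (subst nn_integral_scale_measure) (simp_all add: measurable_distr_eq1)
  also have "(\<integral>\<^sup>+y. F y \<partial>distr ?L ?S sgn) = (\<integral>\<^sup>+x. F (sgn x) \<partial>?L)"
    using F by (intro nn_integral_distr[OF sgn]) (simp add: measurable_distr_eq1)
  also have "\<dots> = (\<integral>\<^sup>+x. F (sgn x) * indicator ?B x \<partial>lborel)"
    by (rule nn_integral_restrict_space) simp
  also have "\<dots> = (\<integral>\<^sup>+x. indicator (ball 0 1) x * F (sgn x) \<partial>lborel)"
    by (rule nn_integral_cong_AE, rule AE_mp[OF AE_lborel_negligible[OF negligible_sing[of 0]]])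
      (auto simp: indicator_def)
  finally show ?thesis .
qed

lemma integral_surface_measure:
  fixes F :: "'a::euclidean_space \<Rightarrow> real"
  assumes [measurable]: "F \<in> borel_measurable borel" and nonneg: "\<And>x. 0 \<le> F x"
  shows "(LINT y|surface_measure. F y) = DIM('a) * (LINT x|lborel. indicator (ball 0 1) x * F (sgn x))"
proof -
  have [measurable]: "(indicator (ball 0 1) :: 'a \<Rightarrow> real) \<in> borel_measurable borel"
    by (intro borel_measurable_indicator) simp
  have "F \<in> borel_measurable surface_measure"
    by (rule measurable_surface_measure) simp
  then have "(LINT y|surface_measure. F y) = enn2real (\<integral>\<^sup>+y. ennreal (F y) \<partial>surface_measure)"
    using nonneg by (intro integral_eq_nn_integral) auto
  also have "\<dots> = DIM('a) * enn2real (\<integral>\<^sup>+x. indicator (ball 0 1) x * ennreal (F (sgn x)) \<partial>lborel)"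
    by (subst nn_integral_surface_measure) (simp_all add: enn2real_mult)
  also have "(\<integral>\<^sup>+x. indicator (ball 0 1) x * ennreal (F (sgn x)) \<partial>lborel) =
      (\<integral>\<^sup>+x. ennreal (indicator (ball 0 1) x * F (sgn x)) \<partial>lborel)"
    by (intro nn_integral_cong) (simp add: indicator_def)
  also have "enn2real \<dots> = (LINT x|lborel. indicator (ball 0 1) x * F (sgn x))"
    using nonneg by (intro integral_eq_nn_integral[symmetric]) auto
  finally show ?thesis .
qed

context root_data
begin

definition mass :: real where "mass = sphere_mean (\<lambda>_. 1) 0"

lemma dunkl_d_eq_mass: "dunkl_d Rp k = mass"
  by (simp add: dunkl_d_def integral_surface_measure mass_def sphere_mean_def sphere_integrand_def)

text \<open>The weight vanishes only on the hyperplanes, a cone of measure zero.\<close>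

lemma mass_pos: "0 < mass"
proof -
  let ?I = "sphere_integrand (\<lambda>_. 1) 0"
  have nonneg: "0 \<le> ?I x" for x by (simp add: sphere_integrand_def)
  have int: "integrable lborel ?I" by (intro sphere_integrand_integrable continuous_intros) auto
  have "(LINT x|lborel. ?I x) \<noteq> 0"
  proof
    assume "(LINT x|lborel. ?I x) = 0"
    then have "AE x in lborel. ?I x = 0"
      using integral_nonneg_eq_0_iff_AE[OF int] nonneg by auto
    moreover note AE_regular
    moreover have "AE x in lborel. x \<noteq> (0::'a)"
      using AE_lborel_negligible[OF negligible_sing] by simp
    ultimately have "AE x in lborel. x \<notin> ball (0::'a) 1"
    proof eventually_elim
      case (elim x)
      have "sgn x \<in> regular"
        using elim(2,3) by (simp add: regular_def sgn_div_norm)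
      then have "0 < w (sgn x)" by (rule weight_pos)
      then show ?case using elim(1) by (auto simp: sphere_integrand_def)
    qed
    then have "emeasure lborel (ball (0::'a) 1) = 0"
    proof (subst (asm) AE_iff_measurable[of "ball 0 1"])
      show "{x \<in> space lborel. \<not> x \<notin> ball 0 1} = ball (0::'a) 1" by auto
    qed simp_all
    then show False using less_imp_neq[OF unit_ball_vol_pos[of "real DIM('a)"]] by (simp add: emeasure_ball)
  qed
  moreover have "0 \<le> (LINT x|lborel. ?I x)"
    by (rule integral_nonneg_AE) (simp add: nonneg)
  ultimately show ?thesis by (simp add: mass_def sphere_mean_def less_le)
qed

lemma dilation_norm_eq:
  assumes u: "C2_on (ball 0 1) u" and p: "1 < p" and s: "0 \<le> s" "s < 1"
  shows "dilation_norm Rp k p u s = sphere_mean (\<lambda>x. \<bar>u x\<bar> powr p) s powr (1 / p)"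
proof -
  interpret C2_function "ball 0 1" u using u by unfold_locales auto
  define U where "U x = (if x \<in> ball 0 1 then u x else 0)" for x
  have [measurable]: "U \<in> borel_measurable borel"
    unfolding U_def[abs_def] by (intro borel_measurable_continuous_on_if continuous_on_f) auto
  define F where "F y = w y * \<bar>U (s *\<^sub>R y)\<bar> powr p" for y
  have F_meas: "F \<in> borel_measurable borel" unfolding F_def[abs_def] by measurable
  have space: "space (surface_measure :: 'a measure) = sphere 0 1"
    using sets_eq_imp_space_eq[OF sets_surface_measure] by (simp add: space_restrict_space)
  have "(LINT y|weighted_surface_measure Rp k. \<bar>u (s *\<^sub>R y)\<bar> powr p) =
      (LINT y|weighted_surface_measure Rp k. \<bar>U (s *\<^sub>R y)\<bar> powr p)"
    using s by (intro Bochner_Integration.integral_cong)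
      (auto simp: weighted_surface_measure_def space U_def)
  also have "\<dots> = (LINT y|surface_measure. F y)"
    unfolding weighted_surface_measure_def
    by (subst integral_density) (auto intro!: measurable_surface_measure simp: F_def[abs_def])
  also have "\<dots> = DIM('a) * (LINT x|lborel. indicator (ball 0 1) x * F (sgn x))"
    by (rule integral_surface_measure[OF F_meas]) (simp add: F_def)
  also have "(\<lambda>x. indicator (ball 0 1) x * F (sgn x)) = sphere_integrand (\<lambda>x. \<bar>u x\<bar> powr p) s"
  proof
    fix x :: 'a
    have "s *\<^sub>R sgn x \<in> ball 0 1" using norm_scaleR_sgn_le[OF s(1), of x] s(2) by simp
    then show "indicator (ball 0 1) x * F (sgn x) = sphere_integrand (\<lambda>x. \<bar>u x\<bar> powr p) s x"
      by (simp add: F_def U_def sphere_integrand_def)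
  qed
  finally show ?thesis by (simp add: dilation_norm_def sphere_mean_def)
qed

text \<open>The integral of the Hardy--Stein integrand, divided by \<open>hom_dim - 2\<close>, as an extended real number.\<close>

definition stein_energy :: "real \<Rightarrow> ('a \<Rightarrow> real) \<Rightarrow> ('a \<Rightarrow> real) \<Rightarrow> ennreal" where
  "stein_energy p c u = (\<integral>\<^sup>+x. ennreal (green 1 x * (w x * stein p c u x)) \<partial>lborel)"

lemma stein_nonneg: "1 < p \<Longrightarrow> (\<And>\<alpha>. \<alpha> \<in> Rp \<Longrightarrow> 0 \<le> c \<alpha>) \<Longrightarrow> 0 \<le> stein p c u x"
  unfolding stein_def by (intro stein_density_nonneg power_second_nonneg bregman_F_nonneg)

lemma green_mono:
  assumes "2 < hom_dim" "0 < S" "S \<le> S'" shows "green S x \<le> green S' x"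
proof (cases "x \<noteq> 0 \<and> norm x < S")
  case True
  then show ?thesis using assms
    by (auto simp: green_def intro!: divide_right_mono diff_left_mono powr_mono2')
next
  case False
  then have "green S x = 0" by (auto simp: green_def)
  then show ?thesis using green_nonneg[OF assms(1)] by simp
qed

lemma jump_coeff_nonneg: "\<alpha> \<in> Rp \<Longrightarrow> 0 \<le> jump_coeff \<alpha>"
  using Rp_k_nonneg by simp

text \<open>The spherical means of \<open>\<bar>u\<bar> powr p\<close> are bounded exactly when the energy is finite, and then their supremum is
  determined by it.\<close>

lemma sphere_mean_bounded_iff:
  assumes dim: "2 < hom_dim" and p: "1 < p" and u: "C2_on (ball 0 1) u"
    and harmonic: "\<And>x. x \<in> ball 0 1 \<Longrightarrow> x \<in> regular \<Longrightarrow> dunkl_expr u x = 0"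
  shows "(\<forall>s\<in>{0..<1}. sphere_mean (\<lambda>x. \<bar>u x\<bar> powr p) s \<le> K) \<longleftrightarrow>
      \<bar>u 0\<bar> powr p * mass \<le> K \<and> stein_energy p jump_coeff u \<le> ennreal (K - \<bar>u 0\<bar> powr p * mass)"
    (is "?L \<longleftrightarrow> ?base \<le> K \<and> ?I \<le> _")
proof -
  let ?m = "sphere_mean (\<lambda>x. \<bar>u x\<bar> powr p)"
  define T where "T S x = ennreal (green S x * (w x * stein p jump_coeff u x))" for S x
  have m0: "?m 0 = ?base"
  proof -
    have "sphere_integrand (\<lambda>x. \<bar>u x\<bar> powr p) 0 x = \<bar>u 0\<bar> powr p * sphere_integrand (\<lambda>_. 1) 0 x" for x
      by (simp add: sphere_integrand_def)
    then show ?thesis by (simp add: sphere_mean_def mass_def)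
  qed
  have T_int: "integral\<^sup>N lborel (T S) = ennreal (?m S - ?base)" if "0 < S" "S < 1" for S
    using nn_integral_green_power[OF dim p u harmonic that] by (simp add: T_def[abs_def] mass_def)
  have I: "?I = integral\<^sup>N lborel (T 1)" by (simp add: stein_energy_def T_def[abs_def])
  have nonneg: "0 \<le> w x * stein p jump_coeff u x" for x
    by (rule mult_nonneg_nonneg[OF weight_nonneg stein_nonneg[OF p jump_coeff_nonneg]])
  have T_mono: "T S x \<le> T S' x" if "0 < S" "S \<le> S'" for S S' x
    unfolding T_def by (intro ennreal_leI mult_right_mono green_mono dim that nonneg)
  define S where "S n = 1 - 1 / real (n + 2)" for n
  have S: "0 < S n" "S n < 1" "S n \<le> S (Suc n)" for n
    by (auto simp: S_def divide_less_eq intro: divide_left_mono)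
  have S1: "S \<longlonglongrightarrow> 1"
    unfolding S_def[abs_def] using tendsto_diff[OF tendsto_const LIMSEQ_ignore_initial_segment[OF lim_const_over_n[of 1], of 2], of 1]
    by simp
  have T_meas: "T S \<in> borel_measurable lborel" if "S \<le> 1" for S
  proof -
    have "(\<lambda>x. green S x * (w x * stein p jump_coeff u x)) \<in> borel_measurable borel"
      unfolding stein_def using bregman_F_measurable[OF p] that
      by (intro green_stein_measurable u) auto
    then show ?thesis unfolding T_def[abs_def] by measurable
  qed
  have lim: "(\<lambda>n. integral\<^sup>N lborel (T (S n))) \<longlonglongrightarrow> ?I"
    unfolding I
  proof (rule nn_integral_LIMSEQ)
    show "incseq (\<lambda>n. T (S n))" by (intro incseq_SucI le_funI T_mono S)
    show "T (S n) \<in> borel_measurable lborel" for n using S(2)[of n] by (intro T_meas) simp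
    fix x
    show "(\<lambda>n. T (S n) x) \<longlonglongrightarrow> T 1 x"
    proof (cases "x \<noteq> 0 \<and> norm x < 1")
      case True
      have "eventually (\<lambda>n. norm x < S n) sequentially"
        using order_tendstoD(1)[OF S1] True by blast
      then have "eventually (\<lambda>n. (norm x powr (2 - hom_dim) - S n powr (2 - hom_dim)) / (hom_dim - 2) = green (S n) x) sequentially"
        by eventually_elim (use True in \<open>simp add: green_def\<close>)
      moreover have "(\<lambda>n. (norm x powr (2 - hom_dim) - S n powr (2 - hom_dim)) / (hom_dim - 2)) \<longlonglongrightarrow>
          (norm x powr (2 - hom_dim) - 1 powr (2 - hom_dim)) / (hom_dim - 2)"
        using dim by (intro tendsto_intros S1) auto
      ultimately have "(\<lambda>n. green (S n) x) \<longlonglongrightarrow> green 1 x"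
        using True by (simp add: green_def[of 1] Lim_transform_eventually)
      then show ?thesis unfolding T_def by (intro tendsto_ennrealI tendsto_mult tendsto_const)
    next
      case False
      then have "green (S n) x = 0" "green 1 x = 0" for n
        using S(2)[of n] by (auto simp: green_def)
      then show ?thesis by (simp add: T_def)
    qed
  qed
  show ?thesis
  proof
    assume L: ?L
    have "?base \<le> K" using L m0 by force
    moreover have "?I \<le> ennreal (K - ?base)"
    proof (rule LIMSEQ_le_const2[OF lim])
      show "\<exists>N. \<forall>n\<ge>N. integral\<^sup>N lborel (T (S n)) \<le> ennreal (K - ?base)"
        using L S by (intro exI[of _ 0] allI impI) (auto simp: T_int less_imp_le intro!: ennreal_leI)
    qed
    ultimately show "?base \<le> K \<and> ?I \<le> ennreal (K - ?base)" ..
  next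
    assume K: "?base \<le> K \<and> ?I \<le> ennreal (K - ?base)"
    show ?L
    proof
      fix s :: real assume s: "s \<in> {0..<1}"
      show "?m s \<le> K"
      proof (cases "s = 0")
        case True
        then show ?thesis using K m0 by simp
      next
        case False
        then have "ennreal (?m s - ?base) = integral\<^sup>N lborel (T s)" using s by (simp add: T_int)
        also have "\<dots> \<le> ?I" unfolding I using s False by (intro nn_integral_mono T_mono) auto
        also have "\<dots> \<le> ennreal (K - ?base)" using K by simp
        finally have "?m s - ?base \<le> K - ?base" using K by (simp add: ennreal_le_iff)
        then show ?thesis by simp
      qed
    qed
  qed
qed

text \<open>The jump coefficients only matter up to bounded factors for finiteness.\<close>

lemma stein_energy_finite_compare:
  assumes dim: "2 < hom_dim" and p: "1 < p"
    and c: "\<And>\<alpha>. \<alpha> \<in> Rp \<Longrightarrow> 0 \<le> c \<alpha>" "\<And>\<alpha>. \<alpha> \<in> Rp \<Longrightarrow> c \<alpha> \<le> M * c' \<alpha>" and M: "1 \<le> M"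
    and u: "C2_on (ball 0 1) u" and finite: "stein_energy p c' u < \<infinity>"
  shows "stein_energy p c u < \<infinity>"
proof -
  have le: "stein p c u x \<le> M * stein p c' u x" for x
  proof -
    have "1 * (power_second p (u x) * (norm (gradient u x))\<^sup>2) \<le> M * (power_second p (u x) * (norm (gradient u x))\<^sup>2)"
      using M power_second_nonneg[OF p] by (intro mult_right_mono) auto
    moreover have "(\<Sum>\<alpha>\<in>Rp. c \<alpha> * (bregman_F p (u x) (u (reflection \<alpha> x)) / (\<alpha> \<bullet> x)\<^sup>2)) \<le>
        (\<Sum>\<alpha>\<in>Rp. M * c' \<alpha> * (bregman_F p (u x) (u (reflection \<alpha> x)) / (\<alpha> \<bullet> x)\<^sup>2))"
      using c bregman_F_nonneg[OF p] by (intro sum_mono mult_right_mono divide_nonneg_nonneg) auto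
    ultimately show ?thesis
      unfolding stein_def stein_density_def distrib_left sum_distrib_left by (simp add: mult.assoc)
  qed
  have "(\<lambda>x. green 1 x * (w x * stein p c' u x)) \<in> borel_measurable borel"
    unfolding stein_def using bregman_F_measurable[OF p] by (intro green_stein_measurable u) auto
  then have [measurable]: "(\<lambda>x. ennreal (green 1 x * (w x * stein p c' u x))) \<in> borel_measurable lborel"
    by measurable
  have "stein_energy p c u \<le> (\<integral>\<^sup>+x. ennreal M * ennreal (green 1 x * (w x * stein p c' u x)) \<partial>lborel)"
    unfolding stein_energy_def
  proof (rule nn_integral_mono)
    fix x
    have "green 1 x * (w x * stein p c u x) \<le> green 1 x * (w x * (M * stein p c' u x))"
      by (intro mult_left_mono le green_nonneg dim weight_nonneg)
    then have "ennreal (green 1 x * (w x * stein p c u x)) \<le> ennreal (M * (green 1 x * (w x * stein p c' u x)))"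
      by (intro ennreal_leI) (simp add: ac_simps)
    also have "\<dots> = ennreal M * ennreal (green 1 x * (w x * stein p c' u x))"
      using M by (intro ennreal_mult') simp
    finally show "ennreal (green 1 x * (w x * stein p c u x)) \<le> ennreal M * ennreal (green 1 x * (w x * stein p c' u x))" .
  qed
  also have "\<dots> = ennreal M * stein_energy p c' u"
    unfolding stein_energy_def by (rule nn_integral_cmult) measurable
  also have "\<dots> < \<infinity>" using finite by (simp add: ennreal_mult_less_top)
  finally show ?thesis .
qed

abbreviation unit_jump :: "'a \<Rightarrow> real" where "unit_jump \<alpha> \<equiv> k \<alpha> * 2"

lemma stein_energy_unit_iff:
  assumes dim: "2 < hom_dim" and p: "1 < p" and u: "C2_on (ball 0 1) u"
  shows "stein_energy p unit_jump u < \<infinity> \<longleftrightarrow> stein_energy p jump_coeff u < \<infinity>"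
proof -
  \<comment> \<open>A common bound for the ratios of \<open>2\<close> and \<open>\<alpha> \<bullet> \<alpha>\<close> in both directions.\<close>
  define M where "M = 1 + (\<Sum>\<alpha>\<in>Rp. 2 / (\<alpha> \<bullet> \<alpha>) + (\<alpha> \<bullet> \<alpha>) / 2)"
  have M: "2 / (\<alpha> \<bullet> \<alpha>) \<le> M" "(\<alpha> \<bullet> \<alpha>) / 2 \<le> M" if "\<alpha> \<in> Rp" for \<alpha>
  proof -
    have "2 / (\<alpha> \<bullet> \<alpha>) + (\<alpha> \<bullet> \<alpha>) / 2 \<le> (\<Sum>\<alpha>\<in>Rp. 2 / (\<alpha> \<bullet> \<alpha>) + (\<alpha> \<bullet> \<alpha>) / 2)"
      using that by (intro member_le_sum) auto
    moreover have "0 \<le> 2 / (\<alpha> \<bullet> \<alpha>)" "0 \<le> (\<alpha> \<bullet> \<alpha>) / 2" by auto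
    ultimately show "2 / (\<alpha> \<bullet> \<alpha>) \<le> M" "(\<alpha> \<bullet> \<alpha>) / 2 \<le> M" unfolding M_def by linarith+
  qed
  have M1: "1 \<le> M" by (auto simp: M_def intro!: sum_nonneg)
  have unit_le: "unit_jump \<alpha> \<le> M * jump_coeff \<alpha>" if "\<alpha> \<in> Rp" for \<alpha>
  proof -
    have "2 \<le> M * (\<alpha> \<bullet> \<alpha>)" using M(1)[OF that] Rp_nonzero[OF that] by (simp add: divide_le_eq)
    from mult_left_mono[OF this Rp_k_nonneg[OF that]] show ?thesis by (simp add: ac_simps)
  qed
  have jump_le: "jump_coeff \<alpha> \<le> M * unit_jump \<alpha>" if "\<alpha> \<in> Rp" for \<alpha>
    using mult_left_mono[OF M(2)[OF that] Rp_k_nonneg[OF that]] by (simp add: ac_simps)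
  show ?thesis
    using stein_energy_finite_compare[OF dim p _ unit_le M1 u]
      stein_energy_finite_compare[OF dim p jump_coeff_nonneg jump_le M1 u] Rp_k_nonneg by auto
qed

text \<open>At the origin the left-hand side has the value of \<open>0 powr (2 - hom_dim) = 0\<close> in place of an infinite one.\<close>

lemma hardy_stein_integrand_eq:
  assumes dim: "2 < hom_dim" and x: "x \<noteq> 0"
  shows "indicator (ball 0 1) x *\<^sub>R hardy_stein_integrand Rp k p u x =
      (hom_dim - 2) * (green 1 x * (w x * stein p unit_jump u x))"
proof -
  have "2 * (\<Sum>\<alpha>\<in>Rp. k \<alpha> * (bregman_F p (u x) (u (reflection \<alpha> x)) / (\<alpha> \<bullet> x)\<^sup>2)) =
      (\<Sum>\<alpha>\<in>Rp. unit_jump \<alpha> * (bregman_F p (u x) (u (reflection \<alpha> x)) / (\<alpha> \<bullet> x)\<^sup>2))"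
    unfolding sum_distrib_left by (intro sum.cong) auto
  then have "hardy_stein_integrand Rp k p u x =
      (norm x powr (2 - hom_dim) - 1) * stein p unit_jump u x * w x"
    unfolding hardy_stein_integrand_def stein_def stein_density_def power_second_def
    by (simp only: diff_diff_add add.commute[of "2 * dunkl_gamma Rp k"])
  then show ?thesis using dim x by (simp add: green_def indicator_def ac_simps)
qed

lemma hardy_stein_integrand_measurable:
  assumes u: "C2_on (ball 0 1) u" and p: "1 < p"
  shows "(\<lambda>x. indicator (ball 0 1) x *\<^sub>R hardy_stein_integrand Rp k p u x) \<in> borel_measurable borel"
proof -
  have [measurable]: "(\<lambda>x. indicator (ball 0 1) x * stein p unit_jump u x) \<in> borel_measurable borel"
    unfolding stein_def using bregman_F_measurable[OF p] by (intro stein_density_measurable u) auto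
  have "(\<lambda>x. indicator (ball 0 1) x *\<^sub>R hardy_stein_integrand Rp k p u x) =
      (\<lambda>x. (norm x powr (2 - 2 * dunkl_gamma Rp k - real DIM('a)) - 1) *
        (indicator (ball 0 1) x * stein p unit_jump u x) * w x)"
    unfolding hardy_stein_integrand_def stein_def stein_density_def power_second_def
    by (intro ext) (simp add: sum_distrib_left ac_simps)
  also have "\<dots> \<in> borel_measurable borel" by measurable
  finally show ?thesis .
qed

lemma hardy_stein_integral:
  assumes dim: "2 < hom_dim" and p: "1 < p" and u: "C2_on (ball 0 1) u"
  shows "set_integrable lborel (ball 0 1) (hardy_stein_integrand Rp k p u) \<longleftrightarrow> stein_energy p unit_jump u < \<infinity>"
    and "(LINT y:ball 0 1|lborel. hardy_stein_integrand Rp k p u y) =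
      (hom_dim - 2) * enn2real (stein_energy p unit_jump u)"
proof -
  define D where "D x = green 1 x * (w x * stein p unit_jump u x)" for x
  have D_meas [measurable]: "D \<in> borel_measurable lborel"
  proof -
    have "D \<in> borel_measurable borel" unfolding D_def[abs_def] stein_def using bregman_F_measurable[OF p]
      by (intro green_stein_measurable u) auto
    then show ?thesis by simp
  qed
  have D_nonneg: "0 \<le> D x" for x
    unfolding D_def using Rp_k_nonneg by (intro mult_nonneg_nonneg green_nonneg dim weight_nonneg stein_nonneg p) auto
  have eq: "AE x in lborel. indicator (ball 0 1) x *\<^sub>R hardy_stein_integrand Rp k p u x = (hom_dim - 2) * D x"
    using AE_lborel_negligible[OF negligible_sing[of 0]]
    by eventually_elim (use hardy_stein_integrand_eq[OF dim] in \<open>simp add: D_def\<close>)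
  have meas: "(\<lambda>x. indicator (ball 0 1) x *\<^sub>R hardy_stein_integrand Rp k p u x) \<in> borel_measurable lborel"
    using hardy_stein_integrand_measurable[OF u p] by (simp only: measurable_lborel2)
  have energy: "stein_energy p unit_jump u = (\<integral>\<^sup>+x. ennreal (D x) \<partial>lborel)"
    by (simp add: stein_energy_def D_def)
  have "set_integrable lborel (ball 0 1) (hardy_stein_integrand Rp k p u) \<longleftrightarrow>
      integrable lborel (\<lambda>x. (hom_dim - 2) * D x)"
    unfolding set_integrable_def by (rule integrable_cong_AE[OF meas _ eq]) measurable
  also have "\<dots> \<longleftrightarrow> integrable lborel D" using dim by simp
  also have "\<dots> \<longleftrightarrow> stein_energy p unit_jump u < \<infinity>"
    using D_nonneg by (simp add: integrable_iff_bounded energy)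
  finally show "set_integrable lborel (ball 0 1) (hardy_stein_integrand Rp k p u) \<longleftrightarrow>
      stein_energy p unit_jump u < \<infinity>" .
  have "(LINT y:ball 0 1|lborel. hardy_stein_integrand Rp k p u y) = (LINT x|lborel. (hom_dim - 2) * D x)"
    unfolding set_lebesgue_integral_def by (rule integral_cong_AE[OF meas _ eq]) measurable
  also have "\<dots> = (hom_dim - 2) * (LINT x|lborel. D x)" by simp
  also have "(LINT x|lborel. D x) = enn2real (stein_energy p unit_jump u)"
    unfolding energy using D_nonneg by (intro integral_eq_nn_integral) auto
  finally show "(LINT y:ball 0 1|lborel. hardy_stein_integrand Rp k p u y) =
      (hom_dim - 2) * enn2real (stein_energy p unit_jump u)" .
qed

text \<open>All bounds for the norms of the dilations are bounds for the spherical means; the least one is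
  read off from the equivalence above.\<close>

lemma hardy_space_iff:
  assumes dim: "2 < hom_dim" and p: "1 < p" and u: "dunkl_harmonic_on Rp k (ball 0 1) u"
  shows "u \<in> hardy_space Rp k p \<longleftrightarrow> stein_energy p jump_coeff u < \<infinity>"
    and "u \<in> hardy_space Rp k p \<Longrightarrow>
      hardy_norm Rp k p u powr p = \<bar>u 0\<bar> powr p * mass + enn2real (stein_energy p jump_coeff u)"
proof -
  let ?m = "sphere_mean (\<lambda>x. \<bar>u x\<bar> powr p)"
  let ?base = "\<bar>u 0\<bar> powr p * mass" and ?I = "stein_energy p jump_coeff u"
  have C2: "C2_on (ball 0 1) u" using u by (simp add: dunkl_harmonic_on_def)
  have harmonic: "dunkl_expr u x = 0" if "x \<in> ball 0 1" "x \<in> regular" for x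
    using dunkl_laplacian_eq_dunkl_expr[OF open_ball _ C2 that] u that by (simp add: dunkl_harmonic_on_def)
  note iff = sphere_mean_bounded_iff[OF dim p C2 harmonic]
  have m_nonneg: "0 \<le> ?m s" for s
    unfolding sphere_mean_def sphere_integrand_def
    by (intro mult_nonneg_nonneg integral_nonneg_AE AE_I2) auto
  have norm_le: "dilation_norm Rp k p u s \<le> K \<longleftrightarrow> ?m s \<le> K powr p" if s: "s \<in> {0..<1}" and K: "0 \<le> K" for s K
  proof -
    have "dilation_norm Rp k p u s = ?m s powr (1 / p)" using s by (intro dilation_norm_eq C2 p) auto
    moreover have "?m s = (?m s powr (1 / p)) powr p" using m_nonneg[of s] p by (simp add: powr_powr)
    moreover have "?m s powr (1 / p) \<le> K \<longleftrightarrow> (?m s powr (1 / p)) powr p \<le> K powr p"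
      using K p powr_mono2[of p "?m s powr (1 / p)" K] powr_less_mono2[of p K "?m s powr (1 / p)"]
      by (cases "?m s powr (1 / p) \<le> K") (auto simp: not_le)
    ultimately show ?thesis by simp
  qed
  have bdd_iff: "(\<forall>s\<in>{0..<1}. dilation_norm Rp k p u s \<le> K) \<longleftrightarrow> ?base \<le> K powr p \<and> ?I \<le> ennreal (K powr p - ?base)"
    if K: "0 \<le> K" for K
    using iff[of "K powr p"] norm_le[OF _ K] by simp
  have nonneg: "0 \<le> dilation_norm Rp k p u s" for s by (simp add: dilation_norm_def)
  have m0_nonneg: "0 \<le> ?base" using mass_pos by simp
  have "u \<in> hardy_space Rp k p \<longleftrightarrow> (\<exists>K. \<forall>s\<in>{0..<1}. dilation_norm Rp k p u s \<le> K)"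
    using u by (auto simp: hardy_space_def bdd_above_def)
  also have "\<dots> \<longleftrightarrow> (\<exists>K\<ge>0. \<forall>s\<in>{0..<1}. dilation_norm Rp k p u s \<le> K)"
    by (meson abs_ge_self abs_ge_zero order_trans)
  finally have hardy: "u \<in> hardy_space Rp k p \<longleftrightarrow> (\<exists>K\<ge>0. \<forall>s\<in>{0..<1}. dilation_norm Rp k p u s \<le> K)" .
  \<comment> \<open>The least bound of the norms of the dilations if the energy is finite.\<close>
  define K0 where "K0 = (?base + enn2real ?I) powr (1 / p)"
  have K0: "0 \<le> K0" "K0 powr p = ?base + enn2real ?I"
    using m0_nonneg p by (simp_all add: K0_def powr_powr)
  have K0_bound: "\<forall>s\<in>{0..<1}. dilation_norm Rp k p u s \<le> K0" if "?I < \<infinity>"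
    using that by (simp add: bdd_iff[OF K0(1)] K0(2) less_top)
  show space: "u \<in> hardy_space Rp k p \<longleftrightarrow> ?I < \<infinity>"
  proof
    assume "u \<in> hardy_space Rp k p"
    then obtain K where "?I \<le> ennreal (K powr p - ?base)" using hardy bdd_iff by blast
    then show "?I < \<infinity>" by (rule le_less_trans) simp
  next
    assume "?I < \<infinity>"
    then show "u \<in> hardy_space Rp k p" using hardy K0_bound K0(1) by blast
  qed
  assume "u \<in> hardy_space Rp k p"
  then have I: "?I < \<infinity>" and bdd: "bdd_above (dilation_norm Rp k p u ` {0..<1})"
    using space by (auto simp: hardy_space_def)
  let ?K = "hardy_norm Rp k p u"
  have upper: "\<forall>s\<in>{0..<1}. dilation_norm Rp k p u s \<le> ?K"
    unfolding hardy_norm_def using bdd by (auto intro: cSUP_upper)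
  have K_nonneg: "0 \<le> ?K" using upper nonneg[of 0] by (auto intro: order_trans)
  have "?K \<le> K0" unfolding hardy_norm_def using K0_bound[OF I] by (intro cSUP_least) auto
  then have "?K powr p \<le> ?base + enn2real ?I"
    using powr_mono2[of p ?K K0] K_nonneg p K0(2) by simp
  moreover have "?base + enn2real ?I \<le> ?K powr p"
  proof -
    have le: "?base \<le> ?K powr p" "?I \<le> ennreal (?K powr p - ?base)"
      using bdd_iff[OF K_nonneg] upper by auto
    then have "enn2real ?I \<le> ?K powr p - ?base" by (intro enn2real_leI) auto
    then show ?thesis by simp
  qed
  ultimately show "?K powr p = ?base + enn2real ?I" by simp
qed

end

theorem theorem4p5:
  fixes R Rp :: "'a::euclidean_space set" and k :: "'a \<Rightarrow> real" and p :: real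
  assumes "root_system R"
    and "positive_subsystem R Rp"
    and "multiplicity_function R k"
    and "real DIM('a) + 2 * dunkl_gamma Rp k > 2"
    and "1 < p"
  shows "((\<forall>\<alpha>\<in>R. \<alpha> \<bullet> \<alpha> = 2) \<longrightarrow>
           (\<forall>u\<in>hardy_space Rp k p.
              (1 / dunkl_d Rp k) * hardy_norm Rp k p u powr p =
                \<bar>u 0\<bar> powr p + dunkl_C Rp k *
                  (LINT y:ball 0 1|lborel. hardy_stein_integrand Rp k p u y)))
       \<and> (\<forall>u. dunkl_harmonic_on Rp k (ball 0 1) u \<longrightarrow>
           (u \<in> hardy_space Rp k p \<longleftrightarrow>
            set_integrable lborel (ball 0 1) (hardy_stein_integrand Rp k p u)))"
proof -
  interpret root_data R Rp k using assms(1-3) by unfold_locales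
  note dim = assms(4) and p = assms(5)
  show ?thesis
  proof (intro conjI impI ballI allI)
    fix u assume normalized: "\<forall>\<alpha>\<in>R. \<alpha> \<bullet> \<alpha> = 2" and u: "u \<in> hardy_space Rp k p"
    then have harmonic: "dunkl_harmonic_on Rp k (ball 0 1) u" by (simp add: hardy_space_def)
    then have C2: "C2_on (ball 0 1) u" by (simp add: dunkl_harmonic_on_def)
    have "stein p jump_coeff u = stein p unit_jump u"
      using normalized Rp_R by (auto simp: stein_def stein_density_def fun_eq_iff intro!: sum.cong)
    then have "stein_energy p jump_coeff u = stein_energy p unit_jump u" by (simp add: stein_energy_def)
    then have "hardy_norm Rp k p u powr p = \<bar>u 0\<bar> powr p * mass + enn2real (stein_energy p unit_jump u)"
      using hardy_space_iff(2)[OF dim p harmonic u] by simp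
    then show "(1 / dunkl_d Rp k) * hardy_norm Rp k p u powr p =
        \<bar>u 0\<bar> powr p + dunkl_C Rp k * (LINT y:ball 0 1|lborel. hardy_stein_integrand Rp k p u y)"
      using mass_pos dim
      by (simp add: hardy_stein_integral(2)[OF dim p C2] dunkl_C_def dunkl_d_eq_mass add_divide_distrib)
  next
    fix u assume harmonic: "dunkl_harmonic_on Rp k (ball 0 1) u"
    then have C2: "C2_on (ball 0 1) u" by (simp add: dunkl_harmonic_on_def)
    show "u \<in> hardy_space Rp k p \<longleftrightarrow> set_integrable lborel (ball 0 1) (hardy_stein_integrand Rp k p u)"
      using hardy_space_iff(1)[OF dim p harmonic] stein_energy_unit_iff[OF dim p C2]
        hardy_stein_integral(1)[OF dim p C2] by simp
  qed
qed

end
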